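(* Let $r\geq 1$, $\delta\geq 0$ and $\Phi\in\mathfrak{F}_{r,\delta}$. Let $u\in A_1$ and let $v$ be a weight on $\mathbb{R}^n$ such that $v^r\in A_\infty$. Then there exists $\varepsilon_0>0$ such that for every $0<\varepsilon<\varepsilon_0$ there is a constant $C>0$ (depending on $\varepsilon$, but not on $t$ or $f$) for which the inequality \[uv^r\left(\left\{x\in \mathbb{R}^n: \frac{M_\Phi(fv)(x)}{M_\Phi v(x)}>t\right\}\right)\leq C\int_{\mathbb{R}^n}\left(\eta_\varepsilon\circ \Phi\right)\left(\frac{|f(x)|}{t}\right)u(x)v^r(x)\,dx\] holds for every $t>0$ and every measurable function $f$ on $\mathbb{R}^n$, where $\eta_\varepsilon(z)=z(1+\log^+z)^{\delta/\varepsilon}$.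
   Context: A weight is a nonnegative locally integrable function on $\mathbb{R}^n$ that is positive almost everywhere. Cubes have sides parallel to the coordinate axes. For a nonnegative function $w$ and a measurable set $E$, $w(E)=\int_E w$; in particular $uv^r(E)=\int_E u v^r\,dx$. $\log^+z=\max\{0,\log z\}$ (with $\log^+0=0$). $A_1$ is the Muckenhoupt class of weights $w$ for which there is $C>0$ with $\frac1{|Q|}\int_Q w\le C\,w(x)$ for almost every $x\in Q$ and every cube $Q$. A weight $w$ belongs to $A_\infty$ if there is $C>0$ such that $\left(\frac{1}{|Q|}\int_Q w\right)\exp\left(\frac{1}{|Q|}\int_Q \log w^{-1}\right)\leq C$ for every cube $Q$. A Young function is a convex, increasing function $\Phi:[0,\infty)\to[0,\infty)$ with $\Phi(0)=0$ and $\Phi(t)\to\infty$ as $t\to\infty$. It is submultiplicative if $\Phi(st)\le\Phi(s)\Phi(t)$ for all $s,t>0$. It has lower type $r$ if there is $C>0$ with $\Phi(st)\le C s^r\Phi(t)$ for all $0<s\le1$ and $t>0$. For $r\ge1$, $\delta\ge0$, $\mathfrak{F}_{r,\delta}$ is the family of Young functions $\Phi$ that are submultiplicative, have lower type $r$, and satisfy $\frac{\Phi(t)}{t^r}\le C_0(\log t)^\delta$ for all $t\ge t^*$, for some constants $C_0>0$ and $t^*\ge1$. For a cube $Q$, the Luxemburg average is $\|f\|_{\Phi,Q}=\inf\left\{\lambda>0:\frac1{|Q|}\int_Q\Phi\left(\frac{|f|}{\lambda}\right)\le1\right\}$, and the generalized maximal operator is $M_\Phi f(x)=\sup_{Q\ni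 x}\|f\|_{\Phi,Q}$, the supremum being over all cubes $Q$ containing $x$. *)

theory Defs
  imports "HOL-Analysis.Analysis"
begin

section \<open>Cubes, averages and weights\<close>

definition cube :: "(real^'n) set \<Rightarrow> bool" where
  "cube Q \<longleftrightarrow> (\<exists>a l. l > 0 \<and> Q = cbox a (\<chi> i. a $ i + l))"

definition avg :: "(real^'n) set \<Rightarrow> (real^'n \<Rightarrow> real) \<Rightarrow> real" where
  "avg Q w = (LINT x:Q|lebesgue. w x) / measure lebesgue Q"

definition weight :: "(real^'n \<Rightarrow> real) \<Rightarrow> bool" where
  "weight w \<longleftrightarrow> (\<forall>x. 0 \<le> w x) \<and> (\<forall>K. compact K \<longrightarrow> w absolutely_integrable_on K)
     \<and> (AE x in lebesgue. 0 < w x)"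

definition weighted_measure :: "(real^'n \<Rightarrow> real) \<Rightarrow> (real^'n) set \<Rightarrow> ennreal" where
  "weighted_measure w E = (\<integral>\<^sup>+x\<in>E. ennreal (w x) \<partial>lebesgue)"

definition muckenhoupt_A1 :: "(real^'n \<Rightarrow> real) \<Rightarrow> bool" where
  "muckenhoupt_A1 w \<longleftrightarrow> weight w \<and>
     (\<exists>C>0. \<forall>Q. cube Q \<longrightarrow> (AE x in lebesgue. x \<in> Q \<longrightarrow> avg Q w \<le> C * w x))"

text \<open>For a weight \<open>w\<close> the positive part of \<open>ln w\<close> is locally integrable, so the average
  of \<open>ln (1 / w)\<close> over a cube always exists in \<open>(-\<infinity>, \<infinity>]\<close>, and the bound below
  forces it to be finite. As the Bochner integral of a non-integrable function is \<open>0\<close>,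
  finiteness has to be stated explicitly.\<close>

definition muckenhoupt_A_infinity :: "(real^'n \<Rightarrow> real) \<Rightarrow> bool" where
  "muckenhoupt_A_infinity w \<longleftrightarrow> weight w \<and>
     (\<exists>C>0. \<forall>Q. cube Q \<longrightarrow>
        (\<lambda>x. ln (inverse (w x))) absolutely_integrable_on Q \<and>
        avg Q w * exp (avg Q (\<lambda>x. ln (inverse (w x)))) \<le> C)"


section \<open>Young functions\<close>

text \<open>A function on \<open>[0, \<infinity>)\<close> is represented by a function on the reals; its values at negative
  arguments are irrelevant.\<close>

definition young_function :: "(real \<Rightarrow> real) \<Rightarrow> bool" where
  "young_function \<Phi> \<longleftrightarrow> \<Phi> ` {0..} \<subseteq> {0..} \<and> convex_on {0..} \<Phi> \<and> mono_on {0..} \<Phi>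
     \<and> \<Phi> 0 = 0 \<and> filterlim \<Phi> at_top at_top"

definition submultiplicative :: "(real \<Rightarrow> real) \<Rightarrow> bool" where
  "submultiplicative \<Phi> \<longleftrightarrow> (\<forall>s>0. \<forall>t>0. \<Phi> (s * t) \<le> \<Phi> s * \<Phi> t)"

definition lower_type :: "real \<Rightarrow> (real \<Rightarrow> real) \<Rightarrow> bool" where
  "lower_type r \<Phi> \<longleftrightarrow>
     (\<exists>C>0. \<forall>s t. 0 < s \<and> s \<le> 1 \<and> 0 < t \<longrightarrow> \<Phi> (s * t) \<le> C * s powr r * \<Phi> t)"

text \<open>For \<open>\<delta> = 0\<close> the convention \<open>0 powr 0 = 0\<close> only affects the point \<open>t = 1\<close>, hence it does
  not change the class: \<open>t0\<close> may always be enlarged.\<close>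

definition young_class :: "real \<Rightarrow> real \<Rightarrow> (real \<Rightarrow> real) set" where
  "young_class r \<delta> = {\<Phi>. young_function \<Phi> \<and> submultiplicative \<Phi> \<and> lower_type r \<Phi> \<and>
     (\<exists>C0>0. \<exists>t0\<ge>1. \<forall>t\<ge>t0. \<Phi> t / t powr r \<le> C0 * ln t powr \<delta>)}"

definition log_plus :: "real \<Rightarrow> real" where
  "log_plus z = (if z = 0 then 0 else max 0 (ln z))"

definition eta :: "real \<Rightarrow> real \<Rightarrow> real \<Rightarrow> real" where
  "eta \<delta> \<epsilon> z = z * (1 + log_plus z) powr (\<delta> / \<epsilon>)"


section \<open>The generalized maximal operator\<close>

text \<open>Both quantities take values in \<open>[0, \<infinity>]\<close>; the infimum of the empty set is \<open>\<infinity>\<close>.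
  The maximal function of a weight may be infinite (e.g. for \<open>\<bar>x\<bar>\<close>); division in \<open>ennreal\<close> gives
  \<open>a / \<infinity> = 0\<close> for every \<open>a\<close>, including \<open>\<infinity>\<close>, so that \<open>a / b > t\<close> agrees with \<open>a > t * b\<close>
  whenever \<open>b > 0\<close> and \<open>t > 0\<close>.\<close>

definition luxemburg_avg :: "(real \<Rightarrow> real) \<Rightarrow> (real^'n) set \<Rightarrow> (real^'n \<Rightarrow> real) \<Rightarrow> ennreal" where
  "luxemburg_avg \<Phi> Q f = Inf {ennreal k | k. k > 0 \<and>
     (\<integral>\<^sup>+x\<in>Q. ennreal (\<Phi> (\<bar>f x\<bar> / k)) \<partial>lebesgue) / emeasure lebesgue Q \<le> 1}"

definition maximal_op :: "(real \<Rightarrow> real) \<Rightarrow> (real^'n \<Rightarrow> real) \<Rightarrow> real^'n \<Rightarrow> ennreal" where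
  "maximal_op \<Phi> f x = (SUP Q \<in> {Q. cube Q \<and> x \<in> Q}. luxemburg_avg \<Phi> Q f)"

end

(* With w = v^r, cubes are replaced by dyadic cubes p and their triples 3p (the union of the 3^n
   neighbours of p). At a point x of the set in question let 2^j be comparable to the maximal
   function of w at x, and let p be the maximal dyadic cube (of bounded generation) on which the
   average of Phi(c |f| v / (t 2^(j/r))) exceeds 6^(-n), where x lies in 3p. The denominator
   M_Phi v forces the average of w over 3p to be 2^(j-m) with m >= 0, up to constants.

   - Splitting 3p at a suitable height of w, the power decay of u gives the factor 2^(-c m) in
       uw(3p inter {w <= 2^(j+1)}) <= C 2^(-c m) 2^j u(3p),
     so m may be fixed.
   - Since Phi(s z) <= A z^r eta(Phi s) + B z^(r(1+kappa)) for epsilon < 1, the reverse Hoelder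
     inequality for w absorbs the last term and yields 2^j |p| <= C int_p eta(Phi(|f|/t)) w.
   - For fixed m and fixed 2^i comparable to the average of u over 3p, the stopping cubes inside a
     maximal one p0 are grouped according to j: those of level j0 + l are disjoint and have total
     volume at most C 2^(-l) |p0|, so the power decay of w sums the contributions to C 2^j0 |p0|.
   - The maximal cubes for fixed i are disjoint and 2^i <= C u on them by the A_1 condition;
     summing the geometric series in i gives back u. *)
theory Submission
  imports Defs "HOL-Real_Asymp.Real_Asymp"
begin


section \<open>The dyadic grid\<close>

text \<open>The product of u and \<open>w\<close> need not be locally integrable (both may have a
  power singularity at the same point), so uw itself cannot serve as a reference measure on cubes.
  What saves the estimate is that, off a null set, \<open>w x\<close> is at most the maximal
  function of \<open>w\<close>: only the part of 3p where \<open>w\<close> is at most 2^(j+1) has to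
  be measured, and there the two weights can be separated. A second obstacle is that the level 2^j
  depends on the point. Fixing m makes the level a function of the cube, j = \<open>tau w p\<close>
  + m, but cubes of different levels may be nested. A larger level is a more demanding stopping
  condition, so inside a selected cube the other selected cubes have at least the same
  \<open>tau w\<close>; this is what makes nested cubes summable. The averages of u over nested
  cubes obey no such order, hence the separate binning by 2^i. The threshold 6^(-n) pays 3^n for the
  neighbours of a dyadic cube and 2^n for rounding a side length up to a power of two.\<close>

type_synonym 'n dindex = "int \<times> (int ^ 'n)"

definition cell :: "int \<Rightarrow> real^'n \<Rightarrow> int^'n" where
  "cell k x = (\<chi> i. \<lfloor>x $ i / 2 powi k\<rfloor>)"

text \<open>Half-open, so that every generation partitions the space. The generation
  \<open>fst p\<close> grows with the size: the side length is 2^\<open>fst p\<close>.\<close>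

definition dcube :: "'n::finite dindex \<Rightarrow> (real^'n) set" where
  "dcube p = {x. cell (fst p) x = snd p}"

text \<open>Formulated with cell indices so that nesting of triples becomes a fact about integer
  division, and so that a triple is an exact disjoint union of 3^n dyadic cubes.\<close>

definition triple :: "'n::finite dindex \<Rightarrow> (real^'n) set" where
  "triple p = {x. \<forall>i. \<bar>cell (fst p) x $ i - snd p $ i\<bar> \<le> 1}"

definition dparent :: "'n::finite dindex \<Rightarrow> 'n dindex" where
  "dparent p = (fst p + 1, \<chi> i. snd p $ i div 2)"

lemma cell_parent: "cell (k + 1) x $ i = cell k x $ i div 2"
proof -
  have "(2::real) powi (k + 1) = 2 powi k * 2" by (simp add: power_int_add_1)
  then have "x $ i / 2 powi (k + 1) = (x $ i / 2 powi k) / real_of_int 2" by simp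
  then show ?thesis
    using floor_divide_real_eq_div[of 2 "x $ i / 2 powi k"] unfolding cell_def by (metis vec_lambda_beta zero_le_numeral)
qed

lemma cell_ancestor: "cell (k + int j) x $ i = cell k x $ i div 2 ^ j"
proof (induction j)
  case (Suc j)
  have "cell (k + int (Suc j)) x $ i = cell (k + int j) x $ i div 2"
    using cell_parent[of "k + int j"] by (simp add: algebra_simps)
  then show ?case
    using Suc by (simp add: zdiv_zmult2_eq power_Suc2 del: power_Suc)
qed simp

text \<open>A common point forces the index of the coarser cube to be that of the finer one divided
  by 2^j. For the triples: division by a positive integer takes integers at distance at most 1 to
  integers at distance at most 1.\<close>

lemma dcube_subset:
  assumes "x \<in> dcube p" "x \<in> dcube q" "fst p \<le> fst q"
  shows "dcube p \<subseteq> dcube q" and "triple p \<subseteq> triple q"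
proof -
  define j where "j = nat (fst q - fst p)"
  have j: "fst q = fst p + int j" using assms(3) by (simp add: j_def)
  have sq: "snd q $ i = snd p $ i div 2 ^ j" for i
    using assms cell_ancestor[of "fst p" j x i] by (simp add: dcube_def j)
  show "dcube p \<subseteq> dcube q"
    by (auto simp: dcube_def vec_eq_iff sq j cell_ancestor)
  have "\<bar>a div c - b div c\<bar> \<le> 1" if "\<bar>a - b\<bar> \<le> 1" "c > 0" for a b c :: int
  proof -
    have "a \<le> b + c" "b \<le> a + c" using that by auto
    from zdiv_mono1[OF this(1), of c] zdiv_mono1[OF this(2), of c] that(2) show ?thesis by simp
  qed
  then show "triple p \<subseteq> triple q"
    by (auto simp: triple_def sq j cell_ancestor)
qed

lemma dcube_disjoint:
  assumes "dcube p \<inter> dcube q \<noteq> {}" "fst p = fst q"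
  shows "p = q"
  using assms by (auto simp: dcube_def prod_eq_iff)

lemma dcube_dparent: "dcube p \<subseteq> dcube (dparent p)"
  by (auto simp: dcube_def dparent_def vec_eq_iff cell_parent)

lemma fst_dparent [simp]: "fst (dparent p) = fst p + 1"
  by (simp add: dparent_def)

lemma dcube_subset_triple: "dcube p \<subseteq> triple p"
  by (auto simp: dcube_def triple_def)

lemma triple_eq_Union:
  "triple p = (\<Union>b\<in>{b. \<forall>i. \<bar>b $ i - snd p $ i\<bar> \<le> 1}. dcube (fst p, b))"
  by (auto simp: dcube_def triple_def)

lemma card_neighbours:
  fixes a :: "int ^ 'n"
  shows "card {b. \<forall>i. \<bar>b $ i - a $ i\<bar> \<le> 1} = 3 ^ CARD('n)" 
    and "finite {b. \<forall>i. \<bar>b $ i - a $ i\<bar> \<le> 1}"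
proof -
  let ?F = "PiE (UNIV::'n set) (\<lambda>i. {a $ i - 1..a $ i + 1})"
  have eq: "bij_betw (\<lambda>f. (\<chi> i. f i)) ?F {b. \<forall>i. \<bar>b $ i - a $ i\<bar> \<le> 1}"
    by (rule bij_betw_byWitness[where f' = vec_nth])
      (auto simp: PiE_iff abs_le_iff algebra_simps; fastforce)+
  have c: "card {a $ i - 1..a $ i + 1} = 3" for i by simp
  show "card {b. \<forall>i. \<bar>b $ i - a $ i\<bar> \<le> 1} = 3 ^ CARD('n)"
    using bij_betw_same_card[OF eq] by (simp add: card_PiE)
  show "finite {b. \<forall>i. \<bar>b $ i - a $ i\<bar> \<le> 1}"
    using bij_betw_finite[OF eq] by (simp add: finite_PiE)
qed

section \<open>Coordinates and volumes of dyadic cubes and triples\<close>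

abbreviation side :: "'n::finite dindex \<Rightarrow> real" where "side p \<equiv> 2 powi fst p"

definition lower :: "'n::finite dindex \<Rightarrow> real^'n" where
  "lower p = (\<chi> i. of_int (snd p $ i) * side p)"

lemma mem_dcube_iff:
  "x \<in> dcube p \<longleftrightarrow> (\<forall>i. lower p $ i \<le> x $ i \<and> x $ i < lower p $ i + side p)"
proof -
  have "(\<lfloor>y / 2 powi k\<rfloor> = a) \<longleftrightarrow> (of_int a * 2 powi k \<le> y \<and> y < of_int a * 2 powi k + 2 powi k)"
    for y :: real and a k :: int
    by (simp add: floor_eq_iff pos_le_divide_eq pos_divide_less_eq algebra_simps)
  then show ?thesis
    by (simp add: dcube_def cell_def lower_def vec_eq_iff)
qed

lemma mem_triple_iff:
  "x \<in> triple p \<longleftrightarrow> (\<forall>i. lower p $ i - side p \<le> x $ i \<and> x $ i < lower p $ i + 2 * side p)"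
proof -
  have "(\<bar>\<lfloor>y / 2 powi k\<rfloor> - a\<bar> \<le> 1) \<longleftrightarrow> (of_int a * 2 powi k - 2 powi k \<le> y \<and> y < of_int a * 2 powi k + 2 * 2 powi k)"
    for y :: real and a k :: int
  proof -
    have "(\<bar>\<lfloor>y / 2 powi k\<rfloor> - a\<bar> \<le> 1) \<longleftrightarrow> a - 1 \<le> \<lfloor>y / 2 powi k\<rfloor> \<and> \<lfloor>y / 2 powi k\<rfloor> < a + 2"
      by auto
    then show ?thesis
      by (simp add: le_floor_iff floor_less_iff pos_le_divide_eq pos_divide_less_eq left_diff_distrib distrib_right)
  qed
  then show ?thesis
    by (simp add: triple_def cell_def lower_def)
qed

lemma emeasure_cbox_side:
  fixes a :: "real^'n"
  assumes "l > 0"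
  shows "emeasure lebesgue (cbox a (\<chi> i. a $ i + l)) = ennreal (l ^ CARD('n))"
    and "emeasure lebesgue (box a (\<chi> i. a $ i + l)) = ennreal (l ^ CARD('n))"
proof -
  have B: "a \<bullet> b \<le> (\<chi> i. a $ i + l) \<bullet> b \<and> ((\<chi> i. a $ i + l) - a) \<bullet> b = l" if "b \<in> Basis" for b
    using that assms by (auto simp: Basis_vec_def inner_axis)
  have "(\<Prod>b\<in>Basis. ((\<chi> i. a $ i + l) - a) \<bullet> b) = l ^ CARD('n)"
    using B by (simp cong: prod.cong)
  then show "emeasure lebesgue (cbox a (\<chi> i. a $ i + l)) = ennreal (l ^ CARD('n))"
    "emeasure lebesgue (box a (\<chi> i. a $ i + l)) = ennreal (l ^ CARD('n))"
    using B by (simp_all add: emeasure_lborel_cbox emeasure_lborel_box)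
qed

lemma cube_lebesgue:
  assumes "cube (Q :: (real^'n) set)"
  shows "Q \<in> sets lebesgue" "compact Q" "0 < measure lebesgue Q" 
    "emeasure lebesgue Q = ennreal (measure lebesgue Q)" "Q \<in> lmeasurable"
proof -
  obtain a l where Q: "l > 0" "Q = cbox a (\<chi> i. a $ i + l)" using assms by (auto simp: cube_def)
  show "Q \<in> sets lebesgue" "compact Q" "Q \<in> lmeasurable" using Q by auto
  show "0 < measure lebesgue Q" "emeasure lebesgue Q = ennreal (measure lebesgue Q)" 
    using emeasure_cbox_side[OF Q(1), of a] Q by (auto simp: measure_def)
qed

lemma dcube_sets [measurable]: "dcube p \<in> sets borel"
proof -
  have "dcube p = {x. \<forall>i. lower p $ i \<le> x $ i \<and> x $ i < lower p $ i + side p}"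
    using mem_dcube_iff by blast
  also have "\<dots> \<in> sets borel" by measurable
  finally show ?thesis .
qed

lemma triple_sets [measurable]: "triple p \<in> sets borel"
proof -
  have "triple p = {x. \<forall>i. lower p $ i - side p \<le> x $ i \<and> x $ i < lower p $ i + 2 * side p}"
    using mem_triple_iff by blast
  also have "\<dots> \<in> sets borel" by measurable
  finally show ?thesis .
qed

definition vol :: "'n::finite dindex \<Rightarrow> real" where
  "vol p = side p ^ CARD('n)"

lemma vol_pos [simp]: "vol p > 0"
  by (simp add: vol_def)

text \<open>The predicate \<open>cube\<close> means a closed cube, so the conditions on the weights
  reach the half-open sets only through these closures, which have the same volume.\<close>

definition cdcube :: "'n::finite dindex \<Rightarrow> (real^'n) set" where
  "cdcube p = cbox (lower p) (\<chi> i. lower p $ i + side p)"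

definition ctriple :: "'n::finite dindex \<Rightarrow> (real^'n) set" where
  "ctriple p = cbox (lower p - (\<chi> i. side p)) (\<chi> i. (lower p - (\<chi> i. side p)) $ i + 3 * side p)"

lemma cube_closure_dyadic: "cube (cdcube p)" "cube (ctriple p)"
  unfolding cube_def cdcube_def ctriple_def
  by (rule exI[of _ "lower p"], rule exI[of _ "side p"], simp)
     (rule exI[of _ "lower p - (\<chi> i. side p)"], rule exI[of _ "3 * side p"], simp)

lemma subset_closure_dyadic: "dcube p \<subseteq> cdcube p" "triple p \<subseteq> ctriple p"
proof -
  show "dcube p \<subseteq> cdcube p"
    by (auto simp: cdcube_def mem_box_cart mem_dcube_iff less_imp_le)
  show "triple p \<subseteq> ctriple p"
    by (auto simp: ctriple_def mem_box_cart mem_triple_iff) (smt (verit))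
qed

lemma emeasure_between:
  fixes a :: "real^'n"
  assumes "l > 0" "S \<in> sets lebesgue" "box a (\<chi> i. a $ i + l) \<subseteq> S" "S \<subseteq> cbox a (\<chi> i. a $ i + l)"
  shows "emeasure lebesgue S = ennreal (l ^ CARD('n))"
proof (rule antisym)
  show "emeasure lebesgue S \<le> ennreal (l ^ CARD('n))"
    unfolding emeasure_cbox_side(1)[OF assms(1), of a, symmetric] using assms by (intro emeasure_mono) auto
  show "ennreal (l ^ CARD('n)) \<le> emeasure lebesgue S"
    unfolding emeasure_cbox_side(2)[OF assms(1), of a, symmetric] using assms by (intro emeasure_mono) auto
qed

lemma emeasure_dyadic:
  fixes p :: "'n::finite dindex"
  shows "emeasure lebesgue (dcube p) = ennreal (vol p)"
    and "emeasure lebesgue (triple p) = ennreal (3 ^ CARD('n) * vol p)"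
    and "emeasure lebesgue (cdcube p) = ennreal (vol p)"
    and "emeasure lebesgue (ctriple p) = ennreal (3 ^ CARD('n) * vol p)"
proof -
  show "emeasure lebesgue (dcube p) = ennreal (vol p)"
    unfolding vol_def by (rule emeasure_between[where a = "lower p"])
      (auto simp: mem_box_cart mem_dcube_iff less_imp_le)
  have "emeasure lebesgue (triple p) = ennreal ((3 * side p) ^ CARD('n))"
    by (rule emeasure_between[where a = "lower p - (\<chi> i. side p)"])
      (auto simp: mem_box_cart mem_triple_iff less_imp_le, smt+)
  then show "emeasure lebesgue (triple p) = ennreal (3 ^ CARD('n) * vol p)"
    by (simp add: vol_def power_mult_distrib)
  show "emeasure lebesgue (cdcube p) = ennreal (vol p)"
    unfolding vol_def cdcube_def by (rule emeasure_cbox_side) simp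
  have "emeasure lebesgue (ctriple p) = ennreal ((3 * side p) ^ CARD('n))"
    unfolding ctriple_def by (rule emeasure_cbox_side) simp
  then show "emeasure lebesgue (ctriple p) = ennreal (3 ^ CARD('n) * vol p)"
    by (simp add: vol_def power_mult_distrib)
qed

lemma vol_dparent: "vol (dparent (p :: 'n::finite dindex)) = 2 ^ CARD('n) * vol p"
  by (simp add: vol_def power_int_add power_mult_distrib)

text \<open>Bounding the generations makes maximal cubes exist without any integrability of \<open>f\<close>; the bound
  is removed at the very end by Fatou's lemma.\<close>

definition dmaximal :: "'n::finite dindex set \<Rightarrow> 'n dindex set" where
  "dmaximal F = {p \<in> F. \<forall>q\<in>F. dcube p \<subseteq> dcube q \<longrightarrow> q = p}"

lemma dcube_nonempty: "dcube p \<noteq> {}"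
  using emeasure_dyadic(1)[of p] by (metis emeasure_empty ennreal_eq_0_iff linorder_not_le vol_pos)

lemma dcube_subset_fst:
  assumes "dcube p \<subseteq> dcube q" shows "fst p \<le> fst q"
proof -
  have "emeasure lebesgue (dcube p) \<le> emeasure lebesgue (dcube q)"
    using assms by (intro emeasure_mono) auto
  then have "side p ^ CARD('a) \<le> side q ^ CARD('a)"
    using vol_pos[of q] by (simp add: emeasure_dyadic vol_def)
  then have "side p \<le> side q" by (simp add: power_mono_iff)
  then show ?thesis using power_int_strict_increasing[of "fst q" "fst p" "2::real"] by linarith
qed

lemma dcube_cases:
  assumes "x \<in> dcube p" "x \<in> dcube q"
  shows "dcube p \<subseteq> dcube q \<or> dcube q \<subseteq> dcube p"
  using dcube_subset(1)[of x p q] dcube_subset(1)[of x q p] assms by linarith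

text \<open>Above \<open>p\<close> only finitely many generations are left below \<open>N\<close>,
  so an element of the largest one is maximal. The inclusion of triples keeps a point of
  \<open>triple p\<close> covered when passing to the maximal cube.\<close>

lemma ex_dmaximal:
  assumes "p \<in> F" "\<And>q. q \<in> F \<Longrightarrow> fst q \<le> N"
  obtains q where "q \<in> dmaximal F" "dcube p \<subseteq> dcube q" "triple p \<subseteq> triple q"
proof -
  let ?S = "{q \<in> F. dcube p \<subseteq> dcube q}"
  have "\<exists>q\<in>?S. \<forall>q'\<in>?S. fst q' \<le> fst q"
  proof -
    have p: "p \<in> ?S" using assms by simp
    obtain q where "q \<in> ?S" "\<And>q'. q' \<in> ?S \<Longrightarrow> nat (N - fst q) \<le> nat (N - fst q')"
      using ex_has_least_nat[of "\<lambda>q. q \<in> ?S" p "\<lambda>q. nat (N - fst q)"] p by blast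
    then show ?thesis using assms(2) by (intro bexI[of _ q]) force+
  qed
  then obtain q where q: "q \<in> F" "dcube p \<subseteq> dcube q" 
    and m: "\<And>q'. q' \<in> F \<Longrightarrow> dcube p \<subseteq> dcube q' \<Longrightarrow> fst q' \<le> fst q" by blast
  have "q \<in> dmaximal F"
    unfolding dmaximal_def
  proof (intro CollectI conjI ballI impI q(1))
    fix q' assume "q' \<in> F" "dcube q \<subseteq> dcube q'"
    then have "fst q' = fst q"
      using m[of q'] q(2) dcube_subset_fst[of q q'] by force
    then show "q' = q"
      using dcube_disjoint[of q' q] dcube_nonempty[of q] \<open>dcube q \<subseteq> dcube q'\<close> by auto
  qed
  moreover obtain x where "x \<in> dcube p" using dcube_nonempty[of p] by blast
  then have "triple p \<subseteq> triple q"
    using dcube_subset(2)[of x p q] q(2) dcube_subset_fst[OF q(2)] by auto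
  ultimately show ?thesis using that q by blast
qed

lemma dmaximal_subset: "dmaximal F \<subseteq> F" by (auto simp: dmaximal_def)

lemma dmaximal_unique:
  assumes "p \<in> dmaximal F" "q \<in> dmaximal F" "x \<in> dcube p" "x \<in> dcube q"
  shows "p = q"
  using assms dcube_cases[of x p q] by (auto simp: dmaximal_def)

lemma disjoint_dmaximal: "disjoint_family_on dcube (dmaximal F)"
  unfolding disjoint_family_on_def using dmaximal_unique by blast

lemma countable_dindex [simp]: "countable (A :: 'n::finite dindex set)"
  by (rule countable_subset[OF subset_UNIV]) simp

section \<open>Comparison of open sets and arbitrary cubes with the grid\<close>

lemma small_dcube_in_open:
  fixes x :: "real^'n"
  assumes "open U" "x \<in> U"
  shows "\<exists>p. x \<in> dcube p \<and> dcube p \<subseteq> U \<and> fst p \<le> N"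
proof -
  obtain e where e: "e > 0" "ball x e \<subseteq> U" using assms open_contains_ball by blast
  let ?n = "real CARD('n)"
  obtain j where j: "(1/2) ^ j < e / ?n" 
    using real_arch_pow_inv[of "e / ?n" "1/2"] e by (auto simp: zero_less_card_finite)
  define k where "k = min N (- int j)"
  let ?p = "(k, cell k x)"
  have "(2::real) powi k \<le> 2 powi (- int j)" by (intro power_int_increasing) (auto simp: k_def)
  also have "\<dots> = (1/2) ^ j" by (simp add: power_int_minus power_one_over inverse_eq_divide)
  finally have k: "2 powi k * ?n < e" using j by (simp add: pos_less_divide_eq) (meson mult_right_mono of_nat_0_le_iff order_le_less_trans)
  have "dcube ?p \<subseteq> ball x e"
  proof
    fix y assume y: "y \<in> dcube ?p"
    have x: "x \<in> dcube ?p" by (simp add: dcube_def)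
    have "norm (x - y) \<le> (\<Sum>i\<in>UNIV. \<bar>(x - y) $ i\<bar>)" by (rule norm_le_l1_cart)
    also have "\<dots> \<le> (\<Sum>i\<in>(UNIV::'n set). 2 powi k)"
      using x y unfolding mem_dcube_iff by (intro sum_mono) (smt (verit) fst_conv vector_minus_component)
    also have "\<dots> < e" using k by (simp add: mult.commute)
    finally show "y \<in> ball x e" by (simp add: dist_norm)
  qed
  then show ?thesis using e by (intro exI[of _ ?p]) (auto simp: dcube_def k_def)
qed

text \<open>The generation is the side length of \<open>Q\<close> rounded up to a power of two: the
  neighbours of the cell of \<open>x\<close> then cover \<open>Q\<close>, and the side is
  overestimated by at most a factor 2, which costs 2^n in volume.\<close>

lemma cube_subset_triples:
  fixes x :: "real^'n"
  assumes "cube Q" "x \<in> Q"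
  obtains k where "Q \<subseteq> triple (k, cell k x)" "emeasure lebesgue Q \<ge> ennreal ((2 powi k / 2) ^ CARD('n))"
proof -
  obtain a l where Q: "l > 0" "Q = cbox a (\<chi> i. a $ i + l)" using assms by (auto simp: cube_def)
  define k where "k = \<lceil>log 2 l\<rceil>"
  have "2 powr (real_of_int k - 1) < 2 powr log 2 l" "2 powr log 2 l \<le> 2 powr (real_of_int k)"
    unfolding k_def by (auto simp: ) linarith+
  then have k: "2 powi k / 2 \<le> l" "l \<le> 2 powi k"
    using Q by (auto simp: powr_diff powr_real_of_int')
  show ?thesis
  proof (rule that[of k])
    show "Q \<subseteq> triple (k, cell k x)"
    proof
      fix y assume "y \<in> Q"
      then have d: "\<bar>y $ i - x $ i\<bar> \<le> 2 powi k" for i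
        using assms(2) k unfolding Q by (auto simp: mem_box_cart abs_le_iff) (smt (verit))+
      have "x \<in> dcube (k, cell k x)" by (simp add: dcube_def)
      then show "y \<in> triple (k, cell k x)"
        unfolding mem_triple_iff mem_dcube_iff using d by (auto simp: abs_le_iff) (smt (verit))+
    qed
    show "emeasure lebesgue Q \<ge> ennreal ((2 powi k / 2) ^ CARD('n))"
      unfolding Q(2) emeasure_cbox_side(1)[OF Q(1)] using k by (intro ennreal_leI power_mono) auto
  qed
qed

section \<open>Weights\<close>

text \<open>A genuine measure, in contrast to \<open>weighted_measure\<close>, so that monotonicity
  and countable additivity of \<open>emeasure\<close> are available.\<close>

definition wm :: "(real^'n \<Rightarrow> real) \<Rightarrow> (real^'n) measure" where
  "wm w = density lebesgue (\<lambda>x. ennreal (w x))"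

lemma sets_wm [simp, measurable_cong]: "sets (wm w) = sets lebesgue"
  and space_wm [simp]: "space (wm w) = UNIV"
  by (simp_all add: wm_def)

lemma weight_measurable:
  fixes w :: "real^'n \<Rightarrow> real"
  assumes "weight w" shows "w \<in> borel_measurable lebesgue"
proof (rule borel_measurable_LIMSEQ_real)
  show "(\<lambda>x. indicat_real (cball 0 (real j)) x *\<^sub>R w x) \<in> borel_measurable lebesgue" for j
    using assms unfolding weight_def set_integrable_def by (meson borel_measurable_integrable compact_cball)
  show "(\<lambda>j. indicat_real (cball 0 (real j)) x *\<^sub>R w x) \<longlonglongrightarrow> w x" for x
  proof (rule tendsto_eventually)
    obtain N where "norm x \<le> real N" using real_arch_simple by blast
    then show "\<forall>\<^sub>F j in sequentially. indicat_real (cball 0 (real j)) x *\<^sub>R w x = w x"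
      by (intro eventually_sequentiallyI[of N]) (auto simp: indicator_def)
  qed
qed

lemma emeasure_wm:
  assumes "weight w" "A \<in> sets lebesgue"
  shows "emeasure (wm w) A = (\<integral>\<^sup>+x. ennreal (w x) * indicator A x \<partial>lebesgue)"
  unfolding wm_def using assms by (intro emeasure_density) (auto intro: measurable_compose[OF weight_measurable])

lemma weight_set_integrable:
  assumes "weight w" "compact K" "A \<in> sets lebesgue" "A \<subseteq> K"
  shows "set_integrable lebesgue A w"
  using assms set_integrable_subset[of lebesgue K w A] by (auto simp: weight_def)

lemma emeasure_wm_integral:
  assumes "weight w" "compact K" "A \<in> sets lebesgue" "A \<subseteq> K"
  shows "emeasure (wm w) A = ennreal (LINT x:A|lebesgue. w x)"
proof -
  have "emeasure (wm w) A = (\<integral>\<^sup>+x. ennreal (indicator A x *\<^sub>R w x) \<partial>lebesgue)"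
    using assms by (auto simp: emeasure_wm intro!: nn_integral_cong split: split_indicator)
  also have "\<dots> = ennreal (LINT x:A|lebesgue. w x)"
    using weight_set_integrable[OF assms] assms(1) unfolding set_integrable_def set_lebesgue_integral_def weight_def
    by (intro nn_integral_eq_integral) (auto intro: always_eventually)
  finally show ?thesis .
qed

lemma wm_finite:
  assumes "weight w" "compact K" "A \<subseteq> K"
  shows "emeasure (wm w) A < \<infinity>"
proof -
  have K: "K \<in> sets lebesgue" using assms lmeasurable_compact by blast
  then have "emeasure (wm w) A \<le> emeasure (wm w) K"
    using assms by (intro emeasure_mono) auto
  also have "\<dots> < \<infinity>" using assms K by (subst emeasure_wm_integral[of w K K]) auto
  finally show ?thesis .
qed

lemma wm_null:
  assumes "weight w" "A \<in> sets lebesgue" "emeasure lebesgue A = 0"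
  shows "emeasure (wm w) A = 0"
  using assms absolutely_continuousI_density[of "\<lambda>x. ennreal (w x)" lebesgue] weight_measurable[of w]
  unfolding absolutely_continuous_def wm_def null_sets_def by auto

lemma wm_pos:
  assumes "weight w" "A \<in> sets lebesgue" "emeasure lebesgue A \<noteq> 0"
  shows "emeasure (wm w) A > 0"
proof (rule ccontr)
  assume "\<not> emeasure (wm w) A > 0"
  then have "(\<integral>\<^sup>+x. ennreal (w x) * indicator A x \<partial>lebesgue) = 0"
    using assms by (simp add: emeasure_wm)
  moreover have [measurable]: "A \<in> sets lebesgue" "w \<in> borel_measurable lebesgue" 
    using assms by (auto intro: weight_measurable)
  ultimately have "AE x in lebesgue. ennreal (w x) * indicator A x = 0"
    by (subst (asm) nn_integral_0_iff_AE) auto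
  moreover have "AE x in lebesgue. 0 < w x" using assms by (simp add: weight_def)
  ultimately have "AE x in lebesgue. x \<notin> A"
    by eventually_elim (auto simp: indicator_def ennreal_eq_0_iff split: if_splits)
  then show False using assms AE_iff_measurable[of A lebesgue "\<lambda>x. x \<notin> A"] by auto
qed

lemma emeasure_wm_cube:
  assumes "weight w" "cube Q"
  shows "emeasure (wm w) Q = ennreal (avg Q w * measure lebesgue Q)" and "avg Q w > 0"
proof -
  note Q = cube_lebesgue[OF assms(2)]
  show *: "emeasure (wm w) Q = ennreal (avg Q w * measure lebesgue Q)"
    using emeasure_wm_integral[OF assms(1) Q(2,1)] Q(3) by (simp add: avg_def)
  have "emeasure (wm w) Q > 0" using wm_pos[OF assms(1) Q(1)] Q(3,4) by simp
  then show "avg Q w > 0"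
    unfolding * using Q(3) by (simp add: zero_less_mult_iff)
qed

section \<open>Large subsets of a cube carry a fixed share of its mass\<close>

text \<open>The only consequence of the \<open>A\<^sub>1\<close> and \<open>A\<^sub>\<infinity>\<close> conditions that enters the size estimates.\<close>

definition spread :: "(real^'n \<Rightarrow> real) \<Rightarrow> bool" where
  "spread w \<longleftrightarrow> weight w \<and> (\<forall>\<theta>>0. \<exists>c>0. \<forall>Q F. cube Q \<and> F \<in> sets lebesgue \<and> F \<subseteq> Q \<and>
     \<theta> * measure lebesgue Q \<le> measure lebesgue F \<longrightarrow> ennreal c * emeasure (wm w) Q \<le> emeasure (wm w) F)"

text \<open>The A_1 condition bounds \<open>w\<close> from below by its average almost everywhere on
  \<open>Q\<close>; integrating this over \<open>F\<close> gives the share \<theta> / C.\<close>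

lemma A1_spread:
  assumes "muckenhoupt_A1 w" shows "spread w"
  unfolding spread_def
proof (intro conjI allI impI)
  show w: "weight w" using assms by (simp add: muckenhoupt_A1_def)
  fix \<theta> :: real assume \<theta>: "\<theta> > 0"
  obtain C where C: "C > 0" "\<And>Q. cube Q \<Longrightarrow> AE x in lebesgue. x \<in> Q \<longrightarrow> avg Q w \<le> C * w x"
    using assms by (auto simp: muckenhoupt_A1_def)
  show "\<exists>c>0. \<forall>Q F. cube Q \<and> F \<in> sets lebesgue \<and> F \<subseteq> Q \<and> \<theta> * measure lebesgue Q \<le> measure lebesgue F 
      \<longrightarrow> ennreal c * emeasure (wm w) Q \<le> emeasure (wm w) F"
  proof (intro exI[of _ "\<theta> / C"] conjI allI impI)
    show "\<theta> / C > 0" using \<theta> C by simp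
    fix Q F :: "(real^'a) set"
    assume "cube Q \<and> F \<in> sets lebesgue \<and> F \<subseteq> Q \<and> \<theta> * measure lebesgue Q \<le> measure lebesgue F"
    then have F: "cube Q" "F \<in> sets lebesgue" "F \<subseteq> Q" "\<theta> * measure lebesgue Q \<le> measure lebesgue F" by auto
    note Q = cube_lebesgue[OF F(1)] and av = emeasure_wm_cube[OF w F(1)]
    have Fm: "F \<in> lmeasurable" using fmeasurableI2[OF Q(5) F(3,2)] .
    have "ennreal (\<theta> / C) * emeasure (wm w) Q = ennreal (1 / C * avg Q w * (\<theta> * measure lebesgue Q))"
      using \<theta> C av Q by (simp add: mult_ac flip: ennreal_mult)
    also have "\<dots> \<le> ennreal (1 / C * avg Q w * measure lebesgue F)"
      using F C av by (intro ennreal_leI mult_left_mono) auto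
    also have "\<dots> = ennreal (1 / C * avg Q w) * emeasure lebesgue F"
      using Fm C av by (simp add: emeasure_eq_measure2 ennreal_mult flip: ennreal_mult)
    also have "\<dots> = (\<integral>\<^sup>+x. ennreal (1 / C * avg Q w) * indicator F x \<partial>lebesgue)"
      using F by (simp add: nn_integral_cmult_indicator)
    also have "\<dots> \<le> (\<integral>\<^sup>+x. ennreal (w x) * indicator F x \<partial>lebesgue)"
    proof (rule nn_integral_mono_AE, use C(2)[OF F(1)] in eventually_elim)
      case (elim x)
      then show ?case using F(3) C(1) by (auto split: split_indicator intro!: ennreal_leI simp: field_simps)
    qed
    also have "\<dots> = emeasure (wm w) F" using w F by (simp add: emeasure_wm)
    finally show "ennreal (\<theta> / C) * emeasure (wm w) Q \<le> emeasure (wm w) F" .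
  qed
qed

text \<open>Jensen's inequality for the logarithm, used separately on \<open>F\<close> and on its
  complement, bounds the average of ln (1/w) over \<open>Q\<close> from below. Too little mass on
  \<open>F\<close> would make the contribution of \<open>F\<close> large and violate the A_infinity
  bound. Quantitatively, the mean over \<open>F\<close> is at least exp (-D/\<theta>) times the mean
  over \<open>Q\<close>; the further factor \<theta> is the share of the volume.\<close>

lemma A_infinity_spread:
  fixes w :: "real^'n \<Rightarrow> real"
  assumes "muckenhoupt_A_infinity w" shows "spread w"
  unfolding spread_def
proof (intro conjI allI impI)
  show w: "weight w" using assms by (simp add: muckenhoupt_A_infinity_def)
  let ?L = "\<lambda>x. ln (inverse (w x))"
  obtain C where C: "C > 0" "\<And>Q. cube Q \<Longrightarrow> ?L absolutely_integrable_on Q"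
    "\<And>Q. cube Q \<Longrightarrow> avg Q w * exp (avg Q ?L) \<le> C"
    using assms by (auto simp: muckenhoupt_A_infinity_def)
  \<comment> \<open>Nonnegativity is what allows the inequality V \<le> M / \<theta> to be
    multiplied by \<open>D\<close> below.\<close>
  define D where "D = max 0 (1 + ln C)"
  fix \<theta> :: real assume \<theta>: "\<theta> > 0"
  show "\<exists>c>0. \<forall>Q F. cube Q \<and> F \<in> sets lebesgue \<and> F \<subseteq> Q \<and> \<theta> * measure lebesgue Q \<le> measure lebesgue F 
      \<longrightarrow> ennreal c * emeasure (wm w) Q \<le> emeasure (wm w) F"
  proof (intro exI[of _ "\<theta> * exp (- D / \<theta>)"] conjI allI impI)
    show "\<theta> * exp (- D / \<theta>) > 0" using \<theta> by simp
    fix Q F :: "(real^'n) set"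
    assume "cube Q \<and> F \<in> sets lebesgue \<and> F \<subseteq> Q \<and> \<theta> * measure lebesgue Q \<le> measure lebesgue F"
    then have F: "cube Q" "F \<in> sets lebesgue" "F \<subseteq> Q" "\<theta> * measure lebesgue Q \<le> measure lebesgue F" by auto
    note Q = cube_lebesgue[OF F(1)] and av = emeasure_wm_cube[OF w F(1)]
    have Fm: "F \<in> lmeasurable" using fmeasurableI2[OF Q(5) F(3,2)] .
    define V M where "V = measure lebesgue Q" and "M = measure lebesgue F"
    define I J where "I = (LINT x:Q|lebesgue. w x)" and "J = (LINT x:F|lebesgue. w x)"
    define G where "G = Q - F"
    have VM: "V > 0" "M > 0" "\<theta> * V \<le> M" "M \<le> V"
      using Q(3) F \<theta> unfolding V_def M_def by (auto intro!: measure_mono_fmeasurable Q(5) intro: less_le_trans[OF mult_pos_pos])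
    have b: "I / V > 0" using av(2) by (simp add: I_def V_def avg_def)
    have IV: "I > 0" using b VM by (simp add: zero_less_divide_iff)
    have WF: "emeasure (wm w) F = ennreal J" and WQ: "emeasure (wm w) Q = ennreal I"
      unfolding J_def I_def using emeasure_wm_integral[OF w Q(2)] F Q by auto
    have "emeasure (wm w) F > 0"
      using VM F by (intro wm_pos[OF w]) (auto simp: M_def measure_def)
    then have J: "J > 0" using WF by simp
    \<comment> \<open>On the complement \<open>G\<close> the mean \<open>b\<close> of the whole cube
      is used, since \<open>G\<close> may be a null set without a mean of its own. The price is at
      most the additive term \<open>V\<close>.\<close>
    define \<alpha> b where "\<alpha> = J / M" and "b = I / V"
    have ab: "\<alpha> > 0" "b > 0" using J VM b by (auto simp: \<alpha>_def b_def)
    have Gm: "G \<in> lmeasurable" unfolding G_def using Q Fm by (intro fmeasurable.Diff) auto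
    have Gs: "G \<in> sets lebesgue" "G \<subseteq> Q" using Gm by (auto simp: G_def)
    have mG: "measure lebesgue G = V - M"
      unfolding G_def V_def M_def using Q(5) F by (intro measurable_measure_Diff) auto
    have iw: "set_integrable lebesgue F w" "set_integrable lebesgue G w"
      using weight_set_integrable[OF w Q(2)] F Gs by auto
    have IG: "(LINT x:G|lebesgue. w x) = I - J"
    proof -
      have "I = (LINT x:F \<union> G|lebesgue. w x)" using F by (simp add: I_def G_def Un_absorb1)
      also have "\<dots> = J + (LINT x:G|lebesgue. w x)"
        unfolding J_def by (rule set_integral_Un[OF _ iw]) (auto simp: G_def)
      finally show ?thesis by simp
    qed
    have iL: "set_integrable lebesgue F ?L" "set_integrable lebesgue G ?L"
      using set_integrable_subset[OF C(2)[OF F(1)]] F Gs by auto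
    \<comment> \<open>Jensen's inequality in tangent line form: integrate ln y \<le> y - 1 at y = w
      / s. With s the mean of \<open>w\<close> over \<open>A\<close> it is the usual statement, but
      any positive s is allowed.\<close>
    have key: "(LINT x:A|lebesgue. ?L x) \<ge> (1 - ln s) * measure lebesgue A - (LINT x:A|lebesgue. w x) / s"
      if A: "A \<in> lmeasurable" "set_integrable lebesgue A w" "set_integrable lebesgue A ?L" and s: "s > 0" for A s
    proof -
      have ic: "set_integrable lebesgue A (\<lambda>x. 1 - ln s)"
        using A(1) unfolding set_integrable_def by (auto simp: fmeasurable_def intro!: integrable_mult_left integrable_real_indicator)
      have iws: "set_integrable lebesgue A (\<lambda>x. w x / s)"
        using A(2) unfolding set_integrable_def by (simp add: divide_inverse flip: mult.assoc)
      have "(1 - ln s) * measure lebesgue A - (LINT x:A|lebesgue. w x) / s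
          = (LINT x:A|lebesgue. (1 - ln s) - w x / s)"
        using set_integral_diff(2)[OF ic iws] A(1)
        by (simp add: set_integral_divide_zero set_lebesgue_integral_def fmeasurable_def mult.commute)
      also have "\<dots> \<le> (LINT x:A|lebesgue. ?L x)"
      proof (rule set_integral_mono_AE[OF set_integral_diff(1)[OF ic iws] A(3)])
        have "AE x in lebesgue. 0 < w x" using w by (simp add: weight_def)
        then show "AE x\<in>A in lebesgue. 1 - ln s - w x / s \<le> ?L x"
        proof eventually_elim
          case (elim x)
          have "ln (w x / s) \<le> w x / s - 1" using elim s by (intro ln_le_minus_one) simp
          then show ?case using elim s by (simp add: ln_div ln_inverse)
        qed
      qed
      finally show ?thesis .
    qed
    have "V * avg Q ?L = (LINT x:F \<union> G|lebesgue. ?L x)"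
      using F VM by (simp add: avg_def V_def G_def Un_absorb1)
    also have "\<dots> = (LINT x:F|lebesgue. ?L x) + (LINT x:G|lebesgue. ?L x)"
      by (rule set_integral_Un[OF _ iL]) (auto simp: G_def)
    also have "\<dots> \<ge> ((1 - ln \<alpha>) * M - J / \<alpha>) + ((1 - ln b) * (V - M) - (I - J) / b)"
      using key[OF Fm iw(1) iL(1) ab(1)] key[OF Gm iw(2) iL(2) ab(2)] by (simp add: M_def J_def IG mG)
    finally have L: "V * avg Q ?L \<ge> ((1 - ln \<alpha>) * M - J / \<alpha>) + ((1 - ln b) * (V - M) - (I - J) / b)" .
    have "J / \<alpha> = M" using J VM by (simp add: \<alpha>_def)
    moreover have "(I - J) / b \<le> V" using J VM IV by (simp add: b_def field_simps)
    ultimately have L2: "V * avg Q ?L \<ge> - ln \<alpha> * M - ln b * (V - M) - V"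
      using L VM by (simp add: algebra_simps)
    have "b * exp (avg Q ?L) \<le> C" using C(3)[OF F(1)] by (simp add: b_def I_def V_def avg_def)
    then have "ln (b * exp (avg Q ?L)) \<le> ln C" using ab C by (subst ln_le_cancel_iff) auto
    then have "ln b + avg Q ?L \<le> ln C" using ab by (simp add: ln_mult)
    then have "V * (ln b + avg Q ?L) \<le> V * ln C" using VM by simp
    then have "M * (ln b - ln \<alpha>) \<le> V * (1 + ln C)" using L2 by (simp add: algebra_simps)
    also have "\<dots> \<le> V * D" using VM by (simp add: D_def)
    also have "\<dots> \<le> M / \<theta> * D" using VM \<theta> by (intro mult_right_mono) (auto simp: D_def field_simps)
    finally have "M * (ln b - ln \<alpha>) \<le> M * (D / \<theta>)" by simp
    then have "ln b - ln \<alpha> \<le> D / \<theta>" using VM by (subst (asm) mult_le_cancel_left_pos) auto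
    then have "ln (b * exp (- D / \<theta>)) \<le> ln \<alpha>" using ab by (simp add: ln_mult)
    then have \<alpha>: "b * exp (- D / \<theta>) \<le> \<alpha>" using ab by simp
    have "\<theta> * exp (- D / \<theta>) * I = (\<theta> * V) * (b * exp (- D / \<theta>))" using VM by (simp add: b_def)
    also have "\<dots> \<le> M * \<alpha>" using VM \<alpha> ab \<theta> by (intro mult_mono) auto
    also have "\<dots> = J" using VM by (simp add: \<alpha>_def)
    finally show "ennreal (\<theta> * exp (- D / \<theta>)) * emeasure (wm w) Q \<le> emeasure (wm w) F"
      unfolding WF WQ using \<theta> IV by (simp add: ennreal_leI flip: ennreal_mult)
  qed
qed

declare split_paired_All [simp del] split_paired_Ex [simp del]

lemma disjoint_family_on_Int:
  "disjoint_family_on X I \<Longrightarrow> disjoint_family_on (\<lambda>i. A \<inter> X i) I"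
  unfolding disjoint_family_on_def by blast

lemma emeasure_UN_le_nn_integral:
  assumes "countable I" "\<And>i. i \<in> I \<Longrightarrow> X i \<in> sets M"
  shows "emeasure M (\<Union>i\<in>I. X i) \<le> (\<integral>\<^sup>+i. emeasure M (X i) \<partial>count_space I)"
proof -
  have U: "(\<Union>i\<in>I. X i) \<in> sets M" using assms by (intro sets.countable_UN') auto
  have "indicator (\<Union>i\<in>I. X i) x \<le> (\<integral>\<^sup>+i. indicator (X i) x \<partial>count_space I)" for x
  proof (cases "x \<in> (\<Union>i\<in>I. X i)")
    case True
    then obtain i where "i \<in> I" "x \<in> X i" by auto
    then show ?thesis using nn_integral_ge_point[of i I "\<lambda>i. indicator (X i) x"] by (auto simp: indicator_def)
  qed simp
  then have "(\<integral>\<^sup>+x. indicator (\<Union>i\<in>I. X i) x \<partial>M) \<le> (\<integral>\<^sup>+x. \<integral>\<^sup>+i. indicator (X i) x \<partial>count_space I \<partial>M)"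
    by (intro nn_integral_mono)
  also have "\<dots> = (\<integral>\<^sup>+i. \<integral>\<^sup>+x. indicator (X i) x \<partial>M \<partial>count_space I)"
    using assms by (intro nn_integral_count_space_nn_integral) auto
  also have "\<dots> = (\<integral>\<^sup>+i. emeasure M (X i) \<partial>count_space I)"
    using assms by (intro nn_integral_cong) auto
  finally show ?thesis using U by simp
qed

lemma dcube_lebesgue [measurable]: "dcube p \<in> sets lebesgue"
  and triple_lebesgue [measurable]: "triple p \<in> sets lebesgue"
  using dcube_sets triple_sets by (simp_all add: sets_completionI_sets)

text \<open>Half-open sets are filled up to closed cubes of equal volume. Capping \<open>c\<close>
  at 1/2 keeps 1 - \<open>c\<close> in [1/2, 1); this number becomes the decay ratio below.\<close>

lemma spread_dcube:
  fixes w :: "real^'n \<Rightarrow> real"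
  assumes "spread w" "\<theta> > 0"
  obtains c where "c > 0" "c \<le> 1/2"
    "\<And>p F. F \<in> sets lebesgue \<Longrightarrow> F \<subseteq> triple p \<Longrightarrow> ennreal (\<theta> * 3 ^ CARD('n) * vol p) \<le> emeasure lebesgue F
       \<Longrightarrow> ennreal c * emeasure (wm w) (triple p) \<le> emeasure (wm w) F"
    "\<And>p F. F \<in> sets lebesgue \<Longrightarrow> F \<subseteq> dcube p \<Longrightarrow> ennreal (\<theta> * vol p) \<le> emeasure lebesgue F
       \<Longrightarrow> ennreal c * emeasure (wm w) (dcube p) \<le> emeasure (wm w) F"
proof -
  obtain c where c: "c > 0" "\<And>Q F. cube Q \<Longrightarrow> F \<in> sets lebesgue \<Longrightarrow> F \<subseteq> Q \<Longrightarrow>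
     \<theta> * measure lebesgue Q \<le> measure lebesgue F \<Longrightarrow> ennreal c * emeasure (wm w) Q \<le> emeasure (wm w) F"
    using assms unfolding spread_def by metis
  have *: "ennreal (min c (1/2)) * emeasure (wm w) R \<le> emeasure (wm w) F"
    if "F \<in> sets lebesgue" "F \<subseteq> R" "R \<subseteq> Q" "cube Q" "emeasure lebesgue Q = ennreal v" "v \<ge> 0"
      "ennreal (\<theta> * v) \<le> emeasure lebesgue F" for R F Q v
  proof -
    have "F \<subseteq> Q" using that by auto
    then have "emeasure lebesgue F \<le> ennreal v"
      using emeasure_mono[of F Q lebesgue] that(5) cube_lebesgue(1)[OF that(4)] by simp
    then have "emeasure lebesgue F \<noteq> \<infinity>" by (metis ennreal_less_top infinity_ennreal_def leD)
    then have "\<theta> * v \<le> measure lebesgue F"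
      using that assms(2) by (simp add: emeasure_eq_ennreal_measure)
    moreover have "measure lebesgue Q = v" using that by (simp add: measure_def)
    ultimately have "ennreal c * emeasure (wm w) Q \<le> emeasure (wm w) F" using that c(2)[of Q F] by auto
    moreover have "ennreal (min c (1/2)) * emeasure (wm w) R \<le> ennreal c * emeasure (wm w) Q"
      using that c(1) cube_lebesgue(1)[of Q] by (intro mult_mono ennreal_leI emeasure_mono) auto
    ultimately show ?thesis by (rule order_trans[rotated])
  qed
  show ?thesis
  proof (rule that[of "min c (1/2)"])
    show "ennreal (min c (1/2)) * emeasure (wm w) (triple p) \<le> emeasure (wm w) F"
      if "F \<in> sets lebesgue" "F \<subseteq> triple p" "ennreal (\<theta> * 3 ^ CARD('n) * vol p) \<le> emeasure lebesgue F" for p F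
      using that by (intro *[OF _ _ subset_closure_dyadic(2) cube_closure_dyadic(2) emeasure_dyadic(4)])
        (simp_all add: mult.assoc less_imp_le)
    show "ennreal (min c (1/2)) * emeasure (wm w) (dcube p) \<le> emeasure (wm w) F"
      if "F \<in> sets lebesgue" "F \<subseteq> dcube p" "ennreal (\<theta> * vol p) \<le> emeasure lebesgue F" for p F
      using that by (intro *[OF _ _ subset_closure_dyadic(1) cube_closure_dyadic(1) emeasure_dyadic(3)])
        (simp_all add: less_imp_le)
  qed (use c in auto)
qed

lemma wm_dyadic_finite:
  assumes "weight w"
  shows "emeasure (wm w) (dcube p) < \<infinity>" "emeasure (wm w) (triple p) < \<infinity>"
  using assms subset_closure_dyadic[of p] cube_closure_dyadic[of p] cube_lebesgue(2) wm_finite by metis+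

section \<open>Power decay of a weight, from the dyadic maximal function of an indicator\<close>

definition dense_cubes :: "'n::finite dindex \<Rightarrow> (real^'n) set \<Rightarrow> real \<Rightarrow> 'n dindex set" where
  "dense_cubes p A \<theta> = {q. dcube q \<subseteq> dcube p \<and> ennreal (\<theta> * vol q) < emeasure lebesgue (A \<inter> dcube q)}"

text \<open>This is the set where the dyadic maximal function of the indicator of \<open>A\<close>,
  localised to \<open>p\<close>, exceeds \<theta>.\<close>

definition dense_set :: "'n::finite dindex \<Rightarrow> (real^'n) set \<Rightarrow> real \<Rightarrow> (real^'n) set" where
  "dense_set p A \<theta> = (\<Union>q\<in>dense_cubes p A \<theta>. dcube q)"

context
  fixes w :: "real^'n \<Rightarrow> real" and p :: "'n dindex" and A :: "(real^'n) set" and c :: real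
  assumes w: "weight w" and A: "A \<in> sets lebesgue" "A \<subseteq> dcube p" and c: "0 < c" "c \<le> 1/2"
    and half: "\<And>p F. F \<in> sets lebesgue \<Longrightarrow> F \<subseteq> dcube p \<Longrightarrow> ennreal (1/2 * vol p) \<le> emeasure lebesgue F
       \<Longrightarrow> ennreal c * emeasure (wm w) (dcube p) \<le> emeasure (wm w) F"
begin

lemma dense_cubes_fst: "q \<in> dense_cubes p A \<theta> \<Longrightarrow> fst q \<le> fst p"
  unfolding dense_cubes_def using dcube_subset_fst by blast

lemma dense_set_maximal: "dense_set p A \<theta> = (\<Union>q\<in>dmaximal (dense_cubes p A \<theta>). dcube q)"
proof
  show "dense_set p A \<theta> \<subseteq> (\<Union>q\<in>dmaximal (dense_cubes p A \<theta>). dcube q)"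
    unfolding dense_set_def
  proof
    fix x assume "x \<in> (\<Union>q\<in>dense_cubes p A \<theta>. dcube q)"
    then obtain q where q: "q \<in> dense_cubes p A \<theta>" "x \<in> dcube q" by auto
    obtain q' where "q' \<in> dmaximal (dense_cubes p A \<theta>)" "dcube q \<subseteq> dcube q'"
      by (rule ex_dmaximal[OF q(1) dense_cubes_fst])
    then show "x \<in> (\<Union>q\<in>dmaximal (dense_cubes p A \<theta>). dcube q)" using q by auto
  qed
  show "(\<Union>q\<in>dmaximal (dense_cubes p A \<theta>). dcube q) \<subseteq> dense_set p A \<theta>"
    unfolding dense_set_def using dmaximal_subset by blast
qed

lemma dense_set_sets [measurable]: "dense_set p A \<theta> \<in> sets lebesgue"
  unfolding dense_set_def by (intro sets.countable_UN') auto

lemma dense_set_subset: "dense_set p A \<theta> \<subseteq> dcube p"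
  by (auto simp: dense_set_def dense_cubes_def)

text \<open>Smallness of \<open>A\<close> keeps \<open>p\<close> itself from being \<theta>'-dense,
  so every maximal \<theta>'-dense cube has a parent inside \<open>p\<close> that is not
  \<theta>'-dense. The density of \<open>A\<close> in the maximal cube is then at most 2^n \<theta>'
  = \<theta>/2. By the weak type bound of the dyadic maximal function the \<theta>-dense set fills
  at most half of that cube, and \<open>half\<close>, applied to the rest of the cube, removes the
  share \<open>c\<close> of its mass.\<close>

lemma dense_set_step:
  fixes \<theta> :: real
  defines "\<theta>' \<equiv> \<theta> / (2 * 2 ^ CARD('n))"
  assumes \<theta>: "\<theta> > 0" and small: "emeasure lebesgue A \<le> ennreal (\<theta>' * vol p)"
  shows "emeasure (wm w) (dense_set p A \<theta>) \<le> ennreal (1 - c) * emeasure (wm w) (dense_set p A \<theta>')"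
proof -
  let ?M = "dmaximal (dense_cubes p A \<theta>')"
  have "(1::real) \<le> 2 ^ CARD('n)" by simp
  then have "\<theta> * 1 \<le> \<theta> * (2 * 2 ^ CARD('n))" using \<theta> by (intro mult_left_mono) linarith+
  then have \<theta>': "0 < \<theta>'" "\<theta>' \<le> \<theta>" using \<theta> by (simp_all add: \<theta>'_def divide_le_eq)
  have mono: "dense_cubes p A \<theta> \<subseteq> dense_cubes p A \<theta>'"
  proof
    fix q assume q: "q \<in> dense_cubes p A \<theta>"
    have "ennreal (\<theta>' * vol q) \<le> ennreal (\<theta> * vol q)"
      using \<theta>' by (intro ennreal_leI mult_right_mono) (auto simp: less_imp_le)
    then show "q \<in> dense_cubes p A \<theta>'" using q unfolding dense_cubes_def by (auto intro: le_less_trans)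
  qed
  have sparse: "emeasure lebesgue (A \<inter> dcube q) \<le> ennreal (\<theta> / 2 * vol q)" if q: "q \<in> ?M" for q
  proof -
    have qF: "q \<in> dense_cubes p A \<theta>'" using q dmaximal_subset by auto
    have sub: "dcube q \<subseteq> dcube p" using qF by (simp add: dense_cubes_def)
    have "q \<noteq> p"
    proof
      assume "q = p"
      then have "ennreal (\<theta>' * vol p) < emeasure lebesgue (A \<inter> dcube p)" using qF by (simp add: dense_cubes_def)
      also have "\<dots> \<le> emeasure lebesgue A" using A by (intro emeasure_mono) auto
      finally show False using small by simp
    qed
    then have "fst q < fst p"
      using dcube_subset_fst[OF sub] dcube_disjoint[of q p] dcube_nonempty[of q] sub by (metis inf.absorb1 order_less_le)
    moreover obtain x where "x \<in> dcube q" using dcube_nonempty[of q] by auto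
    ultimately have psub: "dcube (dparent q) \<subseteq> dcube p"
      using dcube_subset(1)[of x "dparent q" p] dcube_dparent[of q] sub by auto
    have "dparent q \<noteq> q" using fst_dparent[of q] by (metis add_cancel_left_right one_neq_zero)
    then have "dparent q \<notin> dense_cubes p A \<theta>'" using q dcube_dparent[of q] unfolding dmaximal_def by auto
    then have nd: "emeasure lebesgue (A \<inter> dcube (dparent q)) \<le> ennreal (\<theta>' * vol (dparent q))"
      using psub by (simp add: dense_cubes_def)
    have "emeasure lebesgue (A \<inter> dcube q) \<le> emeasure lebesgue (A \<inter> dcube (dparent q))"
      using A(1) by (intro emeasure_mono Int_mono dcube_dparent) auto
    also note nd
    also have "\<theta>' * vol (dparent q) = \<theta> / 2 * vol q"
      unfolding vol_dparent by (simp add: \<theta>'_def field_simps)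
    finally show ?thesis .
  qed
  have half_full: "emeasure lebesgue (dense_set p A \<theta> \<inter> dcube q) \<le> ennreal (1/2 * vol q)" if q: "q \<in> ?M" for q
  proof -
    let ?S = "{s \<in> dmaximal (dense_cubes p A \<theta>). dcube s \<subseteq> dcube q}"
    have dis: "disjoint_family_on dcube ?S" 
      by (rule disjoint_family_on_mono[OF _ disjoint_dmaximal]) auto
    have "dense_set p A \<theta> \<inter> dcube q \<subseteq> (\<Union>s\<in>?S. dcube s)"
    proof
      fix x assume x: "x \<in> dense_set p A \<theta> \<inter> dcube q"
      then obtain s where s: "s \<in> dmaximal (dense_cubes p A \<theta>)" "x \<in> dcube s" unfolding dense_set_maximal by auto
      then have sD: "s \<in> dense_cubes p A \<theta>'" using mono dmaximal_subset by blast
      obtain q' where q': "q' \<in> ?M" "dcube s \<subseteq> dcube q'"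
        by (rule ex_dmaximal[OF sD dense_cubes_fst])
      then have "q' = q" using dmaximal_unique[of q' _ q x] q s x by auto
      then show "x \<in> (\<Union>s\<in>?S. dcube s)" using s q' by blast
    qed
    then have "ennreal \<theta> * emeasure lebesgue (dense_set p A \<theta> \<inter> dcube q) \<le> ennreal \<theta> * emeasure lebesgue (\<Union>s\<in>?S. dcube s)"
      by (intro mult_left_mono emeasure_mono sets.countable_UN') auto
    also have "\<dots> = (\<integral>\<^sup>+s. ennreal (\<theta> * vol s) \<partial>count_space ?S)"
      using \<theta> by (simp add: emeasure_UN_countable[OF _ _ dis] emeasure_dyadic ennreal_mult less_imp_le nn_integral_cmult)
    also have "\<dots> \<le> (\<integral>\<^sup>+s. emeasure lebesgue (A \<inter> dcube s) \<partial>count_space ?S)"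
      by (intro nn_integral_mono) (auto simp: dmaximal_def dense_cubes_def less_imp_le)
    also have "\<dots> = emeasure lebesgue (\<Union>s\<in>?S. A \<inter> dcube s)"
      using A by (intro emeasure_UN_countable[symmetric] disjoint_family_on_Int[OF dis]) auto
    also have "\<dots> \<le> emeasure lebesgue (A \<inter> dcube q)"
      using A by (intro emeasure_mono) auto
    also have "\<dots> \<le> ennreal (\<theta> / 2 * vol q)" by (rule sparse[OF q])
    also have "\<dots> = ennreal \<theta> * ennreal (1/2 * vol q)" using \<theta> by (simp add: less_imp_le flip: ennreal_mult)
    finally show ?thesis using \<theta> by (simp add: ennreal_mult_le_mult_iff)
  qed
  have loc: "emeasure (wm w) (dense_set p A \<theta> \<inter> dcube q) \<le> ennreal (1 - c) * emeasure (wm w) (dcube q)" if q: "q \<in> ?M" for q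
  proof -
    let ?D = "dense_set p A \<theta> \<inter> dcube q"
    obtain d where d: "d \<ge> 0" "emeasure lebesgue ?D = ennreal d" "d \<le> 1/2 * vol q"
      using half_full[OF q] le_ennreal_iff[of "1/2 * vol q"] by (auto simp: less_imp_le)
    have "emeasure lebesgue (dcube q - ?D) = emeasure lebesgue (dcube q) - emeasure lebesgue ?D"
      using d by (intro emeasure_Diff) auto
    also have "\<dots> = ennreal (vol q - d)" using d by (simp add: emeasure_dyadic ennreal_minus)
    finally have "ennreal c * emeasure (wm w) (dcube q) \<le> emeasure (wm w) (dcube q - ?D)"
      using d by (intro half) (auto intro!: ennreal_leI)
    moreover have "emeasure (wm w) (dcube q) = emeasure (wm w) ?D + emeasure (wm w) (dcube q - ?D)"
      by (subst plus_emeasure) (auto intro!: arg_cong[where f = "emeasure _"])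
    moreover have "emeasure (wm w) (dcube q) < \<infinity>" by (rule wm_dyadic_finite[OF w])
    \<comment> \<open>All three masses are finite, so the inequality can be rearranged in the reals,
      where subtraction behaves.\<close>
    ultimately obtain a b e where h: "emeasure (wm w) ?D = ennreal a" "emeasure (wm w) (dcube q - ?D) = ennreal b"
        "emeasure (wm w) (dcube q) = ennreal e" "a \<ge> 0" "b \<ge> 0" "e \<ge> 0" "e = a + b" "c * e \<le> b"
    proof -
      assume a: "\<And>a b e. \<lbrakk>emeasure (wm w) ?D = ennreal a; emeasure (wm w) (dcube q - ?D) = ennreal b;
        emeasure (wm w) (dcube q) = ennreal e; 0 \<le> a; 0 \<le> b; 0 \<le> e; e = a + b; c * e \<le> b\<rbrakk> \<Longrightarrow> thesis"
      assume h: "ennreal c * emeasure (wm w) (dcube q) \<le> emeasure (wm w) (dcube q - ?D)"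
        "emeasure (wm w) (dcube q) = emeasure (wm w) ?D + emeasure (wm w) (dcube q - ?D)"
        "emeasure (wm w) (dcube q) < \<infinity>"
      then obtain x y where xy: "emeasure (wm w) ?D = ennreal x" "emeasure (wm w) (dcube q - ?D) = ennreal y" "x \<ge> 0" "y \<ge> 0"
        by (cases "emeasure (wm w) ?D"; cases "emeasure (wm w) (dcube q - ?D)") auto
      show thesis
        using h(1) xy c by (intro a[OF xy(1,2), of "x + y"]) (auto simp: h(2) simp flip: ennreal_mult ennreal_plus)
    qed
    have "a \<le> (1 - c) * e" using h(7,8) by (simp add: algebra_simps)
    then have "ennreal a \<le> ennreal (1 - c) * ennreal e"
      using c h(6) by (subst ennreal_mult[symmetric]) (auto intro: ennreal_leI)
    then show ?thesis by (simp only: h(1,3))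
  qed
  have dsM: "dense_set p A \<theta> = (\<Union>q\<in>?M. dense_set p A \<theta> \<inter> dcube q)"
  proof -
    have "dense_set p A \<theta> \<subseteq> dense_set p A \<theta>'" unfolding dense_set_def using mono by blast
    then show ?thesis using dense_set_maximal[of \<theta>'] by blast
  qed
  have "emeasure (wm w) (dense_set p A \<theta>) \<le> (\<integral>\<^sup>+q. emeasure (wm w) (dense_set p A \<theta> \<inter> dcube q) \<partial>count_space ?M)"
    by (subst dsM, rule emeasure_UN_le_nn_integral) auto
  also have "\<dots> \<le> (\<integral>\<^sup>+q. ennreal (1 - c) * emeasure (wm w) (dcube q) \<partial>count_space ?M)"
    using loc by (intro nn_integral_mono) auto
  also have "\<dots> = ennreal (1 - c) * emeasure (wm w) (dense_set p A \<theta>')"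
    unfolding dense_set_maximal by (simp add: nn_integral_cmult emeasure_UN_countable[OF _ _ disjoint_dmaximal])
  finally show ?thesis .
qed

text \<open>Each step divides the density threshold by 2 2^n, starting from 1/2, and gains a factor
  1 - \<open>c\<close>. The bound on \<open>A\<close> is the one that keeps all \<open>k\<close>
  steps admissible.\<close>

lemma dense_set_iterate:
  assumes "emeasure lebesgue A \<le> ennreal (1/2 * (1 / (2 * 2 ^ CARD('n))) ^ k * vol p)"
  shows "emeasure (wm w) (dense_set p A (1/2)) \<le> ennreal ((1 - c) ^ k) * emeasure (wm w) (dcube p)"
proof -
  let ?b = "1 / (2 * 2 ^ CARD('n)) :: real"
  have "(1::real) \<le> 2 ^ CARD('n)" by simp
  then have "(1::real) \<le> 2 * 2 ^ CARD('n)" by linarith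
  then have b: "0 < ?b" "?b \<le> 1" by (simp_all only: divide_le_eq_1_pos zero_less_divide_1_iff)
  have "j \<le> k \<Longrightarrow> emeasure (wm w) (dense_set p A (1/2)) \<le> ennreal ((1 - c) ^ j) * emeasure (wm w) (dense_set p A (1/2 * ?b ^ j))" for j
  proof (induction j)
    case (Suc j)
    have "?b ^ k \<le> ?b ^ Suc j" using b Suc.prems by (intro power_decreasing) auto
    then have "1/2 * ?b ^ k * vol p \<le> (1/2 * ?b ^ j) / (2 * 2 ^ CARD('n)) * vol p"
      by (intro mult_right_mono) (auto simp: less_imp_le)
    then have "emeasure lebesgue A \<le> ennreal ((1/2 * ?b ^ j) / (2 * 2 ^ CARD('n)) * vol p)"
      using assms by (meson ennreal_leI order_trans)
    then have s: "emeasure (wm w) (dense_set p A (1/2 * ?b ^ j)) \<le> ennreal (1 - c) * emeasure (wm w) (dense_set p A ((1/2 * ?b ^ j) / (2 * 2 ^ CARD('n))))"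
      using b by (intro dense_set_step) auto
    have "emeasure (wm w) (dense_set p A (1/2)) \<le> ennreal ((1 - c) ^ j) * emeasure (wm w) (dense_set p A (1/2 * ?b ^ j))"
      using Suc by simp
    also have "\<dots> \<le> ennreal ((1 - c) ^ j) * (ennreal (1 - c) * emeasure (wm w) (dense_set p A ((1/2 * ?b ^ j) / (2 * 2 ^ CARD('n)))))"
      by (intro mult_left_mono s) auto
    also have "\<dots> = ennreal ((1 - c) ^ Suc j) * emeasure (wm w) (dense_set p A (1/2 * ?b ^ Suc j))"
    proof -
      have "(1/2 * ?b ^ j) / (2 * 2 ^ CARD('n)) = 1/2 * ?b ^ Suc j" by simp
      moreover have "ennreal ((1 - c) ^ Suc j) = ennreal ((1 - c) ^ j) * ennreal (1 - c)"
        using c by (simp add: mult.commute flip: ennreal_mult)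
      ultimately show ?thesis by (simp only: mult.assoc)
    qed
    finally show ?case .
  qed simp
  from this[of k] have "emeasure (wm w) (dense_set p A (1/2)) \<le> ennreal ((1 - c) ^ k) * emeasure (wm w) (dense_set p A (1/2 * ?b ^ k))" by simp
  also have "\<dots> \<le> ennreal ((1 - c) ^ k) * emeasure (wm w) (dcube p)"
    using dense_set_subset by (intro mult_left_mono emeasure_mono) auto
  finally show ?thesis .
qed

end

text \<open>The A_infinity property in its power form: absolute continuity on dyadic cubes with a
  power rate, where \<open>x\<close> bounds the relative volume of \<open>E\<close>. It is used for
  u and for \<open>w\<close> alike.\<close>

definition decays :: "real \<Rightarrow> real \<Rightarrow> (real^'n \<Rightarrow> real) \<Rightarrow> bool" where
  "decays C \<gamma> w \<longleftrightarrow> (\<forall>p E x. E \<in> sets lebesgue \<longrightarrow> E \<subseteq> dcube p \<longrightarrow> 0 \<le> x \<longrightarrow> emeasure lebesgue E \<le> ennreal (x * vol p)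
     \<longrightarrow> emeasure (wm w) E \<le> ennreal (C * x powr \<gamma>) * emeasure (wm w) (dcube p))"

lemma decaysD:
  assumes "decays C \<gamma> w" "E \<in> sets lebesgue" "E \<subseteq> dcube p" "0 \<le> x" "emeasure lebesgue E \<le> ennreal (x * vol p)"
  shows "emeasure (wm w) E \<le> ennreal (C * x powr \<gamma>) * emeasure (wm w) (dcube p)"
  using assms unfolding decays_def by blast

text \<open>The constant 1/4 instead of 1/2 leaves room to enlarge \<open>E\<close> to a relatively
  open set \<open>A\<close> of at most twice the allowed volume. Each point of such a set has a
  small dyadic cube inside it, so \<open>A\<close> lies in its own 1/2-dense set without exceptional
  points, and the iteration applies.\<close>

lemma spread_decays_geometric:
  fixes w :: "real^'n \<Rightarrow> real"
  assumes "spread w"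
  obtains q :: real where "1/2 \<le> q" "q < 1"
    "\<And>p E k. E \<in> sets lebesgue \<Longrightarrow> E \<subseteq> dcube p \<Longrightarrow> 
       emeasure lebesgue E \<le> ennreal (1/4 * (1 / (2 * 2 ^ CARD('n))) ^ k * vol p) \<Longrightarrow>
       emeasure (wm w) E \<le> ennreal (q ^ k) * emeasure (wm w) (dcube p)"
proof -
  have w: "weight w" using assms by (simp add: spread_def)
  obtain c where c: "c > 0" "c \<le> 1/2"
    "\<And>p F. F \<in> sets lebesgue \<Longrightarrow> F \<subseteq> dcube p \<Longrightarrow> ennreal (1/2 * vol p) \<le> emeasure lebesgue F
       \<Longrightarrow> ennreal c * emeasure (wm w) (dcube p) \<le> emeasure (wm w) F"
    using spread_dcube[OF assms, of "1/2"] by (metis half_gt_zero zero_less_one)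
  show ?thesis
  proof (rule that[of "1 - c"])
    fix p :: "'n dindex" and E k
    let ?t = "(1 / (2 * 2 ^ CARD('n))) ^ k * vol p"
    assume E: "E \<in> sets lebesgue" "E \<subseteq> dcube p" "emeasure lebesgue E \<le> ennreal (1/4 * (1 / (2 * 2 ^ CARD('n))) ^ k * vol p)"
    have "1/4 * ?t > 0" by simp
    then obtain U where U: "open U" "E \<subseteq> U" "U - E \<in> lmeasurable" "emeasure lebesgue (U - E) < ennreal (1/4 * ?t)"
      using sets_lebesgue_outer_open[OF E(1)] by metis
    define A where "A = U \<inter> dcube p"
    have A: "A \<in> sets lebesgue" "A \<subseteq> dcube p" using U by (auto simp: A_def)
    have "emeasure lebesgue A \<le> emeasure lebesgue (E \<union> (U - E))"
      using U E by (intro emeasure_mono) (auto simp: A_def)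
    also have "\<dots> \<le> emeasure lebesgue E + emeasure lebesgue (U - E)"
      using E U by (intro emeasure_subadditive) auto
    also have "\<dots> \<le> ennreal (1/4 * ?t) + ennreal (1/4 * ?t)"
      using E(3) U(4) by (intro add_mono) (auto simp: mult.assoc less_imp_le)
    also have "\<dots> = ennreal (1/2 * (1 / (2 * 2 ^ CARD('n))) ^ k * vol p)"
      by (subst ennreal_plus[symmetric]) (auto simp: less_imp_le)
    finally have mA: "emeasure lebesgue A \<le> ennreal (1/2 * (1 / (2 * 2 ^ CARD('n))) ^ k * vol p)" .
    have "A \<subseteq> dense_set p A (1/2)"
    proof
      fix x assume x: "x \<in> A"
      obtain s where s: "x \<in> dcube s" "dcube s \<subseteq> U" "fst s \<le> fst p"
        using small_dcube_in_open[OF U(1), of x "fst p"] x unfolding A_def by blast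
      have "dcube s \<subseteq> dcube p" using dcube_subset(1)[OF s(1) _ s(3)] x by (auto simp: A_def)
      then have "A \<inter> dcube s = dcube s" using s by (auto simp: A_def)
      moreover have "ennreal (1/2 * vol s) < ennreal (vol s)" by (rule ennreal_lessI) auto
      ultimately have "s \<in> dense_cubes p A (1/2)"
        using \<open>dcube s \<subseteq> dcube p\<close> by (simp add: dense_cubes_def emeasure_dyadic)
      then show "x \<in> dense_set p A (1/2)" unfolding dense_set_def using s by auto
    qed
    then have "emeasure (wm w) E \<le> emeasure (wm w) (dense_set p A (1/2))"
      using U E dense_set_sets[OF w A c(1,2,3)] by (intro emeasure_mono) (auto simp: A_def)
    also have "\<dots> \<le> ennreal ((1 - c) ^ k) * emeasure (wm w) (dcube p)"
      by (rule dense_set_iterate[OF w A c(1,2,3) mA])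
    finally show "emeasure (wm w) E \<le> ennreal ((1 - c) ^ k) * emeasure (wm w) (dcube p)" .
  qed (use c in auto)
qed

text \<open>Interpolation of the geometric decay: \<gamma> solves b^\<gamma> = q, where b = 1/(2
  2^n) is the volume ratio and q the mass ratio of one step. As b \<le> 1/2 \<le> q, \<gamma> is at
  most 1, which \<open>truncated_mass\<close> relies on.\<close>

lemma spread_decays:
  fixes w :: "real^'n \<Rightarrow> real"
  assumes "spread w"
  obtains C \<gamma> where "C > 0" "0 < \<gamma>" "\<gamma> \<le> 1" "decays C \<gamma> w"
proof -
  have w: "weight w" using assms by (simp add: spread_def)
  obtain q where q: "1/2 \<le> q" "q < 1" and geo:
    "\<And>p E k. E \<in> sets lebesgue \<Longrightarrow> E \<subseteq> dcube p \<Longrightarrow> 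
       emeasure lebesgue E \<le> ennreal (1/4 * (1 / (2 * 2 ^ CARD('n))) ^ k * vol p) \<Longrightarrow>
       emeasure (wm w) E \<le> ennreal (q ^ k) * emeasure (wm w) (dcube p)"
    using spread_decays_geometric[OF assms] by metis
  define b :: real where "b = 1 / (2 * 2 ^ CARD('n))"
  have b: "0 < b" "b \<le> 1/2" by (auto simp: b_def)
  define \<gamma> where "\<gamma> = ln q / ln b"
  have lb: "ln b < 0" "ln b \<le> ln (1/2)" using b by (auto simp: ln_le_cancel_iff)
  have lq: "ln q < 0" "ln (1/2) \<le> ln q" using q by (auto simp: ln_le_cancel_iff simp del: ln_div)
  have \<gamma>: "0 < \<gamma>" "\<gamma> \<le> 1" using lb lq by (auto simp: \<gamma>_def zero_less_divide_iff divide_le_eq)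
  have bq: "b powr (\<gamma> * y) = q powr y" for y
    using b q lb by (simp add: powr_def \<gamma>_def)
  \<comment> \<open>The factor 4^\<gamma> undoes the 1/4 of the geometric estimate, and 1/q pays for
    rounding the exponent ln (4x) / ln b down to an integer.\<close>
  have "decays (4 powr \<gamma> / q) \<gamma> w"
    unfolding decays_def
  proof (intro allI impI)
    fix p :: "'n dindex" and E x
    assume E: "E \<in> sets lebesgue" "E \<subseteq> dcube p" "0 \<le> x" "emeasure lebesgue E \<le> ennreal (x * vol p)"
    consider "x = 0" | "x > 1/4" | "0 < x" "x \<le> 1/4" using E by linarith
    then show "emeasure (wm w) E \<le> ennreal (4 powr \<gamma> / q * x powr \<gamma>) * emeasure (wm w) (dcube p)"
    proof cases
      case 1
      then show ?thesis using E wm_null[OF w E(1)] by simp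
    next
      case 2
      have "1 \<le> (4 * x) powr \<gamma> / q"
        using 2 \<gamma> q ge_one_powr_ge_zero[of "4 * x" \<gamma>] by (simp add: le_divide_eq)
      also have "\<dots> = 4 powr \<gamma> / q * x powr \<gamma>" using 2 by (simp add: powr_mult)
      finally have "1 * emeasure (wm w) (dcube p) \<le> ennreal (4 powr \<gamma> / q * x powr \<gamma>) * emeasure (wm w) (dcube p)"
        by (intro mult_right_mono) (metis ennreal_1 ennreal_leI, simp)
      moreover have "emeasure (wm w) E \<le> emeasure (wm w) (dcube p)" using E by (intro emeasure_mono) auto
      ultimately show ?thesis by simp
    next
      case 3
      define k where "k = nat \<lfloor>ln (4 * x) / ln b\<rfloor>"
      have nn: "0 \<le> ln (4 * x) / ln b" using 3 lb by (simp add: divide_nonpos_neg)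
      have k: "real k \<le> ln (4 * x) / ln b" "ln (4 * x) / ln b < real k + 1"
        using nn by (auto simp: k_def)
      have "ln (4 * x) \<le> real k * ln b" using k(1) lb by (simp add: neg_le_divide_eq)
      then have "ln (4 * x) \<le> ln (b ^ k)" using b by (simp add: ln_realpow)
      then have "4 * x \<le> b ^ k" using 3 b by (subst (asm) ln_le_cancel_iff) auto
      then have "x * vol p \<le> 1/4 * b ^ k * vol p" by (intro mult_right_mono) (auto simp: less_imp_le)
      then have "emeasure (wm w) E \<le> ennreal (q ^ k) * emeasure (wm w) (dcube p)"
        using E by (intro geo) (auto simp: b_def intro: order_trans[OF _ ennreal_leI])
      also have "q ^ k \<le> 4 powr \<gamma> / q * x powr \<gamma>"
      proof -
        have "(real k + 1) * ln b \<le> ln (4 * x)" using k(2) lb by (simp add: neg_divide_less_eq)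
        then have "ln (b powr (real k + 1)) \<le> ln (4 * x)" using b by (simp add: ln_powr)
        then have "b powr (real k + 1) \<le> 4 * x" using 3 b by (subst (asm) ln_le_cancel_iff) auto
        then have "(b powr (real k + 1)) powr \<gamma> \<le> (4 * x) powr \<gamma>" using \<gamma> b by (intro powr_mono2) auto
        also have "(b powr (real k + 1)) powr \<gamma> = q powr (real k + 1)"
          using bq[of "real k + 1"] by (simp add: powr_powr mult.commute)
        also have "\<dots> = q ^ k * q" using q by (simp add: powr_add powr_realpow)
        finally show ?thesis using q 3 by (simp add: powr_mult field_simps)
      qed
      finally show ?thesis by (simp add: mult_right_mono ennreal_leI)
    qed
  qed
  then show ?thesis using that[of "4 powr \<gamma> / q" \<gamma>] \<gamma> q by auto
qed

section \<open>Reverse Hoelder inequality and Lebesgue differentiation\<close>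

lemma wm_ge:
  assumes "weight w" "E \<in> sets lebesgue" "\<And>x. x \<in> E \<Longrightarrow> s \<le> w x"
  shows "ennreal s * emeasure lebesgue E \<le> emeasure (wm w) E"
proof -
  have "ennreal s * emeasure lebesgue E = (\<integral>\<^sup>+x. ennreal s * indicator E x \<partial>lebesgue)"
    using assms by (simp add: nn_integral_cmult_indicator)
  also have "\<dots> \<le> (\<integral>\<^sup>+x. ennreal (w x) * indicator E x \<partial>lebesgue)"
    using assms by (intro nn_integral_mono) (auto split: split_indicator intro: ennreal_leI)
  finally show ?thesis using assms by (simp add: emeasure_wm)
qed

lemma nn_integral_geometric:
  assumes "0 \<le> a" "0 \<le> q" "q < 1"
  shows "(\<integral>\<^sup>+i. ennreal (a * q ^ i) \<partial>count_space UNIV) = ennreal (a / (1 - q))"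
proof -
  have "(\<lambda>i. a * q ^ i) sums (a * (1 / (1 - q)))"
    using assms by (intro sums_mult geometric_sums) auto
  then show ?thesis
    using assms unfolding nn_integral_count_space_nat by (intro suminf_ennreal_eq) auto
qed

text \<open>The single layer with 2^i < y \<le> 2^(i+1) already dominates. Writing the sum over all
  layers removes the dependence of i on y before integrating.\<close>

lemma powr_le_layers:
  fixes y \<kappa> :: real
  assumes "0 \<le> y" "0 < \<kappa>"
  shows "ennreal (y powr (1 + \<kappa>)) \<le>
    1 + (\<integral>\<^sup>+i. ennreal ((2 ^ (i + 1)) powr \<kappa>) * (ennreal y * indicator {y. 2 ^ i < y} y) \<partial>count_space UNIV)"
proof (cases "y \<le> 1")
  case True
  then have "y powr (1 + \<kappa>) \<le> 1" using assms by (simp add: powr_le1)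
  then have "ennreal (y powr (1 + \<kappa>)) \<le> 1" by (metis ennreal_1 ennreal_leI)
  then show ?thesis by (rule order_trans) simp
next
  case False
  define i where "i = nat (\<lceil>log 2 y\<rceil> - 1)"
  have "log 2 y > 0" using False by simp
  then have i: "real i < log 2 y" "log 2 y \<le> real i + 1" unfolding i_def by linarith+
  then have "2 powr real i < 2 powr log 2 y" "2 powr log 2 y \<le> 2 powr (real i + 1)" by simp_all
  then have i: "2 ^ i < y" "y \<le> 2 ^ (i + 1)" using False by (simp_all add: powr_add powr_realpow)
  have "y powr (1 + \<kappa>) = y powr \<kappa> * y" using False by (simp add: powr_add)
  also have "\<dots> \<le> (2 ^ (i + 1)) powr \<kappa> * y"
    using False assms i by (intro mult_right_mono powr_mono2) auto
  finally have "ennreal (y powr (1 + \<kappa>)) \<le> ennreal ((2 ^ (i + 1)) powr \<kappa>) * (ennreal y * indicator {y. 2 ^ i < y} y)"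
    using i False by (simp add: ennreal_leI flip: ennreal_mult)
  also have "\<dots> \<le> (\<integral>\<^sup>+i. ennreal ((2 ^ (i + 1)) powr \<kappa>) * (ennreal y * indicator {y. 2 ^ i < y} y) \<partial>count_space UNIV)"
    by (rule nn_integral_ge_point) simp
  finally show ?thesis by (rule order_trans) simp
qed

text \<open>Here \<open>l\<close> is any upper bound for the mean, since later it comes from a
  triple. The layer w > 2^i l has relative volume at most 2^(-i), so its mass decays like 2^(-i
  \<gamma>); raising the exponent by only \<gamma>/2 leaves a convergent geometric series.\<close>

lemma reverse_holder:
  fixes w :: "real^'n \<Rightarrow> real"
  assumes w: "weight w" and dec: "decays C \<gamma> w" and "C > 0" "0 < \<gamma>"
  obtains C' where "C' > 0"
    "\<And>p l. l > 0 \<Longrightarrow> emeasure (wm w) (dcube p) \<le> ennreal (l * vol p) \<Longrightarrow>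
      (\<integral>\<^sup>+x\<in>dcube p. ennreal ((w x / l) powr (1 + \<gamma>/2)) \<partial>lebesgue) \<le> ennreal (C' * vol p)"
proof -
  define \<kappa> where "\<kappa> = \<gamma> / 2"
  have \<kappa>: "\<kappa> > 0" using assms by (simp add: \<kappa>_def)
  \<comment> \<open>The decay 2^(-i \<gamma>) equals q^i q^i: one factor cancels the power
    (2^i)^\<kappa> of the layer, the other makes the series converge.\<close>
  define q :: real where "q = 2 powr (- \<kappa>)"
  have q: "0 < q" "q < 1" using \<kappa> by (auto simp: q_def intro: powr_less_one)
  define C' where "C' = 1 + C * 2 powr \<kappa> / (1 - q)"
  have [measurable]: "w \<in> borel_measurable lebesgue" by (rule weight_measurable[OF w])
  have w0: "0 \<le> w x" for x using w by (simp add: weight_def)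
  show ?thesis
  proof (rule that[of C'])
    show "C' > 0" using assms q by (auto simp: C'_def intro!: add_pos_pos)
    fix p :: "'n dindex" and l :: real
    assume l: "l > 0" and av: "emeasure (wm w) (dcube p) \<le> ennreal (l * vol p)"
    define E where "E i = {x \<in> dcube p. 2 ^ i < w x / l}" for i :: nat
    have "(\<lambda>x. w x / l) -` {2 ^ i<..} \<inter> space lebesgue \<in> sets lebesgue" for i :: nat by measurable
    then have "dcube p \<inter> ((\<lambda>x. w x / l) -` {2 ^ i<..} \<inter> space lebesgue) \<in> sets lebesgue" for i :: nat
      by (intro sets.Int) auto
    moreover have "dcube p \<inter> ((\<lambda>x. w x / l) -` {2 ^ i<..} \<inter> space lebesgue) = E i" for i
      by (auto simp: E_def)
    ultimately have E: "E i \<in> sets lebesgue" "E i \<subseteq> dcube p" for i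
      by (metis, auto simp: E_def)
    have WE: "emeasure (wm w) (E i) \<le> ennreal (C * (q ^ i * q ^ i) * (l * vol p))" for i
    proof -
      have "ennreal (2 ^ i * l) * emeasure lebesgue (E i) \<le> emeasure (wm w) (E i)"
        using l by (intro wm_ge[OF w E(1)]) (auto simp: E_def pos_less_divide_eq)
      also have "\<dots> \<le> emeasure (wm w) (dcube p)" using E by (intro emeasure_mono) auto
      also have "\<dots> \<le> ennreal (l * vol p)" by (rule av)
      also have "\<dots> = ennreal (2 ^ i * l) * ennreal ((1/2) ^ i * vol p)"
        using l by (simp add: power_divide less_imp_le flip: ennreal_mult)
      finally have "emeasure lebesgue (E i) \<le> ennreal ((1/2) ^ i * vol p)"
        using l by (simp add: ennreal_mult_le_mult_iff)
      then have "emeasure (wm w) (E i) \<le> ennreal (C * ((1/2) ^ i) powr \<gamma>) * emeasure (wm w) (dcube p)"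
        using dec E unfolding decays_def by simp
      also have "\<dots> \<le> ennreal (C * ((1/2) ^ i) powr \<gamma>) * ennreal (l * vol p)"
        by (intro mult_left_mono av) simp
      also have "((1/2) ^ i) powr \<gamma> = q ^ i * q ^ i"
      proof -
        have "((1/2) ^ i) powr \<gamma> = ((1/2) powr \<gamma>) ^ i" by (simp add: powr_power powr_realpow[symmetric] powr_powr mult.commute)
        also have "(1/2) powr \<gamma> = q * q"
          by (simp add: q_def \<kappa>_def powr_minus powr_divide inverse_eq_divide flip: powr_add)
        finally show ?thesis by (simp add: power_mult_distrib)
      qed
      also have "ennreal (C * (q ^ i * q ^ i)) * ennreal (l * vol p) = ennreal (C * (q ^ i * q ^ i) * (l * vol p))"
        using l \<open>C > 0\<close> q by (intro ennreal_mult[symmetric]) (auto simp: less_imp_le)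
      finally show ?thesis .
    qed
    have "(\<integral>\<^sup>+x\<in>dcube p. ennreal ((w x / l) powr (1 + \<gamma>/2)) \<partial>lebesgue)
      \<le> (\<integral>\<^sup>+x. indicator (dcube p) x + (\<integral>\<^sup>+i. ennreal ((2 ^ (i + 1)) powr \<kappa> / l) * (ennreal (w x) * indicator (E i) x) \<partial>count_space UNIV) \<partial>lebesgue)"
    proof (intro nn_integral_mono)
      fix x
      have "ennreal ((2 ^ (i + 1)) powr \<kappa>) * (ennreal (w x / l) * indicator {y. 2 ^ i < y} (w x / l))
          = ennreal ((2 ^ (i + 1)) powr \<kappa> / l) * (ennreal (w x) * indicator (E i) x)" if "x \<in> dcube p" for i
        using l w0[of x] that by (auto simp: E_def mult.commute split: split_indicator simp flip: ennreal_mult)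
      then show "ennreal ((w x / l) powr (1 + \<gamma>/2)) * indicator (dcube p) x \<le> 
        indicator (dcube p) x + (\<integral>\<^sup>+i. ennreal ((2 ^ (i + 1)) powr \<kappa> / l) * (ennreal (w x) * indicator (E i) x) \<partial>count_space UNIV)"
        using powr_le_layers[of "w x / l" \<kappa>] l w0[of x] \<kappa> by (auto simp: \<kappa>_def[symmetric] split: split_indicator)
    qed
    also have "\<dots> = (\<integral>\<^sup>+x. indicator (dcube p) x \<partial>lebesgue) + 
      (\<integral>\<^sup>+x. \<integral>\<^sup>+i. ennreal ((2 ^ (i + 1)) powr \<kappa> / l) * (ennreal (w x) * indicator (E i) x) \<partial>count_space UNIV \<partial>lebesgue)"
      using E(1) by (intro nn_integral_add) (auto simp: nn_integral_count_space_nat)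
    also have "(\<integral>\<^sup>+x. \<integral>\<^sup>+i. ennreal ((2 ^ (i + 1)) powr \<kappa> / l) * (ennreal (w x) * indicator (E i) x) \<partial>count_space UNIV \<partial>lebesgue)
       = (\<integral>\<^sup>+i. \<integral>\<^sup>+x. ennreal ((2 ^ (i + 1)) powr \<kappa> / l) * (ennreal (w x) * indicator (E i) x) \<partial>lebesgue \<partial>count_space UNIV)"
      using E(1) by (intro nn_integral_count_space_nn_integral) auto
    also have "\<dots> = (\<integral>\<^sup>+i. ennreal ((2 ^ (i + 1)) powr \<kappa> / l) * emeasure (wm w) (E i) \<partial>count_space UNIV)"
      using E(1) by (intro nn_integral_cong) (simp add: nn_integral_cmult emeasure_wm[OF w])
    also have "\<dots> \<le> (\<integral>\<^sup>+i. ennreal (C * 2 powr \<kappa> * vol p * q ^ i) \<partial>count_space UNIV)"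
    proof (intro nn_integral_mono)
      fix i :: nat
      have "ennreal ((2 ^ (i + 1)) powr \<kappa> / l) * emeasure (wm w) (E i)
         \<le> ennreal ((2 ^ (i + 1)) powr \<kappa> / l) * ennreal (C * (q ^ i * q ^ i) * (l * vol p))"
        by (intro mult_left_mono WE) simp
      also have "\<dots> = ennreal ((2 ^ (i + 1)) powr \<kappa> * q ^ i * (C * vol p * q ^ i))"
      proof (subst ennreal_mult[symmetric])
        show "0 \<le> C * (q ^ i * q ^ i) * (l * vol p)" using l \<open>C > 0\<close> q by (auto simp: less_imp_le)
      qed (use l in \<open>simp_all add: mult_ac\<close>)
      also have "(2 ^ (i + 1)) powr \<kappa> * q ^ i = 2 powr \<kappa>"
      proof -
        have "q ^ i = 2 powr (real i * - \<kappa>)" by (simp only: q_def powr_power zero_neq_numeral[symmetric] simp_thms)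
        moreover have "(2::real) ^ (i + 1) = 2 powr (real i + 1)" by (simp add: powr_add powr_realpow)
        then have "((2::real) ^ (i + 1)) powr \<kappa> = 2 powr ((real i + 1) * \<kappa>)" by (simp only: powr_powr)
        ultimately show ?thesis by (simp add: algebra_simps flip: powr_add)
      qed
      finally show "ennreal ((2 ^ (i + 1)) powr \<kappa> / l) * emeasure (wm w) (E i) \<le> ennreal (C * 2 powr \<kappa> * vol p * q ^ i)"
        by (simp add: mult_ac)
    qed
    also have "\<dots> = ennreal (C * 2 powr \<kappa> * vol p / (1 - q))"
      using assms q by (intro nn_integral_geometric) (auto simp: less_imp_le)
    also have "(\<integral>\<^sup>+x. indicator (dcube p) x \<partial>lebesgue) + ennreal (C * 2 powr \<kappa> * vol p / (1 - q)) = ennreal (C' * vol p)"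
      using assms q by (simp add: emeasure_dyadic C'_def less_imp_le algebra_simps flip: ennreal_plus)
    finally show "(\<integral>\<^sup>+x\<in>dcube p. ennreal ((w x / l) powr (1 + \<gamma>/2)) \<partial>lebesgue) \<le> ennreal (C' * vol p)"
      by (simp add: add_left_mono)
  qed
qed

text \<open>Lebesgue differentiation along the cubes with lower corner \<open>x\<close>. The null
  set is fixed before \<open>m\<close>, so one exceptional set serves all levels.\<close>

lemma weight_le_averages:
  fixes w :: "real^'n \<Rightarrow> real"
  assumes w: "weight w"
  obtains Z where "Z \<in> null_sets lebesgue"
    "\<And>x m. x \<notin> Z \<Longrightarrow> 0 \<le> m \<Longrightarrow> \<forall>Q. cube Q \<longrightarrow> x \<in> Q \<longrightarrow> emeasure (wm w) Q \<le> ennreal m * emeasure lebesgue Q \<Longrightarrow> w x \<le> m"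
proof -
  have wi: "w absolutely_integrable_on cbox a b" for a b using w by (simp add: weight_def)
  then have "w integrable_on cbox a b" for a b using set_lebesgue_integral_eq_integral(1) by blast
  then obtain Z where Z: "negligible Z" "\<And>x e. x \<notin> Z \<Longrightarrow> 0 < e \<Longrightarrow> \<exists>d>0. \<forall>h. 0 < h \<and> h < d \<longrightarrow>
       norm (integral (cbox x (x + h *\<^sub>R One)) w /\<^sub>R h ^ DIM(real^'n) - w x) < e"
    using integrable_ccontinuous_explicit[of w] by metis
  show ?thesis
  proof (rule that[of Z])
    show "Z \<in> null_sets lebesgue" using Z(1) by (simp add: negligible_iff_null_sets)
    fix x m assume x: "x \<notin> Z" and m: "0 \<le> m" 
      and Q: "\<forall>Q. cube Q \<longrightarrow> x \<in> Q \<longrightarrow> emeasure (wm w) Q \<le> ennreal m * emeasure lebesgue Q"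
    show "w x \<le> m"
    proof (rule ccontr)
      assume "\<not> w x \<le> m"
      then obtain d where d: "d > 0" "\<And>h. 0 < h \<and> h < d \<Longrightarrow> 
          norm (integral (cbox x (x + h *\<^sub>R One)) w /\<^sub>R h ^ DIM(real^'n) - w x) < w x - m"
        using Z(2)[OF x, of "w x - m"] by auto
      define h where "h = d / 2"
      have h: "h > 0" "h < d" using d by (auto simp: h_def)
      define Q where "Q = cbox x (\<chi> i. x $ i + h)"
      have "(One :: real^'n) $ i = 1" for i
        by (simp add: cart_eq_inner_axis inner_sum_left inner_Basis axis_in_Basis_iff)
      then have QO: "cbox x (x + h *\<^sub>R One) = Q" unfolding Q_def by (auto intro!: arg_cong2[where f = cbox] simp: vec_eq_iff)
      have cQ: "cube Q" "x \<in> Q" unfolding Q_def cube_def using h by (auto simp: mem_box_cart)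
      have I: "integral Q w = (LINT x:Q|lebesgue. w x)"
        using set_lebesgue_integral_eq_integral(2)[OF wi] unfolding Q_def by metis
      have "emeasure (wm w) Q = ennreal (integral Q w)"
        using emeasure_wm_integral[OF w cube_lebesgue(2,1)[OF cQ(1)]] I by simp
      then have "ennreal (integral Q w) \<le> ennreal (m * h ^ CARD('n))"
        using Q[rule_format, OF cQ] emeasure_cbox_side(1)[OF h(1), of x] m h unfolding Q_def[symmetric] by (simp add: ennreal_mult)
      then have "integral Q w \<le> m * h ^ CARD('n)" using m h by (simp add: ennreal_le_iff2) (meson mult_nonneg_nonneg zero_le_power less_imp_le order_trans)
      then have "integral Q w /\<^sub>R h ^ CARD('n) \<le> m" using h by (simp add: field_simps)
      moreover have "\<bar>integral Q w /\<^sub>R h ^ CARD('n) - w x\<bar> < w x - m"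
        using d(2)[of h] h QO by simp
      ultimately show False by linarith
    qed
  qed
qed

section \<open>Young functions\<close>

lemma log_plus_nonneg [simp]: "0 \<le> log_plus z" by (simp add: log_plus_def)

lemma log_plus_mono:
  assumes "0 \<le> a" "a \<le> b" shows "log_plus a \<le> log_plus b"
proof (cases "a = 0")
  case False
  then have "ln a \<le> ln b" using assms by simp
  then show ?thesis using assms False by (simp add: log_plus_def max.coboundedI2 del: ln_le_cancel_iff)
qed (simp add: log_plus_def)

lemma log_plus_mult:
  assumes "0 \<le> a" "0 \<le> b" shows "log_plus (a * b) \<le> log_plus a + log_plus b"
  using assms by (auto simp: log_plus_def ln_mult)

lemma le_exp_log_plus: "0 \<le> z \<Longrightarrow> z \<le> exp (log_plus z)"
  by (cases "z = 0") (auto simp: log_plus_def max_def)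

lemma eta_nonneg: "0 \<le> z \<Longrightarrow> 0 \<le> eta \<delta> \<epsilon> z" by (simp add: eta_def)

lemma eta_mono:
  assumes "0 \<le> \<delta>" "0 < \<epsilon>" "0 \<le> a" "a \<le> b"
  shows "eta \<delta> \<epsilon> a \<le> eta \<delta> \<epsilon> b"
  unfolding eta_def using assms by (intro mult_mono powr_mono2) (auto intro: log_plus_mono add_nonneg_nonneg)

text \<open>Follows from 1 + a + b \<le> (1 + a)(1 + b) for the logarithms. It allows a constant
  factor of f to be pulled out of \<eta> at the end.\<close>

lemma eta_mult:
  assumes "0 \<le> \<delta>" "0 < \<epsilon>" "0 \<le> a" "0 \<le> b"
  shows "eta \<delta> \<epsilon> (a * b) \<le> eta \<delta> \<epsilon> a * eta \<delta> \<epsilon> b"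
proof -
  have "1 + log_plus (a * b) \<le> 1 + (log_plus a + log_plus b)" using log_plus_mult assms by simp
  also have "\<dots> \<le> (1 + log_plus a) * (1 + log_plus b)" by (simp add: algebra_simps)
  finally have "(1 + log_plus (a * b)) powr (\<delta> / \<epsilon>) \<le> ((1 + log_plus a) * (1 + log_plus b)) powr (\<delta> / \<epsilon>)"
    using assms by (intro powr_mono2) (auto intro: add_nonneg_nonneg)
  also have "\<dots> = (1 + log_plus a) powr (\<delta> / \<epsilon>) * (1 + log_plus b) powr (\<delta> / \<epsilon>)"
    by (simp add: powr_mult add_nonneg_nonneg)
  finally have "(a * b) * (1 + log_plus (a * b)) powr (\<delta> / \<epsilon>) \<le> (a * b) * ((1 + log_plus a) powr (\<delta> / \<epsilon>) * (1 + log_plus b) powr (\<delta> / \<epsilon>))"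
    using assms by (intro mult_left_mono) auto
  then show ?thesis by (simp add: eta_def mult_ac)
qed

lemma eta_measurable [measurable]: "eta \<delta> \<epsilon> \<in> borel_measurable borel"
  unfolding eta_def[abs_def] log_plus_def[abs_def] by measurable

text \<open>This is where \<epsilon> < 1 matters: L^\<epsilon> is then o(L), so an exponential of
  arbitrarily small rate wins for L \<ge> X. The remaining bounded range is paid for by
  \<open>K\<close>.\<close>

lemma exp_powr_bound:
  fixes \<epsilon> \<delta> \<kappa> :: real
  assumes "0 < \<epsilon>" "\<epsilon> < 1" "0 \<le> \<delta>" "0 < \<kappa>"
  obtains K where "K > 0" "\<And>L. 1 \<le> L \<Longrightarrow> exp (L powr \<epsilon>) * L powr \<delta> \<le> K * exp (\<kappa> * (L - 1))"
proof -
  have "((\<lambda>L::real. exp (L powr \<epsilon>) * L powr \<delta> / exp (\<kappa> * (L - 1))) \<longlongrightarrow> 0) at_top"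
    using assms by real_asymp
  then have "\<forall>\<^sub>F L in at_top. exp (L powr \<epsilon>) * L powr \<delta> / exp (\<kappa> * (L - 1)) < 1"
    by (rule order_tendstoD) simp
  then obtain X where X: "\<And>L. L \<ge> X \<Longrightarrow> exp (L powr \<epsilon>) * L powr \<delta> / exp (\<kappa> * (L - 1)) < 1"
    by (auto simp: eventually_at_top_linorder)
  define K where "K = max 1 (exp (X powr \<epsilon>) * X powr \<delta>)"
  show ?thesis
  proof (rule that[of K])
    fix L :: real assume L: "1 \<le> L"
    show "exp (L powr \<epsilon>) * L powr \<delta> \<le> K * exp (\<kappa> * (L - 1))"
    proof (cases "L \<ge> X")
      case True
      then have "exp (L powr \<epsilon>) * L powr \<delta> \<le> 1 * exp (\<kappa> * (L - 1))" using X[OF True] by (simp add: divide_less_eq)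
      also have "\<dots> \<le> K * exp (\<kappa> * (L - 1))" by (intro mult_right_mono) (auto simp: K_def)
      finally show ?thesis .
    next
      case False
      then have "exp (L powr \<epsilon>) * L powr \<delta> \<le> exp (X powr \<epsilon>) * X powr \<delta>"
        using L assms by (intro mult_mono) (auto intro: powr_mono2)
      also have "\<dots> \<le> K * 1" by (simp add: K_def)
      also have "\<dots> \<le> K * exp (\<kappa> * (L - 1))" using L assms by (intro mult_left_mono) (auto simp: K_def)
      finally show ?thesis .
    qed
  qed (simp add: K_def)
qed

section \<open>Growth of the functions in the Young class\<close>

context
  fixes r \<delta> :: real and \<Phi> :: "real \<Rightarrow> real"
  assumes r: "1 \<le> r" and \<delta>: "0 \<le> \<delta>" and \<Phi>: "\<Phi> \<in> young_class r \<delta>"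
begin

lemma young_nonneg: "0 \<le> t \<Longrightarrow> 0 \<le> \<Phi> t"
  and young_mono: "0 \<le> s \<Longrightarrow> s \<le> t \<Longrightarrow> \<Phi> s \<le> \<Phi> t"
  and young_0: "\<Phi> 0 = 0"
  using \<Phi> by (auto simp: young_class_def young_function_def mono_on_def)

lemma young_submult:
  assumes "0 \<le> s" "0 \<le> t" shows "\<Phi> (s * t) \<le> \<Phi> s * \<Phi> t"
  using \<Phi> assms young_0 by (cases "s = 0 \<or> t = 0") (auto simp: young_class_def submultiplicative_def)

text \<open>Otherwise \<Phi>(t) \<le> \<Phi>(1) \<Phi>(t) = 0 for all t \<ge> 1, against \<Phi>(t)
  tending to infinity.\<close>

lemma young_1_pos: "\<Phi> 1 > 0"
proof (rule ccontr)
  assume "\<not> \<Phi> 1 > 0"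
  then have 0: "\<Phi> 1 = 0" using young_nonneg[of 1] by simp
  have "filterlim \<Phi> at_top at_top" using \<Phi> by (simp add: young_class_def young_function_def)
  then have "\<forall>\<^sub>F t in at_top. 1 \<le> \<Phi> t" by (simp add: filterlim_at_top)
  then obtain N where "\<And>t. t \<ge> N \<Longrightarrow> 1 \<le> \<Phi> t" by (auto simp: eventually_at_top_linorder)
  moreover define t where "t = max N 1"
  ultimately have "1 \<le> \<Phi> t" "1 \<le> t" by auto
  then show False using young_submult[of 1 t] 0 by simp
qed

text \<open>Lower type with s = 1/t compares \<Phi>(1) with \<Phi>(t), and \<Phi>(1) \<ge> 1 because
  0 < \<Phi>(1) \<le> \<Phi>(1)^2. Through this bound Luxemburg averages of v control averages of
  v^r.\<close>

lemma young_ge_powr: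
  obtains C where "C > 0" "\<And>t. 0 \<le> t \<Longrightarrow> t powr r \<le> 1 + C * \<Phi> t"
proof -
  obtain C where C: "C > 0" "\<And>s t. 0 < s \<Longrightarrow> s \<le> 1 \<Longrightarrow> 0 < t \<Longrightarrow> \<Phi> (s * t) \<le> C * s powr r * \<Phi> t"
    using \<Phi> by (auto simp: young_class_def lower_type_def)
  show ?thesis
  proof (rule that[OF C(1)])
    fix t :: real assume "0 \<le> t"
    show "t powr r \<le> 1 + C * \<Phi> t"
    proof (cases "t \<le> 1")
      case True
      then have "t powr r \<le> 1" using r \<open>0 \<le> t\<close> by (simp add: powr_le1)
      moreover have "0 \<le> C * \<Phi> t" using C young_nonneg \<open>0 \<le> t\<close> by simp
      ultimately show ?thesis by simp
    next
      case False
      have "\<Phi> 1 = \<Phi> (1 / t * t)" using False by simp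
      also have "\<dots> \<le> C * (1 / t) powr r * \<Phi> t" using False by (intro C) auto
      finally have a: "\<Phi> 1 * t powr r \<le> C * \<Phi> t" using False by (simp add: powr_divide field_simps)
      have "\<Phi> 1 = \<Phi> (1 * 1)" by simp
      then have one: "1 \<le> \<Phi> 1" using young_submult[of 1 1] young_1_pos by simp
      have "1 * t powr r \<le> \<Phi> 1 * t powr r" by (intro mult_right_mono one) simp
      then show ?thesis using a by simp
    qed
  qed
qed

text \<open>Extends the growth condition from large t to all t: lower type covers t \<le> 1 and
  monotonicity the gap up to \<open>t0\<close>. The 1 added to the logarithm keeps the logarithmic
  factor at least 1 there.\<close>

lemma young_le_powr_log:
  obtains C where "C > 0" "\<And>t. 0 \<le> t \<Longrightarrow> \<Phi> t \<le> C * t powr r * (1 + log_plus t) powr \<delta>"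
proof -
  obtain C where C: "C > 0" "\<And>s t. 0 < s \<Longrightarrow> s \<le> 1 \<Longrightarrow> 0 < t \<Longrightarrow> \<Phi> (s * t) \<le> C * s powr r * \<Phi> t"
    using \<Phi> by (auto simp: young_class_def lower_type_def)
  obtain C0 t0 where C0: "C0 > 0" "t0 \<ge> 1" "\<And>t. t \<ge> t0 \<Longrightarrow> \<Phi> t / t powr r \<le> C0 * ln t powr \<delta>"
    using \<Phi> by (auto simp: young_class_def)
  define K where "K = C0 + C * \<Phi> 1 + \<Phi> t0"
  have K: "C0 \<le> K" "C * \<Phi> 1 \<le> K" "\<Phi> t0 \<le> K" "K > 0"
    using C C0 young_nonneg[of 1] young_nonneg[of t0] by (auto simp: K_def intro!: add_pos_nonneg)
  show ?thesis
  proof (rule that[OF K(4)])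
    fix t :: real assume t: "0 \<le> t"
    have L: "1 \<le> (1 + log_plus t) powr \<delta>" using \<delta> by (intro ge_one_powr_ge_zero) auto
    consider "t = 0" | "0 < t" "t \<le> 1" | "1 < t" "t < t0" | "t \<ge> t0" using t by linarith
    then show "\<Phi> t \<le> K * t powr r * (1 + log_plus t) powr \<delta>"
    proof cases
      case 1 then show ?thesis using young_0 by simp
    next
      case 2
      have "\<Phi> t \<le> C * t powr r * \<Phi> 1" using C(2)[of t 1] 2 by simp
      also have "\<dots> \<le> K * t powr r * 1" using K(2) mult_right_mono[of "C * \<Phi> 1" K "t powr r"] by (simp add: mult_ac)
      also have "\<dots> \<le> K * t powr r * (1 + log_plus t) powr \<delta>" using L K by (intro mult_left_mono) auto
      finally show ?thesis .
    next
      case 3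
      have "\<Phi> t \<le> \<Phi> t0" using 3 young_mono by simp
      also have "\<dots> \<le> K * 1 * 1" using K by simp
      also have "\<dots> \<le> K * t powr r * (1 + log_plus t) powr \<delta>"
        using 3 r K L by (intro mult_mono) (auto intro: ge_one_powr_ge_zero)
      finally show ?thesis .
    next
      case 4
      then have "\<Phi> t \<le> C0 * ln t powr \<delta> * t powr r" using C0(2) C0(3)[of t] by (simp add: divide_le_eq)
      also have "\<dots> \<le> K * (1 + log_plus t) powr \<delta> * t powr r"
        using 4 C0(2) K \<delta> by (intro mult_right_mono mult_mono powr_mono2) (auto simp: log_plus_def)
      finally show ?thesis by (simp add: mult_ac)
    qed
  qed
qed

text \<open>After submultiplicativity only L^\<delta>, with L = 1 + log^+ z, couples z to S =
  \<Phi>(s). If L is at most (1 + log^+ S)^(1/\<epsilon>), then L^\<delta> is at most the factor (1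
  + log^+ S)^(\<delta>/\<epsilon>) of \<eta>; this is the origin of that exponent. Otherwise S is at
  most exp(L^\<epsilon>), and S L^\<delta> is swallowed by an arbitrarily small power of z.\<close>

lemma young_product_bound:
  assumes \<epsilon>: "0 < \<epsilon>" "\<epsilon> < 1" and \<kappa>: "0 < \<kappa>"
  obtains A B where "A > 0" "B > 0" 
    "\<And>s z. 0 \<le> s \<Longrightarrow> 0 \<le> z \<Longrightarrow> \<Phi> (s * z) \<le> A * (z powr r * eta \<delta> \<epsilon> (\<Phi> s)) + B * (z powr r) powr (1 + \<kappa>)"
proof -
  obtain C where C: "C > 0" "\<And>t. 0 \<le> t \<Longrightarrow> \<Phi> t \<le> C * t powr r * (1 + log_plus t) powr \<delta>"
    using young_le_powr_log by metis
  obtain K where K: "K > 0" "\<And>L. 1 \<le> L \<Longrightarrow> exp (L powr \<epsilon>) * L powr \<delta> \<le> K * exp ((r * \<kappa>) * (L - 1))"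
    using exp_powr_bound[OF \<epsilon> \<delta>, of "r * \<kappa>"] r \<kappa> by auto
  show ?thesis
  proof (rule that[of C "C * K"])
    fix s z :: real assume sz: "0 \<le> s" "0 \<le> z"
    define S L where "S = \<Phi> s" and "L = 1 + log_plus z"
    have S: "0 \<le> S" using young_nonneg sz by (simp add: S_def)
    have L1: "L \<ge> 1" by (simp add: L_def)
    have "\<Phi> (s * z) \<le> S * (C * z powr r * L powr \<delta>)"
      unfolding S_def L_def using young_submult[OF sz] C(2)[OF sz(2)] young_nonneg[OF sz(1)] by (meson mult_left_mono order_trans)
    then have main: "\<Phi> (s * z) \<le> C * z powr r * (S * L powr \<delta>)" by (simp add: mult_ac)
    have "S * L powr \<delta> \<le> eta \<delta> \<epsilon> S \<or> (0 < z \<and> S * L powr \<delta> \<le> K * z powr (r * \<kappa>))"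
    proof (cases "L \<le> (1 + log_plus S) powr (1 / \<epsilon>)")
      case True
      then have "L powr \<delta> \<le> ((1 + log_plus S) powr (1 / \<epsilon>)) powr \<delta>" using L1 \<delta> by (intro powr_mono2) auto
      then show ?thesis using S by (auto simp: eta_def powr_powr intro!: mult_left_mono)
    next
      case False
      then have "((1 + log_plus S) powr (1 / \<epsilon>)) powr \<epsilon> \<le> L powr \<epsilon>" using \<epsilon> by (intro powr_mono2) auto
      then have SL: "1 + log_plus S \<le> L powr \<epsilon>" using \<epsilon> by (simp add: powr_powr add_nonneg_nonneg)
      \<comment> \<open>In this case L > 1, so \<open>log_plus z\<close> is the true logarithm of z;
        only then is the exponential of L - 1 a power of z.\<close>
      have "1 \<le> (1 + log_plus S) powr (1 / \<epsilon>)" using \<epsilon> by (intro ge_one_powr_ge_zero) auto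
      then have "log_plus z > 0" using False by (simp add: L_def)
      then have z: "z > 0" "log_plus z = ln z" using sz by (auto simp: log_plus_def split: if_splits)
      have "S \<le> exp (L powr \<epsilon>)" using le_exp_log_plus[OF S] SL by (smt (verit) exp_le_cancel_iff)
      then have "S * L powr \<delta> \<le> exp (L powr \<epsilon>) * L powr \<delta>" by (intro mult_right_mono) auto
      also have "\<dots> \<le> K * exp ((r * \<kappa>) * (L - 1))" by (rule K(2)[OF L1])
      also have "exp ((r * \<kappa>) * (L - 1)) = z powr (r * \<kappa>)" using z by (simp add: L_def powr_def)
      finally show ?thesis using z by simp
    qed
    then show "\<Phi> (s * z) \<le> C * (z powr r * eta \<delta> \<epsilon> (\<Phi> s)) + C * K * (z powr r) powr (1 + \<kappa>)"
    proof
      assume "S * L powr \<delta> \<le> eta \<delta> \<epsilon> S"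
      then have "C * z powr r * (S * L powr \<delta>) \<le> C * z powr r * eta \<delta> \<epsilon> S" using C by (intro mult_left_mono) auto
      moreover have "0 \<le> C * K * (z powr r) powr (1 + \<kappa>)" using C K by simp
      ultimately show ?thesis using main by (simp add: S_def mult.assoc)
    next
      assume a: "0 < z \<and> S * L powr \<delta> \<le> K * z powr (r * \<kappa>)"
      then have "C * z powr r * (S * L powr \<delta>) \<le> C * z powr r * (K * z powr (r * \<kappa>))" using C by (intro mult_left_mono) auto
      also have "\<dots> = C * K * (z powr r) powr (1 + \<kappa>)" using a by (simp add: powr_powr powr_add algebra_simps)
      finally have "C * z powr r * (S * L powr \<delta>) \<le> C * K * (z powr r) powr (1 + \<kappa>)" .
      moreover have "0 \<le> C * (z powr r * eta \<delta> \<epsilon> (\<Phi> s))" using C young_nonneg[OF sz(1)] by (simp add: eta_nonneg)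
      ultimately show ?thesis using main by simp
    qed
  qed (use C K in auto)
qed

text \<open>Monotonicity of \<Phi> is known on [0, \<infinity>) only, hence the detour through max
  0.\<close>

lemma young_measurable:
  assumes [measurable]: "g \<in> borel_measurable M" and "\<And>x. 0 \<le> g x"
  shows "(\<lambda>x. \<Phi> (g x)) \<in> borel_measurable M"
proof -
  have "mono (\<lambda>t. \<Phi> (max 0 t))" by (auto simp: mono_def intro!: young_mono)
  then have [measurable]: "(\<lambda>t. \<Phi> (max 0 t)) \<in> borel_measurable borel" by (rule borel_measurable_mono)
  have "(\<lambda>x. \<Phi> (max 0 (g x))) \<in> borel_measurable M" by measurable
  then show ?thesis using assms(2) by (simp add: max_def)
qed

end

section \<open>The stopping cubes\<close>

definition tavg :: "(real^'n \<Rightarrow> real) \<Rightarrow> 'n::finite dindex \<Rightarrow> real" where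
  "tavg w p = measure (wm w) (triple p) / (3 ^ CARD('n) * vol p)"

text \<open>The dyadic level of the average over the triple: the shift by 1 places the average in
  the interval from 2^tau (excluded) to 2^(tau+1) (included).\<close>

definition tau :: "(real^'n \<Rightarrow> real) \<Rightarrow> 'n::finite dindex \<Rightarrow> int" where
  "tau w p = \<lceil>log 2 (tavg w p)\<rceil> - 1"

lemma dyadic_between:
  fixes y :: real
  assumes "y > 0"
  shows "2 powi (\<lceil>log 2 y\<rceil> - 1) < y" "y \<le> 2 powi (\<lceil>log 2 y\<rceil> - 1 + 1)"
proof -
  have "real_of_int (\<lceil>log 2 y\<rceil> - 1) < log 2 y" "log 2 y \<le> real_of_int (\<lceil>log 2 y\<rceil> - 1 + 1)" by linarith+
  then have "2 powr real_of_int (\<lceil>log 2 y\<rceil> - 1) < 2 powr log 2 y" "2 powr log 2 y \<le> 2 powr real_of_int (\<lceil>log 2 y\<rceil> - 1 + 1)" 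
    by simp_all
  then show "2 powi (\<lceil>log 2 y\<rceil> - 1) < y" "y \<le> 2 powi (\<lceil>log 2 y\<rceil> - 1 + 1)"
    using assms powr_real_of_int'[of 2 "\<lceil>log 2 y\<rceil> - 1"] powr_real_of_int'[of 2 "\<lceil>log 2 y\<rceil> - 1 + 1"] by simp_all
qed

lemma emeasure_triple:
  fixes w :: "real^'n \<Rightarrow> real"
  assumes "weight w"
  shows "emeasure (wm w) (triple p) = ennreal (tavg w p * (3 ^ CARD('n) * vol p))" "tavg w p > 0"
proof -
  have fin: "emeasure (wm w) (triple p) < \<infinity>" using wm_dyadic_finite[OF assms] by simp
  then have eq: "emeasure (wm w) (triple p) = ennreal (measure (wm w) (triple p))"
    by (intro emeasure_eq_ennreal_measure) auto
  moreover have "vol p \<noteq> 0" using vol_pos[of p] by linarith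
  ultimately show "emeasure (wm w) (triple p) = ennreal (tavg w p * (3 ^ CARD('n) * vol p))"
    by (simp add: tavg_def)
  have "3 ^ CARD('n) * vol p > 0" by simp
  then have "emeasure lebesgue (triple p) \<noteq> 0" unfolding emeasure_dyadic by (metis ennreal_eq_0_iff not_le)
  then have "emeasure (wm w) (triple p) > 0" by (intro wm_pos[OF assms]) auto
  then show "tavg w p > 0" using eq vol_pos[of p] by (auto simp: tavg_def)
qed

lemma tau:
  assumes "weight w"
  shows "2 powi (tau w p) < tavg w p" "tavg w p \<le> 2 powi (tau w p + 1)"
  using dyadic_between[OF emeasure_triple(2)[OF assms, of p]] unfolding tau_def by auto

lemma emeasure_triple_sum:
  assumes "A \<in> sets lebesgue" "A \<subseteq> triple p"
  shows "emeasure (wm w) A = (\<Sum>b\<in>{b. \<forall>i. \<bar>b $ i - snd p $ i\<bar> \<le> 1}. emeasure (wm w) (A \<inter> dcube (fst p, b)))"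
proof -
  let ?I = "{b. \<forall>i. \<bar>b $ i - snd p $ i\<bar> \<le> 1}"
  have "disjoint_family_on (\<lambda>b. A \<inter> dcube (fst p, b)) ?I"
    unfolding disjoint_family_on_def using dcube_disjoint by fastforce
  then have "(\<Sum>b\<in>?I. emeasure (wm w) (A \<inter> dcube (fst p, b))) = emeasure (wm w) (\<Union>b\<in>?I. A \<inter> dcube (fst p, b))"
    using assms card_neighbours(2) by (intro sum_emeasure) auto
  also have "(\<Union>b\<in>?I. A \<inter> dcube (fst p, b)) = A" using assms(2) triple_eq_Union[of p] by auto
  finally show ?thesis by simp
qed

text \<open>The number \<open>x\<close> is relative to the volume of \<open>p\<close>, not of the
  triple, so all neighbours of \<open>p\<close> meet the hypothesis of \<open>decays\<close> with
  the same \<open>x\<close>.\<close>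

lemma decays_triple:
  fixes w :: "real^'n \<Rightarrow> real"
  assumes "decays C \<gamma> w" "E \<in> sets lebesgue" "E \<subseteq> triple p" "0 \<le> x" "emeasure lebesgue E \<le> ennreal (x * vol p)"
  shows "emeasure (wm w) E \<le> ennreal (C * x powr \<gamma>) * emeasure (wm w) (triple p)"
proof -
  let ?I = "{b. \<forall>i. \<bar>b $ i - snd p $ i\<bar> \<le> 1}"
  have "emeasure (wm w) E = (\<Sum>b\<in>?I. emeasure (wm w) (E \<inter> dcube (fst p, b)))"
    by (rule emeasure_triple_sum[OF assms(2,3)])
  also have "\<dots> \<le> (\<Sum>b\<in>?I. ennreal (C * x powr \<gamma>) * emeasure (wm w) (dcube (fst p, b)))"
  proof (rule sum_mono)
    fix b :: "int^'n"
    have "vol (fst p, b) = vol p" by (simp add: vol_def)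
    moreover have "emeasure lebesgue (E \<inter> dcube (fst p, b)) \<le> emeasure lebesgue E"
      using assms(2) by (intro emeasure_mono) auto
    ultimately have "emeasure lebesgue (E \<inter> dcube (fst p, b)) \<le> ennreal (x * vol (fst p, b))"
      using assms(5) by simp
    moreover have "E \<inter> dcube (fst p, b) \<in> sets lebesgue" using assms(2) by (intro sets.Int) auto
    ultimately show "emeasure (wm w) (E \<inter> dcube (fst p, b)) \<le> ennreal (C * x powr \<gamma>) * emeasure (wm w) (dcube (fst p, b))"
      using assms(1,4) unfolding decays_def by blast
  qed
  also have "\<dots> = ennreal (C * x powr \<gamma>) * (\<Sum>b\<in>?I. emeasure (wm w) (triple p \<inter> dcube (fst p, b)))"
  proof -
    have "triple p \<inter> dcube (fst p, b) = dcube (fst p, b)" if "b \<in> ?I" for b using that triple_eq_Union[of p] by blast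
    then show ?thesis by (simp add: sum_distrib_left)
  qed
  also have "(\<Sum>b\<in>?I. emeasure (wm w) (triple p \<inter> dcube (fst p, b))) = emeasure (wm w) (triple p)"
    by (rule emeasure_triple_sum[symmetric]) auto
  finally show ?thesis .
qed

text \<open>A geometric series descending from the largest i with 2^i \<le> X. It later converts the
  binning by averages of u back into u.\<close>

lemma sum_dyadic_le:
  fixes X :: real
  assumes "X > 0"
  shows "(\<integral>\<^sup>+i. ennreal (2 powi i) * indicator {i. 2 powi i \<le> X} i \<partial>count_space (UNIV :: int set)) \<le> ennreal (2 * X)"
proof -
  define i0 where "i0 = \<lfloor>log 2 X\<rfloor>"
  have "(2 powi i \<le> X) = (i \<le> i0)" for i :: int
  proof -
    have "(2 powi i \<le> X) = (2 powr real_of_int i \<le> 2 powr log 2 X)" using assms by (simp add: powr_real_of_int')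
    also have "\<dots> = (i \<le> i0)" by (simp add: i0_def le_floor_iff)
    finally show ?thesis .
  qed
  then have "{i. 2 powi i \<le> X} = {..i0}" "2 powi i0 \<le> X" by auto
  have bij: "bij_betw (\<lambda>l. i0 - int l) UNIV {..i0}"
    by (rule bij_betw_byWitness[where f' = "\<lambda>i. nat (i0 - i)"]) auto
  have "(\<integral>\<^sup>+i. ennreal (2 powi i) * indicator {i. 2 powi i \<le> X} i \<partial>count_space UNIV) = (\<integral>\<^sup>+i. ennreal (2 powi i) \<partial>count_space {..i0})"
    unfolding \<open>{i. 2 powi i \<le> X} = {..i0}\<close> by (rule nn_integral_count_space_indicator[symmetric]) simp
  also have "\<dots> = (\<integral>\<^sup>+l. ennreal (2 powi (i0 - int l)) \<partial>count_space UNIV)"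
    by (rule nn_integral_bij_count_space[OF bij, symmetric])
  also have "\<dots> = (\<integral>\<^sup>+l. ennreal (2 powi i0 * (1/2) ^ l) \<partial>count_space UNIV)"
    by (simp add: power_int_diff power_divide)
  also have "\<dots> = ennreal (2 powi i0 / (1 - 1/2))" by (rule nn_integral_geometric) auto
  also have "\<dots> \<le> ennreal (2 * X)" using \<open>2 powi i0 \<le> X\<close> by (intro ennreal_leI) simp
  finally show ?thesis .
qed

text \<open>The cut s = c 2^(-m/2) lies, on a logarithmic scale, halfway between the truncation
  height c and the size of the average of \<open>w\<close>. Below it uw \<le> s u. Above it the set
  has relative volume O(2^(-m/2)) by Chebyshev's inequality, and the decay of u there compensates
  the cruder bound uw \<le> c u.\<close>

lemma truncated_mass:
  fixes u w :: "real^'n \<Rightarrow> real"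
  assumes u: "weight u" and w: "weight w" and dec: "decays C \<gamma> u" and C: "C > 0" "0 < \<gamma>" "\<gamma> \<le> 1"
  shows "(\<integral>\<^sup>+x\<in>triple p \<inter> {x. w x \<le> 2 powi (tau w p + int m + 1)}. ennreal (u x * w x) \<partial>lebesgue)
    \<le> ennreal (4 * 3 ^ CARD('n) * (1 + C * (3 ^ CARD('n)) powr \<gamma>) * (2 powr (- \<gamma> / 2)) ^ m * (2 powi (tau w p + int m) * 2 powi tau u p * vol p))"
proof -
  define \<rho> :: real where "\<rho> = 2 powr (- 1/2)"
  have "\<rho> * \<rho> = 2 powr (-1)" unfolding \<rho>_def by (subst powr_add[symmetric]) simp
  then have \<rho>: "0 < \<rho>" "\<rho> * \<rho> = 1/2" by (simp_all add: \<rho>_def powr_minus)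
  define D :: real where "D = 3 ^ CARD('n)"
  have D: "D > 0" by (simp add: D_def)
  define c where "c = (2::real) powi (tau w p + int m + 1)"
  have c: "c > 0" by (simp add: c_def)
  define s where "s = c * \<rho> ^ m"
  have s: "s > 0" using c \<rho> by (simp add: s_def)
  have [measurable]: "u \<in> borel_measurable lebesgue" "w \<in> borel_measurable lebesgue" using u w weight_measurable by auto
  have u0: "0 \<le> u x" and w0: "0 \<le> w x" for x using u w by (auto simp: weight_def)
  define E where "E = triple p \<inter> {x \<in> space lebesgue. s < w x}"
  have "{x \<in> space lebesgue. s < w x} \<in> sets lebesgue" by measurable
  then have E: "E \<in> sets lebesgue" "E \<subseteq> triple p" unfolding E_def by (auto intro: sets.Int triple_lebesgue)
  have cm: "c * (\<rho> ^ m * \<rho> ^ m) = 2 powi (tau w p + 1)"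
    by (simp add: c_def \<rho> power_int_add power_divide flip: power_mult_distrib)
  have "ennreal s * emeasure lebesgue E \<le> emeasure (wm w) E"
    by (rule wm_ge[OF w E(1)]) (auto simp: E_def)
  also have "\<dots> \<le> emeasure (wm w) (triple p)" using E by (intro emeasure_mono) auto
  also have "\<dots> \<le> ennreal (2 powi (tau w p + 1) * (D * vol p))"
    unfolding emeasure_triple(1)[OF w] D_def using tau(2)[OF w, of p] by (intro ennreal_leI mult_right_mono) (auto simp: less_imp_le)
  also have "\<dots> = ennreal s * ennreal (\<rho> ^ m * D * vol p)"
    unfolding cm[symmetric] s_def using c \<rho> D by (subst ennreal_mult[symmetric]) (auto simp: mult_ac less_imp_le)
  finally have "emeasure lebesgue E \<le> ennreal (\<rho> ^ m * D * vol p)"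
    using s by (simp add: ennreal_mult_le_mult_iff)
  then have UE: "emeasure (wm u) E \<le> ennreal (C * (\<rho> ^ m * D) powr \<gamma>) * emeasure (wm u) (triple p)"
    using \<rho> D E by (intro decays_triple[OF dec]) auto
  define q where "q = (2 powr (- \<gamma> / 2)) ^ m"
  have "\<rho> ^ m = \<rho> powr real m" "q = (2 powr (- \<gamma> / 2)) powr real m"
    using \<rho> by (simp_all add: q_def powr_realpow)
  then have rq: "(\<rho> ^ m) powr \<gamma> = q" 
    by (simp add: \<rho>_def powr_powr mult_ac)
  \<comment> \<open>Here \<gamma> \<le> 1 brings the low part, which decays like \<rho>^m, under the
    slower rate of the high part.\<close>
  have "\<rho> ^ m \<le> q"
    unfolding q_def \<rho>_def using C by (intro power_mono) auto
  have uw: "ennreal (u x * w x) \<le> ennreal t * ennreal (u x)" if "w x \<le> t" "t > 0" for t x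
    using mult_left_mono[OF that(1) u0[of x]] that(2) u0[of x]
    by (simp add: mult.commute ennreal_leI flip: ennreal_mult)
  have "(\<integral>\<^sup>+x\<in>triple p \<inter> {x. w x \<le> c}. ennreal (u x * w x) \<partial>lebesgue)
      \<le> (\<integral>\<^sup>+x. ennreal s * (ennreal (u x) * indicator (triple p) x) + ennreal c * (ennreal (u x) * indicator E x) \<partial>lebesgue)"
  proof (intro nn_integral_mono)
    fix x
    show "ennreal (u x * w x) * indicator (triple p \<inter> {x. w x \<le> c}) x \<le> 
      ennreal s * (ennreal (u x) * indicator (triple p) x) + ennreal c * (ennreal (u x) * indicator E x)"
    proof (cases "x \<in> triple p \<and> w x \<le> c")
      case True
      show ?thesis
      proof (cases "w x \<le> s")
        case ws: True
        have "ennreal (u x * w x) \<le> ennreal s * ennreal (u x)"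
          using uw[OF ws s] .
        then show ?thesis using True by (simp add: add_increasing2)
      next
        case False
        have "ennreal (u x * w x) \<le> ennreal c * ennreal (u x)"
          using uw[OF _ c] True by blast
        then show ?thesis using True False by (simp add: E_def add_increasing)
      qed
    qed (auto simp: indicator_def)
  qed
  also have "\<dots> = ennreal s * emeasure (wm u) (triple p) + ennreal c * emeasure (wm u) E"
    using E(1) by (subst nn_integral_add) (simp_all add: nn_integral_cmult emeasure_wm[OF u])
  also have "\<dots> \<le> ennreal (c * q) * emeasure (wm u) (triple p) + ennreal c * (ennreal (C * (\<rho> ^ m * D) powr \<gamma>) * emeasure (wm u) (triple p))"
    using UE \<open>\<rho> ^ m \<le> q\<close> c by (intro add_mono mult_mono mult_left_mono) (auto simp: s_def intro!: ennreal_leI)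
  also have "\<dots> = ennreal (c * q * (1 + C * D powr \<gamma>)) * emeasure (wm u) (triple p)"
  proof -
    have "(\<rho> ^ m * D) powr \<gamma> = q * D powr \<gamma>" using \<rho> D by (simp add: powr_mult rq)
    then have "ennreal c * (ennreal (C * (\<rho> ^ m * D) powr \<gamma>) * emeasure (wm u) (triple p)) = ennreal (c * (C * (q * D powr \<gamma>))) * emeasure (wm u) (triple p)"
      using c C by (simp add: ennreal_mult' mult.assoc q_def)
    moreover have "ennreal (c * q) + ennreal (c * (C * (q * D powr \<gamma>))) = ennreal (c * q * (1 + C * D powr \<gamma>))"
      using c C by (subst ennreal_plus[symmetric]) (auto simp: q_def algebra_simps)
    ultimately show ?thesis by (simp flip: distrib_right)
  qed
  also have "\<dots> \<le> ennreal (c * q * (1 + C * D powr \<gamma>)) * ennreal (2 powi (tau u p + 1) * (D * vol p))"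
    unfolding emeasure_triple(1)[OF u] D_def using tau(2)[OF u, of p] by (intro mult_left_mono ennreal_leI mult_right_mono) (auto simp: less_imp_le)
  also have "\<dots> = ennreal ((c * q * (1 + C * D powr \<gamma>)) * (2 powi (tau u p + 1) * (D * vol p)))"
    using D C c by (intro ennreal_mult[symmetric]) (auto simp: less_imp_le q_def intro!: mult_nonneg_nonneg add_nonneg_nonneg)
  \<comment> \<open>Of the factor 4, one 2 is the extra doubling contained in \<open>c\<close> and
    the other comes from bounding the average of u by 2^(tau+1).\<close>
  also have "(c * q * (1 + C * D powr \<gamma>)) * (2 powi (tau u p + 1) * (D * vol p)) =
     4 * D * (1 + C * D powr \<gamma>) * q * (2 powi (tau w p + int m) * 2 powi tau u p * vol p)"
    by (simp add: c_def power_int_add)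
  finally show ?thesis by (simp only: c_def D_def q_def)
qed

section \<open>Stopping cubes, their selection and their covering property\<close>

definition stop :: "(real \<Rightarrow> real^'n \<Rightarrow> ennreal) \<Rightarrow> real \<Rightarrow> int \<Rightarrow> int \<Rightarrow> 'n::finite dindex set" where
  "stop b L N j = {p. fst p \<le> N \<and>
     ennreal ((1/6) ^ CARD('n) * vol p) < (\<integral>\<^sup>+x\<in>dcube p. b (L * 2 powi j) x \<partial>lebesgue)}"

text \<open>The stopping level is computed from the cube itself; m records how far the level at the
  covered points lies above the average of \<open>w\<close> over the triple.\<close>

definition selected where
  "selected u w b L N m i = {p. p \<in> dmaximal (stop b L N (tau w p + int m)) \<and> tau u p = i}"

text \<open>With j = \<open>tau w p\<close> + m, all averages of \<open>w\<close> at a covered point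
  are bounded by a number of at most 2^(j+1), and so is \<open>w\<close> there, up to a null set.
  Only this part of the triple has to be measured.\<close>

definition piece :: "(real^'n \<Rightarrow> real) \<Rightarrow> nat \<Rightarrow> 'n::finite dindex \<Rightarrow> (real^'n) set" where
  "piece w m p = triple p \<inter> {x. w x \<le> 2 powi (tau w p + int m + 1)}"

lemma piece_sets:
  assumes "weight w" shows "piece w m p \<in> sets lebesgue"
proof -
  have [measurable]: "w \<in> borel_measurable lebesgue" using weight_measurable[OF assms] .
  have "{x \<in> space lebesgue. w x \<le> 2 powi (tau w p + int m + 1)} \<in> sets lebesgue" by measurable
  then show ?thesis unfolding piece_def by (intro sets.Int) auto
qed

lemma stop_antimono:
  assumes "\<And>l l' y. 0 < l \<Longrightarrow> l \<le> l' \<Longrightarrow> b l' y \<le> b l y" "L > 0" "i \<le> j"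
  shows "stop b L N j \<subseteq> stop b L N i"
proof -
  have "L * 2 powi i \<le> L * 2 powi j" using assms by (intro mult_left_mono power_int_increasing) auto
  then have "b (L * 2 powi j) x \<le> b (L * 2 powi i) x" for x using assms by auto
  then have "(\<integral>\<^sup>+x\<in>dcube p. b (L * 2 powi j) x \<partial>lebesgue) \<le> (\<integral>\<^sup>+x\<in>dcube p. b (L * 2 powi i) x \<partial>lebesgue)" for p
    by (intro nn_integral_mono mult_right_mono) auto
  then show ?thesis unfolding stop_def by (auto intro: less_le_trans)
qed

lemma stop_fst: "p \<in> stop b L N j \<Longrightarrow> fst p \<le> N"
  by (simp add: stop_def)

text \<open>Let 2^j < m \<le> 2^(j+1). Since 3^n 6^(-n) 2^(kn) is at most the volume of
  \<open>Q\<close>, one of the 3^n dyadic cubes covering \<open>Q\<close> exceeds the threshold and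
  stops at level j. The maximal cube above it still has \<open>x\<close> in its triple, whose
  average of \<open>w\<close> is at most m, so its \<open>tau w\<close> is j - n for some n \<ge> 0.
  The generation k is found before the bound N, as Fatou's lemma will require.\<close>

lemma selected_covers:
  fixes w :: "real^'n \<Rightarrow> real"
  assumes w: "weight w" 
    and anti: "\<And>l l' y. 0 < l \<Longrightarrow> l \<le> l' \<Longrightarrow> b l' y \<le> b l y" 
    and meas: "\<And>l. 0 < l \<Longrightarrow> b l \<in> borel_measurable lebesgue" and L: "L > 0"
    and m: "m > 0" "\<And>Q. cube Q \<Longrightarrow> x \<in> Q \<Longrightarrow> emeasure (wm w) Q \<le> ennreal m * emeasure lebesgue Q"
    and Q: "cube Q" "x \<in> Q" "emeasure lebesgue Q < (\<integral>\<^sup>+y\<in>Q. b (L * m) y \<partial>lebesgue)"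
    and le: "w x \<le> m"
  obtains k where "\<And>N. k \<le> N \<Longrightarrow> \<exists>n i. \<exists>p\<in>selected u w b L N n i. x \<in> piece w n p"
proof -
  obtain k where k: "Q \<subseteq> triple (k, cell k x)" "emeasure lebesgue Q \<ge> ennreal ((2 powi k / 2) ^ CARD('n))"
    using cube_subset_triples[OF Q(1,2)] by metis
  define j where "j = \<lceil>log 2 m\<rceil> - 1"
  have j: "2 powi j < m" "m \<le> 2 powi (j + 1)" unfolding j_def using dyadic_between[OF m(1)] by auto
  let ?I = "{c :: int^'n. \<forall>i. \<bar>c $ i - cell k x $ i\<bar> \<le> 1}"
  have [measurable]: "b (L * m) \<in> borel_measurable lebesgue" using meas L m by auto
  have "\<exists>c\<in>?I. ennreal ((1/6) ^ CARD('n) * vol (k, c)) < (\<integral>\<^sup>+y\<in>dcube (k, c). b (L * m) y \<partial>lebesgue)"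
  proof (rule ccontr)
    assume "\<not> ?thesis"
    then have small: "(\<integral>\<^sup>+y\<in>dcube (k, c). b (L * m) y \<partial>lebesgue) \<le> ennreal ((1/6) ^ CARD('n) * vol (k, c))" if "c \<in> ?I" for c
      using that by (meson not_le)
    have "(\<integral>\<^sup>+y\<in>Q. b (L * m) y \<partial>lebesgue) \<le> (\<integral>\<^sup>+y. (\<Sum>c\<in>?I. b (L * m) y * indicator (dcube (k, c)) y) \<partial>lebesgue)"
    proof (intro nn_integral_mono)
      fix y
      show "b (L * m) y * indicator Q y \<le> (\<Sum>c\<in>?I. b (L * m) y * indicator (dcube (k, c)) y)"
      proof (cases "y \<in> Q")
        case True
        then obtain c where "c \<in> ?I" "y \<in> dcube (k, c)" using k(1) triple_eq_Union[of "(k, cell k x)"] by auto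
        then have "b (L * m) y * indicator Q y \<le> b (L * m) y * indicator (dcube (k, c)) y"
            by (auto simp: indicator_def)
        also have "\<dots> \<le> (\<Sum>c\<in>?I. b (L * m) y * indicator (dcube (k, c)) y)"
          using card_neighbours(2)[of "cell k x"] \<open>c \<in> ?I\<close> by (intro member_le_sum) auto
        finally show ?thesis .
      qed simp
    qed
    also have "\<dots> = (\<Sum>c\<in>?I. (\<integral>\<^sup>+y\<in>dcube (k, c). b (L * m) y \<partial>lebesgue))"
      by (intro nn_integral_sum) auto
    also have "\<dots> \<le> (\<Sum>c\<in>?I. ennreal ((1/6) ^ CARD('n) * (2 powi k) ^ CARD('n)))"
      using small by (intro sum_mono) (auto simp: vol_def)
    also have "\<dots> = ennreal (3 ^ CARD('n)) * ennreal ((1/6) ^ CARD('n) * (2 powi k) ^ CARD('n))"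
    proof -
      have "(3::ennreal) ^ CARD('n) = ennreal (3 ^ CARD('n))" by (metis ennreal_numeral ennreal_power zero_le_numeral)
      then show ?thesis using card_neighbours(1)[of "cell k x"] by simp
    qed
    also have "\<dots> = ennreal (3 ^ CARD('n) * ((1/6) ^ CARD('n) * (2 powi k) ^ CARD('n)))"
      by (rule ennreal_mult[symmetric]) auto
    also have "3 ^ CARD('n) * ((1/6) ^ CARD('n) * (2 powi k) ^ CARD('n)) = ((2 powi k / 2) :: real) ^ CARD('n)"
      by (simp flip: power_mult_distrib)
    also have "ennreal \<dots> \<le> emeasure lebesgue Q" by (rule k(2))
    finally show False using Q(3) by simp
  qed
  then obtain c where c: "c \<in> ?I" "ennreal ((1/6) ^ CARD('n) * vol (k, c)) < (\<integral>\<^sup>+y\<in>dcube (k, c). b (L * m) y \<partial>lebesgue)" by auto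
  have xc: "x \<in> triple (k, c)" using c(1) by (auto simp: triple_def abs_minus_commute)
  have "L * 2 powi j \<le> L * m" using j L by (intro mult_left_mono) auto
  then have "b (L * m) y \<le> b (L * 2 powi j) y" for y using anti L by simp
  then have "(\<integral>\<^sup>+y\<in>dcube (k, c). b (L * m) y \<partial>lebesgue) \<le> (\<integral>\<^sup>+y\<in>dcube (k, c). b (L * 2 powi j) y \<partial>lebesgue)"
    by (intro nn_integral_mono mult_right_mono) auto
  then have st: "(k, c) \<in> stop b L N j" if "k \<le> N" for N
    using that c(2) by (auto simp: stop_def intro: less_le_trans)
  show ?thesis
  proof (rule that[of k])
    fix N assume "k \<le> N"
    obtain p where p: "p \<in> dmaximal (stop b L N j)" "triple (k, c) \<subseteq> triple p"
      by (rule ex_dmaximal[OF st[OF \<open>k \<le> N\<close>] stop_fst])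
    have xp: "x \<in> triple p" using xc p by auto
    have "x \<in> ctriple p" using xp subset_closure_dyadic(2)[of p] by auto
    then have ct: "emeasure (wm w) (ctriple p) \<le> ennreal m * emeasure lebesgue (ctriple p)" using m(2) cube_closure_dyadic(2)[of p] by auto
    have "emeasure (wm w) (triple p) \<le> emeasure (wm w) (ctriple p)"
      using subset_closure_dyadic(2)[of p] cube_lebesgue(1)[OF cube_closure_dyadic(2)[of p]] by (intro emeasure_mono) auto
    also note ct
    also have "ennreal m * emeasure lebesgue (ctriple p) = ennreal (m * (3 ^ CARD('n) * vol p))"
      using m(1) by (simp add: emeasure_dyadic ennreal_mult less_imp_le)
    finally have "tavg w p * (3 ^ CARD('n) * vol p) \<le> m * (3 ^ CARD('n) * vol p)"
      unfolding emeasure_triple(1)[OF w] using m(1) by (subst (asm) ennreal_le_iff) (auto simp: less_imp_le)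
    moreover have "3 ^ CARD('n) * vol p > 0" by simp
    ultimately have "tavg w p \<le> m" by (metis mult_le_cancel_right_pos)
    then have "2 powi (tau w p) < (2::real) powi (j + 1)" using tau(1)[OF w, of p] j(2) by simp
    then have "tau w p \<le> j" using power_int_increasing[of "j + 1" "tau w p" "2::real"] by (meson leD le_less_linear zless_add1_eq less_le_not_le one_le_numeral linorder_not_less zle_add1_eq_le)
    then have jj: "tau w p + int (nat (j - tau w p)) = j" by simp
    have "p \<in> selected u w b L N (nat (j - tau w p)) (tau u p)" 
      unfolding selected_def mem_Collect_eq jj using p(1) by blast
    moreover have "x \<in> piece w (nat (j - tau w p)) p" 
      unfolding piece_def jj using xp le j(2) by auto
    ultimately show "\<exists>n i. \<exists>p\<in>selected u w b L N n i. x \<in> piece w n p" by blast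
  qed
qed

text \<open>Once \<open>tau w\<close> is fixed, all these cubes are maximal in one and the same
  family.\<close>

lemma selected_disjoint:
  "disjoint_family_on dcube {p \<in> selected u w b L N m i. tau w p = l}"
  by (rule disjoint_family_on_mono[OF _ disjoint_dmaximal[of "stop b L N (l + int m)"]]) (auto simp: selected_def)

lemma selected_fst: "p \<in> selected u w b L N m i \<Longrightarrow> fst p \<le> N"
  using dmaximal_subset by (fastforce simp: selected_def stop_def)

text \<open>If the larger cube \<open>q\<close> had the higher level, it would also stop at the
  lower level of \<open>p\<close>, because \<open>b\<close> decreases in its first argument, and
  \<open>p\<close> would not be maximal there.\<close>

lemma selected_nested:
  assumes "\<And>l l' y. 0 < l \<Longrightarrow> l \<le> l' \<Longrightarrow> b l' y \<le> b l y" "L > 0"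
    and p: "p \<in> selected u w b L N m i" and q: "q \<in> selected u w b L N m i" and sub: "dcube p \<subseteq> dcube q"
  shows "tau w q \<le> tau w p"
proof (rule ccontr)
  assume "\<not> tau w q \<le> tau w p"
  then have "q \<in> stop b L N (tau w p + int m)"
  proof -
    have "stop b L N (tau w q + int m) \<subseteq> stop b L N (tau w p + int m)"
      using \<open>\<not> tau w q \<le> tau w p\<close> by (intro stop_antimono assms) auto
    then show ?thesis using q dmaximal_subset by (auto simp: selected_def)
  qed
  then have "q = p" using p sub by (auto simp: selected_def dmaximal_def)
  then show False using \<open>\<not> tau w q \<le> tau w p\<close> by simp
qed

text \<open>Since \<open>p\<close> lies in its triple and \<open>tau w p \<le> j\<close>, the mean
  of \<open>w\<close> over \<open>p\<close> is at most l = 2 3^n 2^j. The function \<open>b\<close>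
  is taken at L 2^j = M l, so its error term gains a factor 1/M over the reverse Hoelder bound at l.
  For large M it accounts for at most half of the threshold 6^(-n); the other half must come from
  the term with \<open>G\<close>.\<close>

lemma stop_mass:
  fixes w :: "real^'n \<Rightarrow> real" and b :: "real \<Rightarrow> real^'n \<Rightarrow> ennreal"
  assumes w: "weight w" and pos: "A > 0" "B > 0" "C > 0" "\<kappa> > 0"
    and rh: "\<And>p l. l > 0 \<Longrightarrow> emeasure (wm w) (dcube p) \<le> ennreal (l * vol p) \<Longrightarrow>
      (\<integral>\<^sup>+x\<in>dcube p. ennreal ((w x / l) powr (1 + \<kappa>)) \<partial>lebesgue) \<le> ennreal (C * vol p)"
    and G: "G \<in> borel_measurable lebesgue"
    and bnd: "\<And>l y. l > 0 \<Longrightarrow> b l y \<le> ennreal A * (ennreal (w y / l) * G y) + ennreal (B * (w y / l) powr (1 + \<kappa>))"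
    and M: "M \<ge> 1" "B * C / M \<le> (1/6) ^ CARD('n) / 2" and L: "L = 2 * 3 ^ CARD('n) * M"
    and p: "p \<in> stop b L N j" "tau w p \<le> j"
  shows "ennreal (2 powi j * vol p) \<le> ennreal (2 * A / ((1/6) ^ CARD('n) * L)) * (\<integral>\<^sup>+x\<in>dcube p. G x * ennreal (w x) \<partial>lebesgue)"
proof -
  define \<theta> :: real where "\<theta> = (1/6) ^ CARD('n)"
  define t :: real where "t = 2 powi j"
  define l where "l = 2 * 3 ^ CARD('n) * t"
  have pos2: "\<theta> > 0" "t > 0" "l > 0" "L > 0" using M by (auto simp: \<theta>_def t_def l_def L)
  have Lt: "L * t = M * l" by (simp add: L l_def)
  have [measurable]: "w \<in> borel_measurable lebesgue" "G \<in> borel_measurable lebesgue" using w G weight_measurable by auto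
  have w0: "0 \<le> w x" for x using w by (simp add: weight_def)
  let ?I = "\<integral>\<^sup>+x\<in>dcube p. G x * ennreal (w x) \<partial>lebesgue"
  have "emeasure (wm w) (dcube p) \<le> emeasure (wm w) (triple p)"
    using dcube_subset_triple[of p] by (intro emeasure_mono) auto
  also have "\<dots> \<le> ennreal (l * vol p)"
  proof -
    have "tavg w p \<le> 2 powi (tau w p + 1)" by (rule tau(2)[OF w])
    also have "\<dots> \<le> (2::real) powi (j + 1)" using p(2) by (intro power_int_increasing) auto
    also have "\<dots> = 2 * t" by (simp add: t_def power_int_add)
    finally have "tavg w p * (3 ^ CARD('n) * vol p) \<le> 2 * t * (3 ^ CARD('n) * vol p)"
      by (intro mult_right_mono) (auto simp: less_imp_le)
    then show ?thesis unfolding emeasure_triple(1)[OF w] l_def by (intro ennreal_leI) (simp add: mult_ac)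
  qed
  finally have rhl: "(\<integral>\<^sup>+x\<in>dcube p. ennreal ((w x / l) powr (1 + \<kappa>)) \<partial>lebesgue) \<le> ennreal (C * vol p)"
    using pos2 by (intro rh) auto
  have bp: "b (L * t) y \<le> ennreal (A / (L * t)) * (G y * ennreal (w y)) + ennreal (B / M) * ennreal ((w y / l) powr (1 + \<kappa>))" for y
  proof -
    have "ennreal A * (ennreal (w y / (L * t)) * G y) = ennreal (A / (L * t)) * (G y * ennreal (w y))"
    proof -
      have "ennreal A * ennreal (w y / (L * t)) = ennreal (A / (L * t)) * ennreal (w y)"
        using pos pos2 w0[of y] by (simp flip: ennreal_mult)
      then show ?thesis by (simp add: mult.assoc[symmetric]) (simp add: mult_ac)
    qed
    moreover have "B * (w y / (L * t)) powr (1 + \<kappa>) \<le> B / M * (w y / l) powr (1 + \<kappa>)"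
    proof -
      have "(1 / M) powr (1 + \<kappa>) = (1 / M) * (1 / M) powr \<kappa>" using M by (simp add: powr_add)
      also have "\<dots> \<le> (1 / M) * 1" using M pos by (intro mult_left_mono powr_le1) auto
      finally have "(w y / l) powr (1 + \<kappa>) * (1 / M) powr (1 + \<kappa>) \<le> (w y / l) powr (1 + \<kappa>) * (1 / M)"
        by (intro mult_left_mono) auto
      moreover have "(w y / (L * t)) powr (1 + \<kappa>) = (w y / l) powr (1 + \<kappa>) * (1 / M) powr (1 + \<kappa>)"
        unfolding Lt using w0[of y] pos2 M by (simp flip: powr_mult) (simp add: mult.commute)
      ultimately have "B * (w y / (L * t)) powr (1 + \<kappa>) \<le> B * ((w y / l) powr (1 + \<kappa>) * (1 / M))"
        using pos by (intro mult_left_mono) auto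
      then show ?thesis by simp
    qed
    ultimately show ?thesis
      using bnd[of "L * t" y] pos pos2 M 
      by (intro order_trans[OF bnd] add_mono) (auto intro!: ennreal_leI simp flip: ennreal_mult)
  qed
  have "ennreal (\<theta> * vol p) \<le> (\<integral>\<^sup>+x\<in>dcube p. b (L * t) x \<partial>lebesgue)"
    using p(1) by (auto simp: stop_def \<theta>_def t_def)
  also have "\<dots> \<le> (\<integral>\<^sup>+x. ennreal (A / (L * t)) * (G x * ennreal (w x) * indicator (dcube p) x) + 
      ennreal (B / M) * (ennreal ((w x / l) powr (1 + \<kappa>)) * indicator (dcube p) x) \<partial>lebesgue)"
    using bp by (intro nn_integral_mono) (auto split: split_indicator)
  also have "\<dots> = ennreal (A / (L * t)) * ?I + ennreal (B / M) * (\<integral>\<^sup>+x\<in>dcube p. ennreal ((w x / l) powr (1 + \<kappa>)) \<partial>lebesgue)"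
    by (subst nn_integral_add) (auto simp: nn_integral_cmult)
  also have "\<dots> \<le> ennreal (A / (L * t)) * ?I + ennreal (\<theta> / 2 * vol p)"
  proof (intro add_left_mono)
    have "ennreal (B / M) * (\<integral>\<^sup>+x\<in>dcube p. ennreal ((w x / l) powr (1 + \<kappa>)) \<partial>lebesgue) \<le> ennreal (B / M) * ennreal (C * vol p)"
      by (intro mult_left_mono rhl) simp
    also have "\<dots> = ennreal (B * C / M * vol p)" using pos M by (subst ennreal_mult[symmetric]) (auto simp: less_imp_le)
    also have "\<dots> \<le> ennreal (\<theta> / 2 * vol p)" using M(2) unfolding \<theta>_def by (intro ennreal_leI mult_right_mono) (auto simp: less_imp_le)
    finally show "ennreal (B / M) * (\<integral>\<^sup>+x\<in>dcube p. ennreal ((w x / l) powr (1 + \<kappa>)) \<partial>lebesgue) \<le> ennreal (\<theta> / 2 * vol p)" .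
  qed
  also have "ennreal (\<theta> * vol p) = ennreal (\<theta> / 2 * vol p) + ennreal (\<theta> / 2 * vol p)"
    using pos2 by (subst ennreal_plus[symmetric]) (auto simp: less_imp_le)
  finally have "ennreal (\<theta> / 2 * vol p) \<le> ennreal (A / (L * t)) * ?I"
    by (subst (asm) (2) add.commute) (simp add: ennreal_add_left_cancel_le)
  then have "ennreal (2 * t / \<theta>) * ennreal (\<theta> / 2 * vol p) \<le> ennreal (2 * t / \<theta>) * (ennreal (A / (L * t)) * ?I)"
    by (intro mult_left_mono) auto
  also have "\<dots> = ennreal (2 * A / (\<theta> * L)) * ?I"
    unfolding mult.assoc[symmetric] using pos pos2 by (subst ennreal_mult[symmetric]) (auto simp: field_simps)
  also have "ennreal (2 * t / \<theta>) * ennreal (\<theta> / 2 * vol p) = ennreal (t * vol p)"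
    using pos2 by (subst ennreal_mult[symmetric]) (auto simp: less_imp_le)
  finally show ?thesis by (simp only: \<theta>_def t_def)
qed

lemma emeasure_wm_prod:
  assumes "weight u" "weight w" "A \<in> sets lebesgue"
  shows "emeasure (wm (\<lambda>x. u x * w x)) A = (\<integral>\<^sup>+x\<in>A. ennreal (u x * w x) \<partial>lebesgue)"
proof -
  have [measurable]: "u \<in> borel_measurable lebesgue" "w \<in> borel_measurable lebesgue" using assms weight_measurable by auto
  show ?thesis unfolding wm_def using assms(3) by (intro emeasure_density) auto
qed

text \<open>The doubling hypothesis \<open>dbl\<close> replaces the mass of a triple by the mass of
  the cube itself, so that disjointness within a level can be used. Both the volume bound and the
  mass of the pieces are reduced in this way to the mass of \<open>E l\<close>. The value 2^i is
  common to all subcubes and comes out of the sum.\<close>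

lemma selected_subcubes:
  fixes u w :: "real^'n \<Rightarrow> real"
  defines "D \<equiv> 3 ^ CARD('n) :: real"
  assumes u: "weight u" and w: "weight w"
    and anti: "\<And>l l' y. 0 < l \<Longrightarrow> l \<le> l' \<Longrightarrow> b l' y \<le> b l y" and L: "L > 0"
    and pc: "\<And>p. emeasure (wm (\<lambda>x. u x * w x)) (piece w m p) \<le> ennreal (K1 * (2 powi (tau w p + int m) * 2 powi tau u p * vol p))"
    and dec: "decays C \<gamma> w" and pos: "K1 > 0" "C > 0" "\<gamma> > 0" "c > 0"
    and dbl: "\<And>p. ennreal c * emeasure (wm w) (triple p) \<le> emeasure (wm w) (dcube p)"
    and p0: "p0 \<in> selected u w b L N m i"
  shows "emeasure (wm (\<lambda>x. u x * w x)) (\<Union>p\<in>{p \<in> selected u w b L N m i. dcube p \<subseteq> dcube p0}. piece w m p)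
    \<le> ennreal (K1 * (2 * C * (2 / c) powr \<gamma> / (c * (1 - 2 powr - \<gamma>))) * (2 powi i * (2 powi (tau w p0 + int m) * vol p0)))"
proof -
  let ?nu = "wm (\<lambda>x. u x * w x)"
  define q where "q = (2::real) powr - \<gamma>"
  have q: "0 < q" "q < 1" using pos by (auto simp: q_def intro: powr_less_one)
  have D: "D > 0" by (simp add: D_def)
  define K3 where "K3 = 1 / (c * D)"
  have K3: "K3 > 0" using pos D by (simp add: K3_def)
  define t0 where "t0 = (2::real) powi tau w p0"
  have t0: "t0 > 0" by (simp add: t0_def)
  define S where "S l = {p \<in> selected u w b L N m i. dcube p \<subseteq> dcube p0 \<and> tau w p = tau w p0 + int l}" for l
  define E where "E l = (\<Union>p\<in>S l. dcube p)" for l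
  have E: "E l \<in> sets lebesgue" "E l \<subseteq> dcube p0" for l
    unfolding E_def by (intro sets.countable_UN') (auto simp: S_def)
  have dis: "disjoint_family_on dcube (S l)" for l
    by (rule disjoint_family_on_mono[OF _ selected_disjoint]) (auto simp: S_def)
  have dtriple: "emeasure (wm w) A \<le> ennreal (2 * t0 * D * vol p0)" if "A \<subseteq> dcube p0" for A
  proof -
    have "emeasure (wm w) A \<le> emeasure (wm w) (triple p0)" 
      using that dcube_subset_triple[of p0] by (intro emeasure_mono) auto
    also have "\<dots> \<le> ennreal (2 * t0 * D * vol p0)"
      unfolding emeasure_triple(1)[OF w] D_def t0_def
    proof (intro ennreal_leI)
      have "tavg w p0 * (3 ^ CARD('n) * vol p0) \<le> 2 powi (tau w p0 + 1) * (3 ^ CARD('n) * vol p0)"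
        by (intro mult_right_mono tau(2)[OF w]) (auto simp: less_imp_le)
      then show "tavg w p0 * (3 ^ CARD('n) * vol p0) \<le> 2 * 2 powi tau w p0 * 3 ^ CARD('n) * vol p0"
        by (simp add: power_int_add mult_ac)
    qed
    finally show ?thesis .
  qed
  have a: "ennreal (2 powi tau w p * vol p) \<le> ennreal K3 * emeasure (wm w) (dcube p)" for p
  proof -
    have "ennreal (2 powi tau w p * vol p) \<le> ennreal (tavg w p * vol p)"
      using tau(1)[OF w, of p] by (intro ennreal_leI mult_right_mono) (auto simp: less_imp_le)
    also have "\<dots> = ennreal K3 * (ennreal c * emeasure (wm w) (triple p))"
    proof -
      have "tavg w p * vol p = K3 * (c * (tavg w p * (D * vol p)))" using pos D by (simp add: K3_def)
      then show ?thesis unfolding emeasure_triple(1)[OF w] D_def[symmetric]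
        by (simp only: ennreal_mult'[OF less_imp_le[OF K3]] ennreal_mult'[OF less_imp_le[OF pos(4)]])
    qed
    also have "\<dots> \<le> ennreal K3 * emeasure (wm w) (dcube p)" by (intro mult_left_mono dbl) auto
    finally show ?thesis .
  qed
  \<comment> \<open>The disjoint subcubes in \<open>S l\<close> have averages about 2^l
    \<open>t0\<close> but share the mass of \<open>p0\<close>, which is at most a constant times
    \<open>t0\<close> \<open>vol p0\<close>; dividing gives the factor 2^(-l).\<close>
  have b: "emeasure lebesgue (E l) \<le> ennreal (2 / c * (1/2) ^ l * vol p0)" for l
  proof -
    define s where "s = 1 / (t0 * 2 ^ l)"
    have s: "s > 0" using t0 by (simp add: s_def)
    have "emeasure lebesgue (E l) = (\<integral>\<^sup>+p. emeasure lebesgue (dcube p) \<partial>count_space (S l))"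
      unfolding E_def by (intro emeasure_UN_countable dis) auto
    also have "\<dots> \<le> (\<integral>\<^sup>+p. ennreal (s * K3) * emeasure (wm w) (dcube p) \<partial>count_space (S l))"
    proof (intro nn_integral_mono)
      fix p assume "p \<in> space (count_space (S l))"
      then have "2 powi tau w p = t0 * 2 ^ l" by (simp add: S_def power_int_add t0_def)
      then have "vol p = s * (2 powi tau w p * vol p)" using t0 by (simp add: s_def)
      then have "emeasure lebesgue (dcube p) = ennreal s * ennreal (2 powi tau w p * vol p)"
        unfolding emeasure_dyadic using s by (subst ennreal_mult[symmetric]) (auto simp: less_imp_le)
      also have "\<dots> \<le> ennreal s * (ennreal K3 * emeasure (wm w) (dcube p))" by (intro mult_left_mono a) auto
      finally show "emeasure lebesgue (dcube p) \<le> ennreal (s * K3) * emeasure (wm w) (dcube p)"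
        using s K3 by (simp add: ennreal_mult mult.assoc less_imp_le)
    qed
    also have "\<dots> = ennreal (s * K3) * emeasure (wm w) (E l)"
      unfolding E_def by (subst emeasure_UN_countable[OF _ _ dis]) (auto simp: nn_integral_cmult)
    also have "\<dots> \<le> ennreal (s * K3) * ennreal (2 * t0 * D * vol p0)" by (intro mult_left_mono dtriple E) auto
    also have "\<dots> = ennreal (2 / c * (1/2) ^ l * vol p0)"
    proof (subst ennreal_mult[symmetric])
      show "ennreal (s * K3 * (2 * t0 * D * vol p0)) = ennreal (2 / c * (1/2) ^ l * vol p0)"
        using t0 pos D by (simp add: s_def K3_def power_divide mult.commute)
    qed (use s K3 t0 D in \<open>auto simp: less_imp_le\<close>)
    finally show ?thesis .
  qed
  have c: "emeasure (wm w) (E l) \<le> ennreal (C * (2 / c) powr \<gamma> * q ^ l * (2 * t0 * D * vol p0))" for l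
  proof -
    have "emeasure (wm w) (E l) \<le> ennreal (C * (2 / c * (1/2) ^ l) powr \<gamma>) * emeasure (wm w) (dcube p0)"
      using pos by (intro decaysD[OF dec E _ b]) auto
    also have "\<dots> \<le> ennreal (C * (2 / c * (1/2) ^ l) powr \<gamma>) * ennreal (2 * t0 * D * vol p0)"
      by (intro mult_left_mono dtriple) auto
    also have "\<dots> = ennreal (C * (2 / c * (1/2) ^ l) powr \<gamma> * (2 * t0 * D * vol p0))"
      using pos t0 D by (intro ennreal_mult[symmetric]) (auto simp: less_imp_le)
    also have "(2 / c * (1/2) ^ l) powr \<gamma> = (2 / c) powr \<gamma> * q ^ l"
    proof -
      have "(1/2) ^ l = 2 powr (- real l)" by (simp add: powr_minus powr_realpow power_divide inverse_eq_divide)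
      moreover have "q ^ l = q powr real l" using q by (simp add: powr_realpow)
      ultimately have "((1/2) ^ l) powr \<gamma> = q ^ l" by (simp add: q_def powr_powr mult_ac)
      then show ?thesis using pos by (subst powr_mult) auto
    qed
    finally show ?thesis by (simp add: mult_ac)
  qed
  define k where "k = K1 * 2 ^ m * 2 powi i"
  have k: "k > 0" using pos by (simp add: k_def)
  have d: "emeasure ?nu (\<Union>p\<in>S l. piece w m p) \<le> ennreal (k * (C * (2 / c) powr \<gamma>) * (2 * t0 * vol p0 / c) * q ^ l)" for l
  proof -
    have "emeasure ?nu (\<Union>p\<in>S l. piece w m p) \<le> (\<integral>\<^sup>+p. emeasure ?nu (piece w m p) \<partial>count_space (S l))"
      by (intro emeasure_UN_le_nn_integral) (auto simp: piece_sets[OF w])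
    also have "\<dots> \<le> (\<integral>\<^sup>+p. ennreal (k * K3) * emeasure (wm w) (dcube p) \<partial>count_space (S l))"
    proof (intro nn_integral_mono)
      fix p assume "p \<in> space (count_space (S l))"
      then have "tau u p = i" by (simp add: S_def selected_def)
      then have "K1 * (2 powi (tau w p + int m) * 2 powi tau u p * vol p) = k * (2 powi tau w p * vol p)"
        by (simp add: k_def power_int_add mult_ac)
      then have "emeasure ?nu (piece w m p) \<le> ennreal (k * (2 powi tau w p * vol p))"
        using pc[of p] by (simp only:)
      also have "\<dots> = ennreal k * ennreal (2 powi tau w p * vol p)" using k by (intro ennreal_mult) (auto simp: less_imp_le)
      also have "\<dots> \<le> ennreal k * (ennreal K3 * emeasure (wm w) (dcube p))" by (intro mult_left_mono a) auto
      finally show "emeasure ?nu (piece w m p) \<le> ennreal (k * K3) * emeasure (wm w) (dcube p)"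
        using k K3 by (simp add: ennreal_mult mult.assoc less_imp_le)
    qed
    also have "\<dots> = ennreal (k * K3) * emeasure (wm w) (E l)"
      unfolding E_def by (subst emeasure_UN_countable[OF _ _ dis]) (auto simp: nn_integral_cmult)
    also have "\<dots> \<le> ennreal (k * K3) * ennreal (C * (2 / c) powr \<gamma> * q ^ l * (2 * t0 * D * vol p0))"
      by (intro mult_left_mono c) auto
    also have "\<dots> = ennreal (k * (C * (2 / c) powr \<gamma>) * (2 * t0 * vol p0 / c) * q ^ l)"
    proof (subst ennreal_mult[symmetric])
      show "ennreal (k * K3 * (C * (2 / c) powr \<gamma> * q ^ l * (2 * t0 * D * vol p0))) = ennreal (k * (C * (2 / c) powr \<gamma>) * (2 * t0 * vol p0 / c) * q ^ l)"
        using D by (simp add: K3_def mult_ac)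
    qed (use k K3 pos t0 D q in \<open>auto simp: less_imp_le\<close>)
    finally show ?thesis .
  qed
  \<comment> \<open>No subcube has a smaller \<open>tau w\<close> than \<open>p0\<close>, so the
    classes with natural l exhaust them.\<close>
  have "{p \<in> selected u w b L N m i. dcube p \<subseteq> dcube p0} = (\<Union>l. S l)"
  proof (intro set_eqI iffI)
    fix p assume p: "p \<in> {p \<in> selected u w b L N m i. dcube p \<subseteq> dcube p0}"
    then have "tau w p0 \<le> tau w p" using selected_nested[where b = b, OF anti L _ p0] by auto
    then have "p \<in> S (nat (tau w p - tau w p0))" using p by (simp add: S_def)
    then show "p \<in> (\<Union>l. S l)" by blast
  qed (auto simp: S_def)
  then have "(\<Union>p\<in>{p \<in> selected u w b L N m i. dcube p \<subseteq> dcube p0}. piece w m p) = (\<Union>l. \<Union>p\<in>S l. piece w m p)" by simp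
  then have "emeasure ?nu (\<Union>p\<in>{p \<in> selected u w b L N m i. dcube p \<subseteq> dcube p0}. piece w m p) 
      \<le> (\<integral>\<^sup>+l. emeasure ?nu (\<Union>p\<in>S l. piece w m p) \<partial>count_space UNIV)"
    by (simp only:) (intro emeasure_UN_le_nn_integral; auto intro!: sets.countable_UN' piece_sets[OF w])
  also have "\<dots> \<le> (\<integral>\<^sup>+l. ennreal (k * (C * (2 / c) powr \<gamma>) * (2 * t0 * vol p0 / c) * q ^ l) \<partial>count_space UNIV)"
    by (intro nn_integral_mono d)
  also have "\<dots> = ennreal (k * (C * (2 / c) powr \<gamma>) * (2 * t0 * vol p0 / c) / (1 - q))"
    using k pos t0 q by (intro nn_integral_geometric) (auto simp: less_imp_le)
  also have "k * (C * (2 / c) powr \<gamma>) * (2 * t0 * vol p0 / c) / (1 - q) = 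
     K1 * (2 * C * (2 / c) powr \<gamma> / (c * (1 - q))) * (2 powi i * (2 powi (tau w p0 + int m) * vol p0))"
    using pos q by (simp add: k_def t0_def power_int_add field_simps)
  finally show ?thesis by (simp only: q_def)
qed

section \<open>The weak type estimate\<close>

text \<open>On the closed triple the A_1 condition bounds the average by a multiple of u almost
  everywhere. There are countably many dyadic cubes, so one null set serves them all.\<close>

lemma A1_tau:
  fixes u :: "real^'n \<Rightarrow> real"
  assumes "muckenhoupt_A1 u"
  obtains C where "C > 0" "AE y in lebesgue. \<forall>p. y \<in> dcube p \<longrightarrow> 2 powi tau u p \<le> C * u y"
proof -
  have u: "weight u" using assms by (simp add: muckenhoupt_A1_def)
  obtain C where C: "C > 0" "\<And>Q. cube Q \<Longrightarrow> AE x in lebesgue. x \<in> Q \<longrightarrow> avg Q u \<le> C * u x"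
    using assms by (auto simp: muckenhoupt_A1_def)
  have le: "2 powi tau u p \<le> avg (ctriple p) u" for p
  proof -
    have sub: "triple p \<subseteq> ctriple p" by (rule subset_closure_dyadic)
    have mes: "measure lebesgue (ctriple p) = 3 ^ CARD('n) * vol p"
      by (simp add: measure_def emeasure_dyadic less_imp_le)
    have pos: "3 ^ CARD('n) * vol p > 0" by simp
    have "emeasure (wm u) (triple p) \<le> emeasure (wm u) (ctriple p)"
      using sub cube_lebesgue(1)[OF cube_closure_dyadic(2)[of p]] by (intro emeasure_mono) auto
    then have "tavg u p * (3 ^ CARD('n) * vol p) \<le> avg (ctriple p) u * (3 ^ CARD('n) * vol p)"
      unfolding emeasure_triple(1)[OF u] emeasure_wm_cube(1)[OF u cube_closure_dyadic(2)] mes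
      using emeasure_wm_cube(2)[OF u cube_closure_dyadic(2)[of p]] pos
      by (subst (asm) ennreal_le_iff) (auto simp: less_imp_le intro!: mult_nonneg_nonneg)
    then have "tavg u p \<le> avg (ctriple p) u" using pos by (metis mult_le_cancel_right_pos)
    then show ?thesis using tau(1)[OF u, of p] by linarith
  qed
  have "AE y in lebesgue. y \<in> dcube p \<longrightarrow> 2 powi tau u p \<le> C * u y" for p
    using C(2)[OF cube_closure_dyadic(2)[of p]]
  proof eventually_elim
    case (elim y)
    then show ?case using le[of p] dcube_subset_triple[of p] subset_closure_dyadic(2)[of p] by fastforce
  qed
  then have "AE y in lebesgue. \<forall>p. y \<in> dcube p \<longrightarrow> 2 powi tau u p \<le> C * u y"
    by (subst AE_all_countable) auto
  then show ?thesis using that C(1) by blast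
qed

text \<open>In the application \<open>b l = \<Phi> (F (w / l) powr (1 / r))\<close>, with \<open>F\<close> a multiple of \<open>\<bar>f\<bar> / t\<close>, and
  \<open>G = \<eta> (\<Phi> F)\<close>. The number \<open>m\<close> dominates the maximal function of \<open>w\<close> at \<open>x\<close>.\<close>

definition dominated :: "(real^'n \<Rightarrow> real) \<Rightarrow> real \<Rightarrow> real \<Rightarrow> real \<Rightarrow> (real \<Rightarrow> real^'n \<Rightarrow> ennreal) \<Rightarrow> (real^'n \<Rightarrow> ennreal) \<Rightarrow> bool" where
  "dominated w A B \<kappa> b G \<longleftrightarrow> (\<forall>l>0. b l \<in> borel_measurable lebesgue) \<and>
     (\<forall>l l' y. 0 < l \<longrightarrow> l \<le> l' \<longrightarrow> b l' y \<le> b l y) \<and> G \<in> borel_measurable lebesgue \<and>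
     (\<forall>l>0. \<forall>y. b l y \<le> ennreal A * (ennreal (w y / l) * G y) + ennreal (B * (w y / l) powr (1 + \<kappa>)))"

definition jump_set :: "(real^'n \<Rightarrow> real) \<Rightarrow> (real \<Rightarrow> real^'n \<Rightarrow> ennreal) \<Rightarrow> real \<Rightarrow> (real^'n) set" where
  "jump_set w b L = {x. \<exists>m>0.
     (\<forall>Q. cube Q \<longrightarrow> x \<in> Q \<longrightarrow> emeasure (wm w) Q \<le> ennreal m * emeasure lebesgue Q) \<and>
     (\<exists>Q. cube Q \<and> x \<in> Q \<and> emeasure lebesgue Q < (\<integral>\<^sup>+y\<in>Q. b (L * m) y \<partial>lebesgue))}"

text \<open>The order of the quantifiers matters: \<kappa> comes from the decay of \<open>w\<close>
  alone and must be known before \<open>young_product_bound\<close> supplies A and B, while L and C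
  must not depend on \<open>b\<close> and \<open>G\<close>, which carry t and f.\<close>

lemma weak_type:
  fixes u w :: "real^'n \<Rightarrow> real"
  assumes A1: "muckenhoupt_A1 u" and sw: "spread w"
  obtains \<kappa> where "\<kappa> > 0"
    "\<And>A B. A > 0 \<Longrightarrow> B > 0 \<Longrightarrow> \<exists>L>0. \<exists>C>0. \<forall>b G.
       dominated w A B \<kappa> b G \<longrightarrow>
       weighted_measure (\<lambda>x. u x * w x) (jump_set w b L)
         \<le> ennreal C * (\<integral>\<^sup>+x. G x * ennreal (u x * w x) \<partial>lebesgue)"
proof -
  have w: "weight w" using sw by (simp add: spread_def)
  have u: "weight u" using A1 by (simp add: muckenhoupt_A1_def)
  have u0: "0 \<le> u x" and w0: "0 \<le> w x" for x using u w by (auto simp: weight_def)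
  have [measurable]: "u \<in> borel_measurable lebesgue" "w \<in> borel_measurable lebesgue" using u w weight_measurable by auto
  obtain Cw \<gamma>w where dw: "Cw > 0" "0 < \<gamma>w" "\<gamma>w \<le> 1" "decays Cw \<gamma>w w" using spread_decays[OF sw] by metis
  obtain Cu \<gamma>u where du: "Cu > 0" "0 < \<gamma>u" "\<gamma>u \<le> 1" "decays Cu \<gamma>u u" using spread_decays[OF A1_spread[OF A1]] by metis
  obtain C' where rh: "C' > 0" "\<And>p l. l > 0 \<Longrightarrow> emeasure (wm w) (dcube p) \<le> ennreal (l * vol p) \<Longrightarrow>
      (\<integral>\<^sup>+x\<in>dcube p. ennreal ((w x / l) powr (1 + \<gamma>w/2)) \<partial>lebesgue) \<le> ennreal (C' * vol p)"
    by (rule reverse_holder[OF w dw(4,1,2)]) (rule that)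
  obtain Ca where Ca: "Ca > 0" "AE y in lebesgue. \<forall>p. y \<in> dcube p \<longrightarrow> 2 powi tau u p \<le> Ca * u y"
    by (rule A1_tau[OF A1])
  \<comment> \<open>With \<theta> = 3^(-n) the cube \<open>p\<close> is an admissible subset of its
    own triple, and the spreading property becomes doubling.\<close>
  have third: "1 / 3 ^ CARD('n) > (0::real)" by simp
  obtain c where c: "c > 0" "\<And>p F. F \<in> sets lebesgue \<Longrightarrow> F \<subseteq> triple p \<Longrightarrow>
      ennreal (1 / 3 ^ CARD('n) * 3 ^ CARD('n) * vol p) \<le> emeasure lebesgue F
       \<Longrightarrow> ennreal c * emeasure (wm w) (triple p) \<le> emeasure (wm w) F"
    by (rule spread_dcube[OF sw third]) (rule that)
  have dbl: "ennreal c * emeasure (wm w) (triple p) \<le> emeasure (wm w) (dcube p)" for p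
    using dcube_subset_triple[of p] by (intro c(2)) (auto simp: emeasure_dyadic)
  obtain Z where Z: "Z \<in> null_sets lebesgue"
    "\<And>x m. x \<notin> Z \<Longrightarrow> 0 \<le> m \<Longrightarrow> \<forall>Q. cube Q \<longrightarrow> x \<in> Q \<longrightarrow> emeasure (wm w) Q \<le> ennreal m * emeasure lebesgue Q \<Longrightarrow> w x \<le> m"
    by (rule weight_le_averages[OF w]) (rule that)
  show ?thesis
  proof (rule that[of "\<gamma>w / 2"])
    show "\<gamma>w / 2 > 0" using dw by simp
    fix A B :: real assume AB: "A > 0" "B > 0"
    define \<theta> :: real where "\<theta> = (1/6) ^ CARD('n)"
    have \<theta>: "\<theta> > 0" by (simp add: \<theta>_def)
    define M where "M = max 1 (2 * B * C' / \<theta>)"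
    have "2 * B * C' / \<theta> \<le> M" "M \<ge> 1" by (auto simp: M_def)
    then have "M \<ge> 1" "B * C' / M \<le> \<theta> / 2" using \<theta> by (auto simp: field_simps)
    then have M: "M \<ge> 1" "B * C' / M \<le> (1/6) ^ CARD('n) / 2" by (simp_all only: \<theta>_def)
    define L where "L = 2 * 3 ^ CARD('n) * M"
    have L: "L > 0" using M by (simp add: L_def)
    define K1 where "K1 = 4 * 3 ^ CARD('n) * (1 + Cu * (3 ^ CARD('n)) powr \<gamma>u)"
    have K1: "K1 > 0" unfolding K1_def using du by (intro mult_pos_pos add_pos_nonneg) auto
    define \<rho> :: real where "\<rho> = 2 powr (- \<gamma>u / 2)"
    have \<rho>: "0 < \<rho>" "\<rho> < 1" using du by (auto simp: \<rho>_def intro: powr_less_one)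
    define K2 where "K2 = 2 * Cw * (2 / c) powr \<gamma>w / (c * (1 - 2 powr - \<gamma>w))"
    have "(2::real) powr - \<gamma>w < 1" using dw by (intro powr_less_one) auto
    then have K2: "K2 > 0" using dw c by (auto simp: K2_def intro!: divide_pos_pos mult_pos_pos)
    define K8 where "K8 = 2 * A / ((1/6) ^ CARD('n) * L)"
    have K8: "K8 > 0" using AB L by (simp add: K8_def)
    define C where "C = K1 * K2 * K8 * (2 * Ca) / (1 - \<rho>)"
    have C: "C > 0" using K1 K2 K8 Ca \<rho> by (simp add: C_def)
    show "\<exists>L>0. \<exists>C>0. \<forall>b G.
       dominated w A B (\<gamma>w / 2) b G \<longrightarrow>
       weighted_measure (\<lambda>x. u x * w x) (jump_set w b L)
         \<le> ennreal C * (\<integral>\<^sup>+x. G x * ennreal (u x * w x) \<partial>lebesgue)"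
    proof (rule exI[of _ L], rule conjI[OF L], rule exI[of _ C], rule conjI[OF C], intro allI impI)
      fix b :: "real \<Rightarrow> real^'n \<Rightarrow> ennreal" and G :: "real^'n \<Rightarrow> ennreal"
      assume dom: "dominated w A B (\<gamma>w / 2) b G"
      then have meas: "\<And>l. 0 < l \<Longrightarrow> b l \<in> borel_measurable lebesgue"
        and anti: "\<And>l l' y. 0 < l \<Longrightarrow> l \<le> l' \<Longrightarrow> b l' y \<le> b l y"
        and bnd: "\<And>l y. 0 < l \<Longrightarrow> b l y \<le> ennreal A * (ennreal (w y / l) * G y) + ennreal (B * (w y / l) powr (1 + \<gamma>w / 2))"
        and G [measurable]: "G \<in> borel_measurable lebesgue"
        unfolding dominated_def by auto
      let ?E = "jump_set w b L"
      let ?nu = "wm (\<lambda>x. u x * w x)"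
      let ?sel = "\<lambda>N m i. selected u w b L N m i"
      \<comment> \<open>The weight u is left out here: it is represented by the numbers 2^i and
        restored in \<open>bins\<close>.\<close>
      define H where "H = density lebesgue (\<lambda>x. G x * ennreal (w x))"
      have H: "emeasure H S = (\<integral>\<^sup>+x. G x * ennreal (w x) * indicator S x \<partial>lebesgue)" if "S \<in> sets lebesgue" for S
        unfolding H_def using that by (intro emeasure_density) auto
      have Hs: "sets H = sets lebesgue" by (simp add: H_def)
      have pc: "emeasure ?nu (piece w m p) \<le> ennreal (K1 * \<rho> ^ m * (2 powi (tau w p + int m) * 2 powi tau u p * vol p))" for m p
        unfolding emeasure_wm_prod[OF u w piece_sets[OF w]] 
        using truncated_mass[OF u w du(4,1,2,3)] by (simp add: piece_def K1_def \<rho>_def)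
      define V where "V N m i = (\<Union>p\<in>dmaximal (?sel N m i). dcube p)" for N m i
      have V: "V N m i \<in> sets lebesgue" for N m i unfolding V_def by (intro sets.countable_UN') auto
      have bin: "emeasure ?nu (\<Union>p\<in>?sel N m i. piece w m p) \<le> ennreal (K1 * K2 * K8 * \<rho> ^ m) * (ennreal (2 powi i) * emeasure H (V N m i))" for N m i
      proof -
        have one: "emeasure ?nu (\<Union>p\<in>{p \<in> ?sel N m i. dcube p \<subseteq> dcube p0}. piece w m p) 
           \<le> ennreal (K1 * K2 * K8 * \<rho> ^ m * 2 powi i) * emeasure H (dcube p0)" if "p0 \<in> dmaximal (?sel N m i)" for p0
        proof -
          have p0: "p0 \<in> ?sel N m i" using that dmaximal_subset by blast
          have "emeasure ?nu (\<Union>p\<in>{p \<in> ?sel N m i. dcube p \<subseteq> dcube p0}. piece w m p)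
             \<le> ennreal (K1 * \<rho> ^ m * K2 * (2 powi i * (2 powi (tau w p0 + int m) * vol p0)))"
            unfolding K2_def using K1 \<rho> by (intro selected_subcubes[OF u w anti L pc dw(4) _ dw(1,2) c(1) dbl p0]) auto
          also have "\<dots> = ennreal (K1 * \<rho> ^ m * K2 * 2 powi i) * ennreal (2 powi (tau w p0 + int m) * vol p0)"
            using K1 K2 \<rho> by (subst ennreal_mult[symmetric]) (auto simp: less_imp_le mult_ac)
          also have "\<dots> \<le> ennreal (K1 * \<rho> ^ m * K2 * 2 powi i) * (ennreal K8 * emeasure H (dcube p0))"
          proof (intro mult_left_mono)
            show "ennreal (2 powi (tau w p0 + int m) * vol p0) \<le> ennreal K8 * emeasure H (dcube p0)"
              unfolding H[OF dcube_lebesgue] K8_def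
            proof (rule stop_mass[OF w AB rh(1) _ rh(2) G bnd M L_def])
              show "p0 \<in> stop b L N (tau w p0 + int m)" using p0 dmaximal_subset by (auto simp: selected_def)
            qed (use dw in auto)
          qed simp
          also have "\<dots> = ennreal (K1 * K2 * K8 * \<rho> ^ m * 2 powi i) * emeasure H (dcube p0)"
            using K1 K2 K8 \<rho> by (subst mult.assoc[symmetric], subst ennreal_mult[symmetric]) (auto simp: less_imp_le mult_ac)
          finally show ?thesis .
        qed
        have "(\<Union>p\<in>?sel N m i. piece w m p) \<subseteq> (\<Union>p0\<in>dmaximal (?sel N m i). \<Union>p\<in>{p \<in> ?sel N m i. dcube p \<subseteq> dcube p0}. piece w m p)"
        proof
          fix x assume "x \<in> (\<Union>p\<in>?sel N m i. piece w m p)"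
          then obtain p where p: "p \<in> ?sel N m i" "x \<in> piece w m p" by blast
          obtain p0 where "p0 \<in> dmaximal (?sel N m i)" "dcube p \<subseteq> dcube p0"
            by (rule ex_dmaximal[OF p(1) selected_fst])
          then show "x \<in> (\<Union>p0\<in>dmaximal (?sel N m i). \<Union>p\<in>{p \<in> ?sel N m i. dcube p \<subseteq> dcube p0}. piece w m p)"
            using p by blast
        qed
        moreover have ms: "(\<Union>p\<in>{p \<in> ?sel N m i. dcube p \<subseteq> dcube p0}. piece w m p) \<in> sets ?nu" for p0
          by (intro sets.countable_UN') (auto simp: piece_sets[OF w])
        ultimately have "emeasure ?nu (\<Union>p\<in>?sel N m i. piece w m p) \<le> 
           emeasure ?nu (\<Union>p0\<in>dmaximal (?sel N m i). \<Union>p\<in>{p \<in> ?sel N m i. dcube p \<subseteq> dcube p0}. piece w m p)"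
          by (intro emeasure_mono sets.countable_UN') auto
        also have "\<dots> \<le> (\<integral>\<^sup>+p0. emeasure ?nu (\<Union>p\<in>{p \<in> ?sel N m i. dcube p \<subseteq> dcube p0}. piece w m p) \<partial>count_space (dmaximal (?sel N m i)))"
          by (rule emeasure_UN_le_nn_integral[OF countable_dindex ms])
        also have "\<dots> \<le> (\<integral>\<^sup>+p0. ennreal (K1 * K2 * K8 * \<rho> ^ m * 2 powi i) * emeasure H (dcube p0) \<partial>count_space (dmaximal (?sel N m i)))"
          by (intro nn_integral_mono one) simp
        also have "\<dots> = ennreal (K1 * K2 * K8 * \<rho> ^ m * 2 powi i) * emeasure H (V N m i)"
          unfolding V_def by (subst emeasure_UN_countable[OF _ _ disjoint_dmaximal]) (auto simp: nn_integral_cmult Hs)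
        also have "\<dots> = ennreal (K1 * K2 * K8 * \<rho> ^ m) * (ennreal (2 powi i) * emeasure H (V N m i))"
          using K1 K2 K8 \<rho> by (subst mult.assoc[symmetric], subst ennreal_mult[symmetric]) (auto simp: less_imp_le)
        finally show ?thesis .
      qed
      let ?R = "\<integral>\<^sup>+x. G x * ennreal (u x * w x) \<partial>lebesgue"
      \<comment> \<open>A point may lie in \<open>V N m i\<close> for many i, but almost everywhere
        only for those with 2^i \<le> Ca u(x). After interchanging sum and integral the inner sum is
        at most 2 Ca u(x).\<close>
      have bins: "(\<integral>\<^sup>+i. ennreal (2 powi i) * emeasure H (V N m i) \<partial>count_space UNIV) \<le> ennreal (2 * Ca) * ?R" for N m
      proof -
        have "(\<integral>\<^sup>+i. ennreal (2 powi i) * emeasure H (V N m i) \<partial>count_space UNIV)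
          = (\<integral>\<^sup>+i. \<integral>\<^sup>+x. (ennreal (2 powi i) * indicator (V N m i) x) * (G x * ennreal (w x)) \<partial>lebesgue \<partial>count_space UNIV)"
          using V by (intro nn_integral_cong) (simp add: H nn_integral_cmult[symmetric] mult_ac)
        also have "\<dots> = (\<integral>\<^sup>+x. \<integral>\<^sup>+i. (ennreal (2 powi i) * indicator (V N m i) x) * (G x * ennreal (w x)) \<partial>count_space UNIV \<partial>lebesgue)"
          using V by (intro nn_integral_count_space_nn_integral[symmetric]) auto
        also have "\<dots> = (\<integral>\<^sup>+x. (\<integral>\<^sup>+i. ennreal (2 powi i) * indicator (V N m i) x \<partial>count_space UNIV) * (G x * ennreal (w x)) \<partial>lebesgue)"
          by (intro nn_integral_cong nn_integral_multc) auto
        also have "\<dots> \<le> (\<integral>\<^sup>+x. ennreal (2 * Ca) * (G x * ennreal (u x * w x)) \<partial>lebesgue)"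
        proof (rule nn_integral_mono_AE)
          have "AE x in lebesgue. 0 < u x" using u by (simp add: weight_def)
          then show "AE x in lebesgue. (\<integral>\<^sup>+i. ennreal (2 powi i) * indicator (V N m i) x \<partial>count_space UNIV) * (G x * ennreal (w x)) 
             \<le> ennreal (2 * Ca) * (G x * ennreal (u x * w x))"
            using Ca(2)
          proof eventually_elim
            case (elim x)
            have "2 powi i \<le> Ca * u x" if x: "x \<in> V N m i" for i
            proof -
              obtain p where p: "p \<in> dmaximal (?sel N m i)" "x \<in> dcube p" using x by (auto simp: V_def)
              then have "tau u p = i" using dmaximal_subset[of "?sel N m i"] by (auto simp: selected_def)
              then show ?thesis using elim(2) p(2) by blast
            qed
            then have "(\<integral>\<^sup>+i. ennreal (2 powi i) * indicator (V N m i) x \<partial>count_space UNIV)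
               \<le> (\<integral>\<^sup>+i. ennreal (2 powi i) * indicator {i. 2 powi i \<le> Ca * u x} i \<partial>count_space UNIV)"
              by (intro nn_integral_mono) (auto split: split_indicator)
            also have "\<dots> \<le> ennreal (2 * (Ca * u x))" using Ca elim by (intro sum_dyadic_le) simp
            finally have "(\<integral>\<^sup>+i. ennreal (2 powi i) * indicator (V N m i) x \<partial>count_space UNIV) * (G x * ennreal (w x))
               \<le> ennreal (2 * (Ca * u x)) * (G x * ennreal (w x))" by (rule mult_right_mono) simp
            also have "ennreal (2 * (Ca * u x)) = ennreal (2 * Ca) * ennreal (u x)"
              using Ca u0[of x] by (subst ennreal_mult[symmetric]) (auto simp: mult_ac)
            also have "ennreal (2 * Ca) * ennreal (u x) * (G x * ennreal (w x)) = ennreal (2 * Ca) * (G x * ennreal (u x * w x))"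
              using u0[of x] w0[of x] by (simp add: ennreal_mult mult_ac)
            finally show ?case .
          qed
        qed
        also have "\<dots> = ennreal (2 * Ca) * ?R" by (simp add: nn_integral_cmult)
        finally show ?thesis .
      qed
      define P where "P N = (\<Union>m. \<Union>i. \<Union>p\<in>?sel N m i. piece w m p)" for N
      have Pm: "(\<Union>p\<in>?sel N m i. piece w m p) \<in> sets lebesgue" for N m i
        by (intro sets.countable_UN') (auto simp: piece_sets[OF w])
      have Pi: "(\<Union>i. \<Union>p\<in>?sel N m i. piece w m p) \<in> sets lebesgue" for N m
        using Pm by (intro sets.countable_UN') auto
      have Ps: "P N \<in> sets lebesgue" for N
        unfolding P_def using Pi by (intro sets.countable_UN') auto
      have main: "emeasure ?nu (P N) \<le> ennreal C * ?R" for N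
      proof -
        have "emeasure ?nu (P N) \<le> (\<integral>\<^sup>+m. emeasure ?nu (\<Union>i. \<Union>p\<in>?sel N m i. piece w m p) \<partial>count_space UNIV)"
          unfolding P_def using Pi by (intro emeasure_UN_le_nn_integral) auto
        also have "\<dots> \<le> (\<integral>\<^sup>+m. ennreal (K1 * K2 * K8 * (2 * Ca) * \<rho> ^ m) * ?R \<partial>count_space UNIV)"
        proof (intro nn_integral_mono)
          fix m :: nat
          have "emeasure ?nu (\<Union>i. \<Union>p\<in>?sel N m i. piece w m p) \<le> (\<integral>\<^sup>+i. emeasure ?nu (\<Union>p\<in>?sel N m i. piece w m p) \<partial>count_space UNIV)"
            using Pm by (intro emeasure_UN_le_nn_integral) auto
          also have "\<dots> \<le> (\<integral>\<^sup>+i. ennreal (K1 * K2 * K8 * \<rho> ^ m) * (ennreal (2 powi i) * emeasure H (V N m i)) \<partial>count_space UNIV)"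
            by (intro nn_integral_mono bin)
          also have "\<dots> = ennreal (K1 * K2 * K8 * \<rho> ^ m) * (\<integral>\<^sup>+i. ennreal (2 powi i) * emeasure H (V N m i) \<partial>count_space UNIV)"
            by (simp add: nn_integral_cmult)
          also have "\<dots> \<le> ennreal (K1 * K2 * K8 * \<rho> ^ m) * (ennreal (2 * Ca) * ?R)"
            by (intro mult_left_mono bins) auto
          also have "\<dots> = ennreal (K1 * K2 * K8 * (2 * Ca) * \<rho> ^ m) * ?R"
            using K1 K2 K8 \<rho> Ca by (subst mult.assoc[symmetric], subst ennreal_mult[symmetric]) (auto simp: less_imp_le mult_ac)
          finally show "emeasure ?nu (\<Union>i. \<Union>p\<in>?sel N m i. piece w m p) \<le> ennreal (K1 * K2 * K8 * (2 * Ca) * \<rho> ^ m) * ?R" .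
        qed
        also have "\<dots> = (\<integral>\<^sup>+m. ennreal (K1 * K2 * K8 * (2 * Ca) * \<rho> ^ m) \<partial>count_space UNIV) * ?R"
          by (rule nn_integral_multc) simp
        also have "(\<integral>\<^sup>+m. ennreal (K1 * K2 * K8 * (2 * Ca) * \<rho> ^ m) \<partial>count_space UNIV) = ennreal C"
          unfolding C_def using K1 K2 K8 \<rho> Ca by (intro nn_integral_geometric) (auto simp: less_imp_le)
        finally show ?thesis .
      qed
      let ?f = "\<lambda>x. ennreal (u x * w x)"
      have ev: "\<forall>\<^sub>F N in sequentially. x \<in> P (int N)" if x: "x \<in> ?E" "x \<notin> Z" for x
      proof -
        obtain m Q where m: "m > 0" "\<And>Q. cube Q \<Longrightarrow> x \<in> Q \<Longrightarrow> emeasure (wm w) Q \<le> ennreal m * emeasure lebesgue Q"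
          "cube Q" "x \<in> Q" "emeasure lebesgue Q < (\<integral>\<^sup>+y\<in>Q. b (L * m) y \<partial>lebesgue)"
          using x(1) unfolding jump_set_def by blast
        have wm: "w x \<le> m" using Z(2)[OF x(2), of m] m(1,2) by auto
        obtain k where k: "\<And>N. k \<le> N \<Longrightarrow> \<exists>n i. \<exists>p\<in>?sel N n i. x \<in> piece w n p"
          by (rule selected_covers[where u = u and b = b and L = L and m = m and Q = Q, OF w anti meas L m wm]) (assumption | rule that)+
        show ?thesis
        proof (rule eventually_sequentiallyI[of "nat k"])
          fix N assume "nat k \<le> N"
          then have "k \<le> int N" by simp
          from k[OF this] show "x \<in> P (int N)" by (auto simp: P_def)
        qed
      qed
      \<comment> \<open>Maximal cubes change with N, so \<open>P N\<close> is not claimed to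
        increase; it suffices that almost every point of the jump set is in \<open>P N\<close> for
        all large N. The comparison is pointwise, and Fatou's lemma is applied to the measurable
        sets \<open>P N\<close>.\<close>
      have "weighted_measure (\<lambda>x. u x * w x) ?E \<le> (\<integral>\<^sup>+x. liminf (\<lambda>N. ?f x * indicator (P (int N)) x) \<partial>lebesgue)"
        unfolding weighted_measure_def
      proof (rule nn_integral_mono_AE, use AE_not_in[OF Z(1)] in eventually_elim)
        fix x assume x: "x \<notin> Z"
        show "?f x * indicator ?E x \<le> liminf (\<lambda>N. ?f x * indicator (P (int N)) x)"
        proof (cases "x \<in> ?E")
          case True
          then show ?thesis using ev[OF True x] by (intro Liminf_bounded) (auto elim!: eventually_mono)
        qed simp
      qed
      also have "\<dots> \<le> liminf (\<lambda>N. \<integral>\<^sup>+x. ?f x * indicator (P (int N)) x \<partial>lebesgue)"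
        using Ps by (intro nn_integral_liminf) auto
      also have "\<dots> = liminf (\<lambda>N. emeasure ?nu (P (int N)))"
        using Ps by (simp add: emeasure_wm_prod[OF u w])
      also have "\<dots> \<le> liminf (\<lambda>N::nat. ennreal C * ?R)"
        by (intro Liminf_mono always_eventually allI main)
      also have "\<dots> = ennreal C * ?R" by (simp add: Liminf_const)
      finally show "weighted_measure (\<lambda>x. u x * w x) (jump_set w b L)
         \<le> ennreal C * ?R" .
    qed
  qed
qed

section \<open>From Luxemburg averages to the jump set\<close>

lemma luxemburg_avg_gt:
  assumes "ennreal k < luxemburg_avg \<Phi> Q f" "k > 0" "cube Q"
  shows "emeasure lebesgue Q < (\<integral>\<^sup>+x\<in>Q. ennreal (\<Phi> (\<bar>f x\<bar> / k)) \<partial>lebesgue)"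
proof (rule ccontr)
  assume "\<not> ?thesis"
  then have "(\<integral>\<^sup>+x\<in>Q. ennreal (\<Phi> (\<bar>f x\<bar> / k)) \<partial>lebesgue) / emeasure lebesgue Q \<le> emeasure lebesgue Q / emeasure lebesgue Q"
    by (intro divide_right_mono_ennreal) simp
  also have "\<dots> = 1" using cube_lebesgue(3,4)[OF assms(3)] by (intro ennreal_divide_self) auto
  finally have "luxemburg_avg \<Phi> Q f \<le> ennreal k"
    unfolding luxemburg_avg_def using assms(2) by (intro Inf_lower) auto
  then show False using assms(1) by simp
qed

lemma luxemburg_avg_less:
  assumes "luxemburg_avg \<Phi> Q f < ennreal k" "cube Q"
  obtains k' where "0 < k'" "k' < k" "(\<integral>\<^sup>+x\<in>Q. ennreal (\<Phi> (\<bar>f x\<bar> / k')) \<partial>lebesgue) \<le> emeasure lebesgue Q"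
proof -
  obtain k' where k': "k' > 0" "ennreal k' < ennreal k"
    "(\<integral>\<^sup>+x\<in>Q. ennreal (\<Phi> (\<bar>f x\<bar> / k')) \<partial>lebesgue) / emeasure lebesgue Q \<le> 1"
    using assms(1) unfolding luxemburg_avg_def Inf_less_iff by auto
  let ?I = "\<integral>\<^sup>+x\<in>Q. ennreal (\<Phi> (\<bar>f x\<bar> / k')) \<partial>lebesgue"
  have Q: "emeasure lebesgue Q \<noteq> 0" "emeasure lebesgue Q \<noteq> \<infinity>"
    using cube_lebesgue(3,4)[OF assms(2)] by auto
  have "?I = ?I / emeasure lebesgue Q * emeasure lebesgue Q"
    unfolding ennreal_divide_times using Q by (simp add: less_top)
  also have "\<dots> \<le> 1 * emeasure lebesgue Q" by (intro mult_right_mono k'(3)) simp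
  finally show ?thesis using that[of k'] k' by (simp add: ennreal_less_iff)
qed

text \<open>It remains to place the set in question inside a jump set: \<open>young_ge_powr\<close>
  turns the denominator into a bound m for all averages of \<open>w\<close>, and the numerator
  provides a cube on which the function \<open>b\<close> at L m has average above 1.\<close>

theorem corollary2:
  fixes r \<delta> :: real and \<Phi> :: "real \<Rightarrow> real" and u v :: "real^'n \<Rightarrow> real"
  assumes "r \<ge> 1" and "\<delta> \<ge> 0" and "\<Phi> \<in> young_class r \<delta>"
    and "muckenhoupt_A1 u"
    and "weight v" and "muckenhoupt_A_infinity (\<lambda>x. v x powr r)"
  shows "\<exists>\<epsilon>0>0. \<forall>\<epsilon>. 0 < \<epsilon> \<and> \<epsilon> < \<epsilon>0 \<longrightarrow>
    (\<exists>C>0. \<forall>t>0. \<forall>f \<in> borel_measurable lebesgue.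
      weighted_measure (\<lambda>x. u x * v x powr r)
        {x. maximal_op \<Phi> (\<lambda>y. f y * v y) x / maximal_op \<Phi> v x > ennreal t}
      \<le> ennreal C *
        (\<integral>\<^sup>+x. ennreal ((eta \<delta> \<epsilon> \<circ> \<Phi>) (\<bar>f x\<bar> / t) * u x * v x powr r) \<partial>lebesgue))"
proof (rule exI[of _ 1], intro conjI allI impI)
  note Y = assms(1-3)
  note nonneg = young_nonneg[OF Y] and mono = young_mono[OF Y]
  define w where "w x = v x powr r" for x
  have w: "weight w" using assms(6) by (simp add: muckenhoupt_A_infinity_def w_def[abs_def])
  have u: "weight u" using assms(4) by (simp add: muckenhoupt_A1_def)
  have sw: "spread w" using A_infinity_spread[OF assms(6)] by (simp add: w_def[abs_def])
  have v0: "0 \<le> v x" and u0: "0 \<le> u x" and w0: "0 \<le> w x" for x using assms(5) u w by (auto simp: weight_def)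
  have [measurable]: "u \<in> borel_measurable lebesgue" "w \<in> borel_measurable lebesgue" "v \<in> borel_measurable lebesgue"
    using u w assms(5) weight_measurable by auto
  have vw: "v x = w x powr (1 / r)" for x using v0[of x] assms(1) by (simp add: w_def powr_powr)
  fix \<epsilon> :: real assume "0 < \<epsilon> \<and> \<epsilon> < 1"
  then have \<epsilon>: "0 < \<epsilon>" "\<epsilon> < 1" by auto
  obtain \<kappa> where \<kappa>: "\<kappa> > 0" and weak:
    "\<And>A B. A > 0 \<Longrightarrow> B > 0 \<Longrightarrow> \<exists>L>0. \<exists>C>0. \<forall>b G. dominated w A B \<kappa> b G \<longrightarrow>
       weighted_measure (\<lambda>x. u x * w x) (jump_set w b L) \<le> ennreal C * (\<integral>\<^sup>+x. G x * ennreal (u x * w x) \<partial>lebesgue)"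
    by (rule weak_type[OF assms(4) sw]) (rule that)
  obtain A B where AB: "A > 0" "B > 0" and prod:
    "\<And>s z. 0 \<le> s \<Longrightarrow> 0 \<le> z \<Longrightarrow> \<Phi> (s * z) \<le> A * (z powr r * eta \<delta> \<epsilon> (\<Phi> s)) + B * (z powr r) powr (1 + \<kappa>)"
    by (rule young_product_bound[OF Y \<epsilon> \<kappa>]) (rule that)
  obtain CY where CY: "CY > 0" "\<And>t. 0 \<le> t \<Longrightarrow> t powr r \<le> 1 + CY * \<Phi> t" using young_ge_powr[OF Y] by metis
  obtain L C where L: "L > 0" and C: "C > 0" and weak': "\<And>b G. dominated w A B \<kappa> b G \<Longrightarrow>
       weighted_measure (\<lambda>x. u x * w x) (jump_set w b L) \<le> ennreal C * (\<integral>\<^sup>+x. G x * ennreal (u x * w x) \<partial>lebesgue)"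
    using weak[OF AB] by blast
  \<comment> \<open>Chosen so that (L m)^(1/r) = K k for m = (1 + CY) k^r. The factor
    \<open>K\<close> built into \<open>F\<close> then cancels, and F (w / (L m))^(1/r) is exactly
    the absolute value of f v divided by s = t k.\<close>
  define K where "K = (L * (1 + CY)) powr (1 / r)"
  have K: "K > 0" using L CY by (simp add: K_def)
  \<comment> \<open>The value of \<eta> at \<Phi>(K) is the price for removing \<open>K\<close> from
    \<open>F\<close> by submultiplicativity of \<Phi> and \<eta>; the added 1 secures
    positivity.\<close>
  define C' where "C' = C * eta \<delta> \<epsilon> (\<Phi> K) + 1"
  have eK: "0 \<le> eta \<delta> \<epsilon> (\<Phi> K)" using K nonneg by (simp add: eta_nonneg)
  show "\<exists>C>0. \<forall>t>0. \<forall>f \<in> borel_measurable lebesgue.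
      weighted_measure (\<lambda>x. u x * v x powr r)
        {x. maximal_op \<Phi> (\<lambda>y. f y * v y) x / maximal_op \<Phi> v x > ennreal t}
      \<le> ennreal C *
        (\<integral>\<^sup>+x. ennreal ((eta \<delta> \<epsilon> \<circ> \<Phi>) (\<bar>f x\<bar> / t) * u x * v x powr r) \<partial>lebesgue)"
  proof (intro exI[of _ C'] conjI allI impI ballI)
    show "C' > 0" using C eK by (simp add: C'_def add_nonneg_pos)
    fix t :: real and f :: "real^'n \<Rightarrow> real"
    assume t: "t > 0" and f [measurable]: "f \<in> borel_measurable lebesgue"
    define F where "F y = K * (\<bar>f y\<bar> / t)" for y
    have F0: "0 \<le> F y" for y using K t by (simp add: F_def)
    have [measurable]: "F \<in> borel_measurable lebesgue" unfolding F_def[abs_def] by measurable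
    define b where "b l y = ennreal (\<Phi> (F y * (w y / l) powr (1 / r)))" for l y
    define G where "G y = ennreal (eta \<delta> \<epsilon> (\<Phi> (F y)))" for y
    define E where "E = jump_set w b L"
    have "weighted_measure (\<lambda>x. u x * w x) E \<le> ennreal C * (\<integral>\<^sup>+x. G x * ennreal (u x * w x) \<partial>lebesgue)"
      unfolding E_def
    proof (rule weak', unfold dominated_def, intro conjI allI impI)
      show "b l \<in> borel_measurable lebesgue" for l
      proof -
        have "(\<lambda>y. \<Phi> (F y * (w y / l) powr (1 / r))) \<in> borel_measurable lebesgue"
          using F0 by (intro young_measurable[OF Y]) auto
        then show ?thesis unfolding b_def[abs_def] by measurable
      qed
      have [measurable]: "(\<lambda>y. \<Phi> (F y)) \<in> borel_measurable lebesgue" using F0 by (intro young_measurable[OF Y]) auto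
      show "G \<in> borel_measurable lebesgue" unfolding G_def[abs_def] by measurable
      show "b l' y \<le> b l y" if "0 < l" "l \<le> l'" for l l' y
        unfolding b_def using that w0[of y] F0[of y] assms(1)
        by (intro ennreal_leI mono mult_left_mono powr_mono2 divide_left_mono) auto
      show "b l y \<le> ennreal A * (ennreal (w y / l) * G y) + ennreal (B * (w y / l) powr (1 + \<kappa>))" if "0 < l" for l y
      proof -
        have z: "((w y / l) powr (1 / r)) powr r = w y / l" using w0[of y] that assms(1) by (simp add: powr_powr)
        have e: "0 \<le> eta \<delta> \<epsilon> (\<Phi> (F y))" using F0 nonneg by (simp add: eta_nonneg)
        have "\<Phi> (F y * (w y / l) powr (1 / r)) \<le> A * (w y / l * eta \<delta> \<epsilon> (\<Phi> (F y))) + B * (w y / l) powr (1 + \<kappa>)"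
          using prod[of "F y" "(w y / l) powr (1 / r)"] F0[of y] unfolding z by simp
        then have "b l y \<le> ennreal (A * (w y / l * eta \<delta> \<epsilon> (\<Phi> (F y))) + B * (w y / l) powr (1 + \<kappa>))"
          unfolding b_def by (rule ennreal_leI)
        also have "\<dots> = ennreal A * (ennreal (w y / l) * G y) + ennreal (B * (w y / l) powr (1 + \<kappa>))"
        proof -
          have "0 \<le> w y / l" using w0[of y] that by simp
          then have "ennreal (A * (w y / l * eta \<delta> \<epsilon> (\<Phi> (F y)))) = ennreal A * (ennreal (w y / l) * G y)"
            unfolding G_def using AB by (simp only: ennreal_mult' less_imp_le)
          moreover have "0 \<le> A * (w y / l * eta \<delta> \<epsilon> (\<Phi> (F y)))" 
            using AB e \<open>0 \<le> w y / l\<close> by (intro mult_nonneg_nonneg) auto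
          ultimately show ?thesis using AB by (subst ennreal_plus) auto
        qed
        finally show ?thesis .
      qed
    qed
    moreover have "{x. maximal_op \<Phi> (\<lambda>y. f y * v y) x / maximal_op \<Phi> v x > ennreal t} \<subseteq> E"
    proof
      fix x
      define \<alpha> where "\<alpha> = maximal_op \<Phi> (\<lambda>y. f y * v y) x"
      assume "x \<in> {x. maximal_op \<Phi> (\<lambda>y. f y * v y) x / maximal_op \<Phi> v x > ennreal t}"
      then have quot: "ennreal t < \<alpha> / maximal_op \<Phi> v x" by (simp add: \<alpha>_def)
      \<comment> \<open>Division by infinity gives 0, so points with an infinite denominator do not
        belong to the set.\<close>
      then have "maximal_op \<Phi> v x \<noteq> top" by (auto simp: ennreal_divide_top)
      then obtain \<beta> where \<beta>: "\<beta> \<ge> 0" "maximal_op \<Phi> v x = ennreal \<beta>" by (cases "maximal_op \<Phi> v x") auto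
      have "ennreal (t * \<beta>) < \<alpha>"
      proof (rule ccontr)
        assume "\<not> ennreal (t * \<beta>) < \<alpha>"
        then have "\<alpha> / ennreal \<beta> \<le> ennreal (t * \<beta>) / ennreal \<beta>" by (intro divide_right_mono_ennreal) simp
        also have "\<dots> \<le> ennreal t"
          using \<beta>(1) t by (cases "\<beta> = 0") (auto simp: divide_ennreal)
        finally show False using quot \<beta>(2) by simp
      qed
      \<comment> \<open>An intermediate value is a positive real even if the denominator vanishes or
        the numerator is infinite. The room on both sides gives strict inequalities for both
        Luxemburg averages.\<close>
      then obtain a where a: "ennreal (t * \<beta>) < a" "a < \<alpha>" using dense by blast
      then obtain s where s: "s \<ge> 0" "a = ennreal s" by (cases a) auto
      define k where "k = s / t"
      have "t * \<beta> < s" using a(1) s \<beta>(1) t by (simp add: ennreal_less_iff)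
      moreover have "0 \<le> t * \<beta>" using t \<beta>(1) by simp
      ultimately have "s > 0" by linarith
      then have k: "\<beta> < k" "k > 0" "s = t * k" using t \<open>t * \<beta> < s\<close> by (auto simp: k_def field_simps)
      \<comment> \<open>On every cube containing x the average of \<Phi>(v / k') is at most 1 for
        some k' < k, so \<open>young_ge_powr\<close> bounds the average of v^r by (1 + CY)
        k'^r.\<close>
      define m where "m = (1 + CY) * k powr r"
      have m: "m > 0" using CY k by (simp add: m_def)
      have avgs: "emeasure (wm w) Q \<le> ennreal m * emeasure lebesgue Q" if Q: "cube Q" "x \<in> Q" for Q
      proof -
        have "luxemburg_avg \<Phi> Q v \<le> ennreal \<beta>"
          unfolding \<beta>(2)[symmetric] maximal_op_def using Q by (intro SUP_upper) auto
        also have "\<dots> < ennreal k" using k \<beta>(1) by (simp add: ennreal_less_iff)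
        finally obtain k' where k': "0 < k'" "k' < k" "(\<integral>\<^sup>+x\<in>Q. ennreal (\<Phi> (\<bar>v x\<bar> / k')) \<partial>lebesgue) \<le> emeasure lebesgue Q"
          using luxemburg_avg_less[OF _ Q(1)] by blast
        note Qm [measurable] = cube_lebesgue(1)[OF Q(1)]
        have [measurable]: "(\<lambda>x. \<Phi> (\<bar>v x\<bar> / k')) \<in> borel_measurable lebesgue"
          using k' by (intro young_measurable[OF Y]) auto
        have "emeasure (wm w) Q = (\<integral>\<^sup>+x. ennreal (w x) * indicator Q x \<partial>lebesgue)" by (rule emeasure_wm[OF w Qm])
        also have "\<dots> \<le> (\<integral>\<^sup>+x. ennreal (k' powr r) * (indicator Q x + ennreal CY * (ennreal (\<Phi> (\<bar>v x\<bar> / k')) * indicator Q x)) \<partial>lebesgue)"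
        proof (intro nn_integral_mono)
          fix y
          have "w y = k' powr r * (\<bar>v y\<bar> / k') powr r"
            using v0[of y] k' by (simp add: w_def powr_divide)
          also have "\<dots> \<le> k' powr r * (1 + CY * \<Phi> (\<bar>v y\<bar> / k'))"
            using k' by (intro mult_left_mono CY) auto
          finally have "ennreal (w y) \<le> ennreal (k' powr r * (1 + CY * \<Phi> (\<bar>v y\<bar> / k')))" by (rule ennreal_leI)
          also have "\<dots> = ennreal (k' powr r) * (1 + ennreal CY * ennreal (\<Phi> (\<bar>v y\<bar> / k')))"
            using CY k' nonneg[of "\<bar>v y\<bar> / k'"] by (simp add: ennreal_plus ennreal_mult)
          finally show "ennreal (w y) * indicator Q y \<le> ennreal (k' powr r) * (indicator Q y + ennreal CY * (ennreal (\<Phi> (\<bar>v y\<bar> / k')) * indicator Q y))"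
            by (auto split: split_indicator)
        qed
        also have "\<dots> = ennreal (k' powr r) * (emeasure lebesgue Q + ennreal CY * (\<integral>\<^sup>+x\<in>Q. ennreal (\<Phi> (\<bar>v x\<bar> / k')) \<partial>lebesgue))"
          by (simp add: nn_integral_cmult nn_integral_add)
        also have "\<dots> \<le> ennreal (k' powr r) * (emeasure lebesgue Q + ennreal CY * emeasure lebesgue Q)"
          by (intro mult_left_mono add_left_mono k'(3)) auto
        also have "\<dots> = ennreal (k' powr r * (1 + CY)) * emeasure lebesgue Q"
          using CY by (simp add: ennreal_plus ennreal_mult distrib_right mult.assoc)
        also have "\<dots> \<le> ennreal m * emeasure lebesgue Q"
          unfolding m_def using k' CY assms(1)
          by (subst mult.commute[of "1 + CY"], intro mult_right_mono ennreal_leI powr_mono2) auto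
        finally show ?thesis .
      qed
      have "ennreal s < maximal_op \<Phi> (\<lambda>y. f y * v y) x" using a(2) s by (simp add: \<alpha>_def)
      then obtain Q where Q: "cube Q" "x \<in> Q" "ennreal s < luxemburg_avg \<Phi> Q (\<lambda>y. f y * v y)"
        unfolding maximal_op_def less_SUP_iff by auto
      have "emeasure lebesgue Q < (\<integral>\<^sup>+y\<in>Q. ennreal (\<Phi> (\<bar>f y * v y\<bar> / s)) \<partial>lebesgue)"
        by (rule luxemburg_avg_gt[OF Q(3) \<open>s > 0\<close> Q(1)])
      also have "(\<lambda>y. ennreal (\<Phi> (\<bar>f y * v y\<bar> / s))) = b (L * m)"
      proof
        fix y
        have "(L * m) powr (1 / r) = K * k"
          using L CY k assms(1) by (simp add: m_def K_def powr_mult powr_powr)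
        then have "F y * (w y / (L * m)) powr (1 / r) = \<bar>f y * v y\<bar> / s"
          using w0[of y] v0[of y] L m K k t by (simp add: F_def powr_divide flip: vw) (simp add: k(3) abs_mult)
        then show "ennreal (\<Phi> (\<bar>f y * v y\<bar> / s)) = b (L * m) y" by (simp add: b_def)
      qed
      finally show "x \<in> E" unfolding E_def jump_set_def using m avgs Q(1,2) by blast
    qed
    then have "weighted_measure (\<lambda>x. u x * v x powr r) {x. maximal_op \<Phi> (\<lambda>y. f y * v y) x / maximal_op \<Phi> v x > ennreal t}
       \<le> weighted_measure (\<lambda>x. u x * w x) E"
      unfolding weighted_measure_def w_def by (intro nn_integral_mono) (auto split: split_indicator)
    ultimately have "weighted_measure (\<lambda>x. u x * v x powr r) {x. maximal_op \<Phi> (\<lambda>y. f y * v y) x / maximal_op \<Phi> v x > ennreal t}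
       \<le> ennreal C * (\<integral>\<^sup>+x. G x * ennreal (u x * w x) \<partial>lebesgue)" by simp
    also have "\<dots> \<le> ennreal C * (\<integral>\<^sup>+x. ennreal (eta \<delta> \<epsilon> (\<Phi> K)) * ennreal ((eta \<delta> \<epsilon> \<circ> \<Phi>) (\<bar>f x\<bar> / t) * u x * v x powr r) \<partial>lebesgue)"
    proof (intro mult_left_mono nn_integral_mono)
      fix x
      have ft: "0 \<le> \<bar>f x\<bar> / t" using t by simp
      have "eta \<delta> \<epsilon> (\<Phi> (F x)) \<le> eta \<delta> \<epsilon> (\<Phi> K * \<Phi> (\<bar>f x\<bar> / t))"
        unfolding F_def using K ft assms(2) \<epsilon> F0[of x]
        by (intro eta_mono young_submult[OF Y] nonneg) (auto simp: F_def)
      also have "\<dots> \<le> eta \<delta> \<epsilon> (\<Phi> K) * eta \<delta> \<epsilon> (\<Phi> (\<bar>f x\<bar> / t))"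
        using K ft assms(2) \<epsilon> by (intro eta_mult nonneg) auto
      finally have "eta \<delta> \<epsilon> (\<Phi> (F x)) * (u x * w x) \<le> eta \<delta> \<epsilon> (\<Phi> K) * eta \<delta> \<epsilon> (\<Phi> (\<bar>f x\<bar> / t)) * (u x * w x)"
        using u0 w0 by (intro mult_right_mono) auto
      then have "ennreal (eta \<delta> \<epsilon> (\<Phi> (F x)) * (u x * w x)) \<le> ennreal (eta \<delta> \<epsilon> (\<Phi> K) * ((eta \<delta> \<epsilon> \<circ> \<Phi>) (\<bar>f x\<bar> / t) * u x * v x powr r))"
        by (intro ennreal_leI) (simp add: w_def mult_ac)
      moreover have "ennreal (eta \<delta> \<epsilon> (\<Phi> (F x)) * (u x * w x)) = G x * ennreal (u x * w x)"
        unfolding G_def using F0[of x] nonneg by (intro ennreal_mult') (simp add: eta_nonneg)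
      ultimately show "G x * ennreal (u x * w x) \<le> ennreal (eta \<delta> \<epsilon> (\<Phi> K)) * ennreal ((eta \<delta> \<epsilon> \<circ> \<Phi>) (\<bar>f x\<bar> / t) * u x * v x powr r)"
        using eK by (simp add: ennreal_mult')
    qed simp
    also have "\<dots> = ennreal C * (ennreal (eta \<delta> \<epsilon> (\<Phi> K)) * (\<integral>\<^sup>+x. ennreal ((eta \<delta> \<epsilon> \<circ> \<Phi>) (\<bar>f x\<bar> / t) * u x * v x powr r) \<partial>lebesgue))"
    proof -
      have [measurable]: "(\<lambda>x. \<Phi> (\<bar>f x\<bar> / t)) \<in> borel_measurable lebesgue" using t by (intro young_measurable[OF Y]) auto
      show ?thesis by (subst nn_integral_cmult) (auto simp: o_def)
    qed
    also have "\<dots> = ennreal (C * eta \<delta> \<epsilon> (\<Phi> K)) * (\<integral>\<^sup>+x. ennreal ((eta \<delta> \<epsilon> \<circ> \<Phi>) (\<bar>f x\<bar> / t) * u x * v x powr r) \<partial>lebesgue)"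
      using C by (simp add: ennreal_mult' mult.assoc)
    also have "\<dots> \<le> ennreal C' * (\<integral>\<^sup>+x. ennreal ((eta \<delta> \<epsilon> \<circ> \<Phi>) (\<bar>f x\<bar> / t) * u x * v x powr r) \<partial>lebesgue)"
      by (intro mult_right_mono ennreal_leI) (auto simp: C'_def)
    finally show "weighted_measure (\<lambda>x. u x * v x powr r) {x. maximal_op \<Phi> (\<lambda>y. f y * v y) x / maximal_op \<Phi> v x > ennreal t}
       \<le> ennreal C' * (\<integral>\<^sup>+x. ennreal ((eta \<delta> \<epsilon> \<circ> \<Phi>) (\<bar>f x\<bar> / t) * u x * v x powr r) \<partial>lebesgue)" .
  qed
qed simp

end
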